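(* Let $f,g\in{\cal M}(\mathbb{K})$ be transcendental and let $\alpha\in{\cal M}(\mathbb{K})$ be non-identically zero and small with respect to both $f$ and $g$. Let $a\in\mathbb{K}\setminus\{0\}$ and let $n$ be a positive integer. If $f'f^n(f-a)$ and $g'g^n(g-a)$ share $\alpha$ C.M. and $n\geq 12$, then either $f=g$ or there exists $h\in{\cal M}(\mathbb{K})$ such that $$f=\frac{a(n+2)}{n+1}\Big(\frac{h^{n+1}-1}{h^{n+2}-1}\Big)h,\qquad g=\frac{a(n+2)}{n+1}\Big(\frac{h^{n+1}-1}{h^{n+2}-1}\Big).$$ Moreover, if $\alpha$ is a non-zero constant or a Moebius function, the same conclusion holds whenever $n\geq 11$.
   Context: $\mathbb{K}$ is an algebraically closed field of characteristic zero, complete with respect to an ultrametric absolute value $|\cdot|$. ${\cal M}(\mathbb{K})$ is the field of meromorphic functions on $\mathbb{K}$, i.e. the field of fractions of the ring of entire functions (power series converging on all of $\mathbb{K}$). A function in ${\cal M}(\mathbb{K})$ is transcendental if it is not a rational function. For $h\in{\cal M}(\mathbb{K})$ and $\gamma\in\mathbb{K}$, $\omega_\gamma(h)$ is $m$ if $h$ has a zero of order $m$ at $\gamma$, $-m$ if a pole of order $m$, $0$ otherwise. For $h$ with no zero or pole at $0$ and $r>0$: $Z(r,h)=\sum_{\omega_\gamma(h)>0,\ |\gamma|\leq r}\omega_\gamma(h)(\log r-\log|\gamma|)$, $N(r,h)=Z(r,1/h)$, $T(r,h)=\max\{Z(r,h)+\log|h(0)|,N(r,h)\}$. $\alpha$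 is small with respect to $f$ if $\lim_{r\to+\infty}T(r,\alpha)/T(r,f)=0$ (if $0$ is a zero or pole of $f$ or $\alpha$, one first translates the variable; the condition does not depend on this). A Moebius function is a rational function $x\mapsto\frac{cx+d}{ex+h}$ with $ch-de\neq0$. Two meromorphic functions $F,G$ share $\alpha$ C.M. if $F-\alpha$ and $G-\alpha$ have the same zeroes with the same multiplicities. *)

theory Defs
  imports
    Complex_Main
    "HOL-Computational_Algebra.Formal_Laurent_Series"
    "HOL-Computational_Algebra.Polynomial_FPS"
begin

text \<open>
  Fields with an ultrametric absolute value. The distance is \<open>absval (x - y)\<close>, so that
  the library's \<^const>\<open>summable\<close>, \<^const>\<open>suminf\<close> and \<^class>\<open>complete_space\<close> refer to this absolute
  value. A separate class parameter is used because \<^const>\<open>norm\<close> is reserved for real normed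
  vector spaces, where the norm is archimedean.
\<close>

class ultrametric_field = field + metric_space +
  fixes absval :: "'a \<Rightarrow> real"
  assumes absval_nonneg: "absval x \<ge> 0"
    and absval_eq_0_iff: "absval x = 0 \<longleftrightarrow> x = 0"
    and absval_mult: "absval (x * y) = absval x * absval y"
    and absval_add: "absval (x + y) \<le> max (absval x) (absval y)"
    and dist_absval: "dist x y = absval (x - y)"

definition entire :: "'a::ultrametric_field fps \<Rightarrow> bool" where
  "entire p \<longleftrightarrow> (\<forall>x. summable (\<lambda>n. fps_nth p n * x ^ n))"

definition entire_eval :: "'a::ultrametric_field fps \<Rightarrow> 'a \<Rightarrow> 'a" where
  "entire_eval p x = (\<Sum>n. fps_nth p n * x ^ n)"

text \<open>
  The field of fractions of the ring of entire functions is realised inside the field of formal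
  Laurent series: a meromorphic function is represented by its Laurent expansion at the origin.
\<close>

definition meromorphic_fun :: "'a::ultrametric_field fls \<Rightarrow> bool" where
  "meromorphic_fun F \<longleftrightarrow>
     (\<exists>p q. entire p \<and> entire q \<and> q \<noteq> 0 \<and> F = fps_to_fls p / fps_to_fls q)"

definition rational_fun :: "'a::field fls \<Rightarrow> bool" where
  "rational_fun F \<longleftrightarrow>
     (\<exists>p q. q \<noteq> 0 \<and> F = fps_to_fls (fps_of_poly p) / fps_to_fls (fps_of_poly q))"

definition transcendental_fun :: "'a::ultrametric_field fls \<Rightarrow> bool" where
  "transcendental_fun F \<longleftrightarrow> meromorphic_fun F \<and> \<not> rational_fun F"

definition moebius_fun :: "'a::field fls \<Rightarrow> bool" where
  "moebius_fun F \<longleftrightarrow>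
     (\<exists>c d e h. c * h - d * e \<noteq> 0 \<and>
        F = (fls_const c * fls_X + fls_const d) / (fls_const e * fls_X + fls_const h))"

text \<open>
  \<open>has_order_at F \<gamma> k\<close>: at \<open>\<gamma>\<close>, \<open>F\<close> has a zero of order \<open>k\<close> if \<open>k > 0\<close>, a pole of order
  \<open>- k\<close> if \<open>k < 0\<close>, and neither if \<open>k = 0\<close>.
\<close>

definition has_order_at :: "'a::ultrametric_field fls \<Rightarrow> 'a \<Rightarrow> int \<Rightarrow> bool" where
  "has_order_at F \<gamma> k \<longleftrightarrow>
     (\<exists>p q. entire p \<and> entire q \<and> entire_eval p \<gamma> \<noteq> 0 \<and> entire_eval q \<gamma> \<noteq> 0 \<and>
        F = (fls_X - fls_const \<gamma>) powi k * (fps_to_fls p / fps_to_fls q))"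

text \<open>The identically zero function has no order at any point; it gets the dummy value 0.\<close>

definition omega :: "'a::ultrametric_field \<Rightarrow> 'a fls \<Rightarrow> int" where
  "omega \<gamma> F = (if F = 0 then 0 else (THE k. has_order_at F \<gamma> k))"

definition Z_count :: "real \<Rightarrow> 'a::ultrametric_field fls \<Rightarrow> real" where
  "Z_count r F =
     (\<Sum>\<gamma> | omega \<gamma> F > 0 \<and> absval \<gamma> \<le> r. of_int (omega \<gamma> F) * (ln r - ln (absval \<gamma>)))"

definition N_count :: "real \<Rightarrow> 'a::ultrametric_field fls \<Rightarrow> real" where
  "N_count r F = Z_count r (1 / F)"

text \<open>
  Only used for \<open>F\<close> with neither a zero nor a pole at 0; then the coefficient \<open>F $$ 0\<close> is the
  value of \<open>F\<close> at 0.
\<close>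

definition T_char :: "real \<Rightarrow> 'a::ultrametric_field fls \<Rightarrow> real" where
  "T_char r F = max (Z_count r F + ln (absval (fls_nth F 0))) (N_count r F)"

text \<open>\<open>is_translate c F G\<close>: \<open>G\<close> is the meromorphic function \<open>F(x + c)\<close>.\<close>

definition is_translate :: "'a::ultrametric_field \<Rightarrow> 'a fls \<Rightarrow> 'a fls \<Rightarrow> bool" where
  "is_translate c F G \<longleftrightarrow>
     (\<exists>p q p' q'. entire p \<and> entire q \<and> entire p' \<and> entire q' \<and> q \<noteq> 0 \<and> q' \<noteq> 0 \<and>
        F = fps_to_fls p / fps_to_fls q \<and> G = fps_to_fls p' / fps_to_fls q' \<and>
        (\<forall>x. entire_eval p' x = entire_eval p (x + c)) \<and>
        (\<forall>x. entire_eval q' x = entire_eval q (x + c)))"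

text \<open>
  The variable is translated so that neither function has a zero or a pole at 0. The
  condition does not depend on the choice of the translation, and \<open>c = 0\<close> is allowed whenever
  no translation is needed.
\<close>

definition small_wrt :: "'a::ultrametric_field fls \<Rightarrow> 'a fls \<Rightarrow> bool" where
  "small_wrt \<alpha> f \<longleftrightarrow>
     (\<exists>c A F. is_translate c \<alpha> A \<and> is_translate c f F \<and>
        A \<noteq> 0 \<and> F \<noteq> 0 \<and> omega 0 A = 0 \<and> omega 0 F = 0 \<and>
        ((\<lambda>r. T_char r A / T_char r F) \<longlongrightarrow> 0) at_top)"

text \<open>
  Sharing counting multiplicities: at every point the zero multiplicities of \<open>F - \<alpha>\<close> and
  \<open>G - \<alpha>\<close> agree. If one difference vanishes identically then so must the other.
\<close>

definition share_CM :: "'a::ultrametric_field fls \<Rightarrow> 'a fls \<Rightarrow> 'a fls \<Rightarrow> bool" where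
  "share_CM F G \<alpha> \<longleftrightarrow>
     (F - \<alpha> = 0 \<longleftrightarrow> G - \<alpha> = 0) \<and>
     (\<forall>\<gamma>. max 0 (omega \<gamma> (F - \<alpha>)) = max 0 (omega \<gamma> (G - \<alpha>)))"

end

theory Submission
  imports Defs
begin

text \<open>
  Put \<open>b = a (n + 2) / (n + 1)\<close> and \<open>P(x) = x^(n+1) (x - b) / (n + 2)\<close>, so that the two differential
  monomials are \<open>F = P(f)'\<close> and \<open>G = P(g)'\<close>, and let \<open>\<phi> = F / \<alpha>\<close>, \<open>\<psi> = G / \<alpha>\<close>. The Gauss norms
  \<open>|h|_r\<close> are multiplicative, they satisfy \<open>|h'|_r \<le> |h|_r / r\<close>, and \<open>ln |h|_r\<close> is, up to a constant, the
  difference of the counting functions of the zeros and poles of \<open>h\<close> (Jensen's formula). Hence every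
  upper bound for \<open>ln |\<Theta>|_r\<close> can be checked point by point on the orders of \<open>\<Theta>\<close>.

  The functions \<open>\<phi> / (\<phi> - 1)\<close>, \<open>1 / (\<phi> - 1)\<close>, \<open>\<psi> / (\<psi> - 1)\<close>, \<open>1 / (\<psi> - 1)\<close> span a space of
  dimension at most 3. If it is 3, let \<open>W\<close> be their Wronskian and \<open>\<Theta>\<close> the product of the last three
  functions divided by \<open>W\<close>. Derivatives being small, \<open>ln |\<Theta>|_r \<ge> 3 ln r + max 0 (- ln |\<phi>|_r)\<close>, while
  away from the zeros and poles of \<open>\<alpha>\<close> the common 1-points of \<open>\<phi>\<close> and \<open>\<psi>\<close> do not contribute to the
  zeros of \<open>\<Theta>\<close>. Together with \<open>(n + 2) T(f) \<le> Z(P(f)) + max 0 (- ln |F|_r) + O(1)\<close> this gives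
  \<open>(n + 2) T(f) \<le> 6 T(f) + 7 T(g) - 4 ln r + E\<close> with
  \<open>E = 2 Z(\<alpha>) + N(\<alpha>) + max 0 (- ln |\<alpha>|_r) + O(1)\<close>. Adding the inequality with \<open>f\<close> and \<open>g\<close> exchanged
  is contradictory for \<open>n + 2 > 13\<close>, as \<open>E\<close> is small, and for \<open>n + 2 = 13\<close> if \<open>E \<le> 3 ln r + O(1)\<close>, which
  holds for constants and Moebius functions.

  If the dimension is 2, then \<open>\<psi>\<close> is a Moebius transform of \<open>\<phi>\<close> and the second main theorem for three
  values leaves only \<open>F = G\<close> and \<open>F G = \<alpha>^2\<close>. In the latter case the zeros of \<open>f\<close> and \<open>f - a\<close> lie at poles
  of \<open>g\<close> and have high multiplicity (up to zeros and poles of \<open>\<alpha>\<close>), which is again excluded by the second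
  main theorem. Finally \<open>F = G\<close> means \<open>P(f) = P(g) + d\<close>; the second main theorem for \<open>P(f)\<close> forces
  \<open>d = 0\<close>, and \<open>h = f / g\<close> solves \<open>g (h^(n+2) - 1) = b (h^(n+1) - 1)\<close>.
\<close>

subsection \<open>Ultrametric absolute values\<close>

text \<open>Sharing only concerns the zeros of F - \<alpha> and says nothing about \<phi> and \<psi>
  at the zeros and poles of \<alpha>, yet the count must be sharp: for n = 11 both sides carry the
  coefficient 13 and only multiples of ln r decide. The 13 is 6 + 7. For f, a zero costs 3 (1
  because F = P(f)' loses one order, 2 from the Wronskian), a zero of f - b costs 1 and a pole 2.
  For g, only orders of G truncated at 2 enter: 2 for zeros, 1 for zeros of g - a, 2 for poles, and
  the zeros of g'/g, which number at most 2 T(g) - ln r. The columns of a 3 by 3 Wronskian are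
  differentiated 0 + 1 + 2 times, whence 3 ln r; with the one from g'/g this makes 4, more than the
  3 that a Moebius function can cost.

  The dimension is at most 3 from the outset because \<phi> / (\<phi> - 1) = 1 + 1 / (\<phi> - 1).
  So a column may be shifted by 1 without changing the Wronskian, and taking at each point the
  version that vanishes there to the higher order is what yields the sharp local bounds.\<close>

lemma absval_0 [simp]: "absval (0 :: 'a :: ultrametric_field) = 0"
  by (simp add: absval_eq_0_iff)

lemma absval_eq_0 [simp]: "absval (x :: 'a :: ultrametric_field) = 0 \<longleftrightarrow> x = 0"
  by (rule absval_eq_0_iff)

lemma absval_pos [simp]: "absval (x :: 'a :: ultrametric_field) > 0 \<longleftrightarrow> x \<noteq> 0"
  using absval_nonneg[of x] absval_eq_0[of x] by linarith

lemma absval_1 [simp]: "absval (1 :: 'a :: ultrametric_field) = 1"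
  using absval_mult[of "1::'a" 1] by simp

lemma absval_minus [simp]: "absval (- x :: 'a :: ultrametric_field) = absval x"
proof -
  have "absval (-1 :: 'a) * absval (-1 :: 'a) = 1"
    by (simp flip: absval_mult)
  hence "absval (-1 :: 'a) = 1"
    using absval_nonneg[of "-1::'a"] square_eq_1_iff[of "absval (-1 :: 'a)"] by (smt (verit))
  thus ?thesis using absval_mult[of "-1" x] by simp
qed

lemma absval_minus_commute: "absval (x - y :: 'a :: ultrametric_field) = absval (y - x)"
  by (metis absval_minus minus_diff_eq)

lemma absval_power: "absval (x ^ n :: 'a :: ultrametric_field) = absval x ^ n"
  by (induction n) (simp_all add: absval_mult)

lemma absval_inverse: "absval (inverse x :: 'a :: ultrametric_field) = inverse (absval x)"
proof (cases "x = 0")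
  case False
  hence "absval x * absval (inverse x) = 1" by (simp flip: absval_mult)
  thus ?thesis by (metis inverse_unique)
qed simp

lemma absval_diff: "absval (x - y :: 'a :: ultrametric_field) \<le> max (absval x) (absval y)"
  using absval_add[of x "-y"] by simp

lemma absval_add_eq:
  fixes x y :: "'a :: ultrametric_field"
  assumes "absval y < absval x"
  shows "absval (x + y) = absval x"
  using absval_add[of x y] absval_diff[of "x + y" y] assms by (auto simp: max_def split: if_splits)

lemma absval_diff_eq:
  fixes x y :: "'a :: ultrametric_field"
  assumes "absval y < absval x"
  shows "absval (x - y) = absval x"
  using absval_add_eq[of "-y" x] assms by simp

lemma absval_sum_le:
  fixes f :: "'b \<Rightarrow> 'a :: ultrametric_field"
  assumes "\<And>i. i \<in> A \<Longrightarrow> absval (f i) \<le> B" "B \<ge> 0"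
  shows "absval (sum f A) \<le> B"
  using assms(1)
proof (induction A rule: infinite_finite_induct)
  case (insert x F)
  thus ?case using absval_add[of "f x" "sum f F"] by (auto intro: order_trans)
qed (use assms(2) in auto)

lemma absval_sum_less:
  fixes f :: "'b \<Rightarrow> 'a :: ultrametric_field"
  assumes "\<And>i. i \<in> A \<Longrightarrow> absval (f i) < B" "B > 0"
  shows "absval (sum f A) < B"
  using assms(1)
proof (induction A rule: infinite_finite_induct)
  case (insert x F)
  thus ?case using absval_add[of "f x" "sum f F"] by (auto intro: le_less_trans)
qed (use assms(2) in auto)

lemma absval_of_nat_le: "absval (of_nat n :: 'a :: ultrametric_field) \<le> 1"
proof (induction n)
  case (Suc n)
  thus ?case using absval_add[of "1::'a" "of_nat n"] by simp
qed simp

lemma tendsto_absval: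
  "(f \<longlongrightarrow> (L :: 'a :: ultrametric_field)) F \<longleftrightarrow> ((\<lambda>x. absval (f x - L)) \<longlongrightarrow> 0) F"
  by (subst tendsto_dist_iff) (simp add: dist_absval)

text \<open>Opens the library rules for limits and series that need a topological group, such as
  \<open>tendsto_diff\<close> and \<open>sums_add\<close>.\<close>

instance ultrametric_field \<subseteq> topological_ab_group_add
proof
  fix a b :: 'a
  have 1: "((\<lambda>x::'a \<times> 'a. absval (fst x - a)) \<longlongrightarrow> 0) (nhds a \<times>\<^sub>F nhds b)"
    unfolding tendsto_absval[symmetric] by (simp add: filterlim_def filtermap_fst_prod_filter)
  have 2: "((\<lambda>x::'a \<times> 'a. absval (snd x - b)) \<longlongrightarrow> 0) (nhds a \<times>\<^sub>F nhds b)"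
    unfolding tendsto_absval[symmetric] by (simp add: filterlim_def filtermap_snd_prod_filter)
  have "((\<lambda>x::'a \<times> 'a. absval (fst x + snd x - (a + b))) \<longlongrightarrow> 0) (nhds a \<times>\<^sub>F nhds b)"
  proof (rule tendsto_sandwich[OF _ _ tendsto_const])
    show "((\<lambda>x::'a \<times> 'a. absval (fst x - a) + absval (snd x - b)) \<longlongrightarrow> 0) (nhds a \<times>\<^sub>F nhds b)"
      using tendsto_add[OF 1 2] by simp
    have "absval (fst x + snd x - (a + b)) \<le> absval (fst x - a) + absval (snd x - b)" for x :: "'a \<times> 'a"
      using absval_add[of "fst x - a" "snd x - b"] absval_nonneg[of "fst x - a"]
        absval_nonneg[of "snd x - b"] by (simp add: algebra_simps max_def split: if_splits)
    thus "\<forall>\<^sub>F x::'a \<times> 'a in nhds a \<times>\<^sub>F nhds b.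
        absval (fst x + snd x - (a + b)) \<le> absval (fst x - a) + absval (snd x - b)" by simp
  qed (simp add: absval_nonneg)
  thus "LIM x (nhds a \<times>\<^sub>F nhds b). fst x + snd x :> nhds (a + b)"
    unfolding tendsto_absval .
  have "((\<lambda>x::'a. absval (x - a)) \<longlongrightarrow> 0) (nhds a)"
    unfolding tendsto_absval[symmetric] by (rule filterlim_ident)
  moreover have "absval (- x - - a) = absval (x - a)" for x :: 'a
    using absval_minus_commute[of x a] by simp
  ultimately show "(uminus \<longlongrightarrow> - a) (nhds a)" by (simp add: tendsto_absval)
qed

lemma tendsto_mult_left_ultrametric:
  fixes c :: "'a :: ultrametric_field"
  assumes "(f \<longlongrightarrow> L) F"
  shows "((\<lambda>x. c * f x) \<longlongrightarrow> c * L) F"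
proof -
  have "absval (c * f x - c * L) = absval c * absval (f x - L)" for x
    by (simp flip: absval_mult add: algebra_simps)
  moreover have "((\<lambda>x. absval c * absval (f x - L)) \<longlongrightarrow> absval c * 0) F"
    using assms unfolding tendsto_absval[of f] by (intro tendsto_intros)
  ultimately show ?thesis by (simp add: tendsto_absval[of "\<lambda>x. c * f x"])
qed

lemma sums_mult_ultrametric:
  fixes c :: "'a :: ultrametric_field"
  assumes "f sums s"
  shows "(\<lambda>n. c * f n) sums (c * s)"
  using tendsto_mult_left_ultrametric[of "\<lambda>n. \<Sum>i<n. f i" s sequentially c] assms
  by (simp add: sums_def sum_distrib_left)

lemma absval_lim_le:
  fixes L :: "'a :: ultrametric_field"
  assumes "X \<longlonglongrightarrow> L" and "\<And>n. absval (X n) \<le> B"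
  shows "absval L \<le> B"
proof (rule field_le_epsilon)
  fix e :: real assume "e > 0"
  then obtain n where "absval (X n - L) < e"
    using LIMSEQ_D[OF assms(1)[unfolded tendsto_absval], of e] by (auto simp: absval_nonneg)
  moreover have "absval L \<le> max (absval (X n)) (absval (X n - L))"
    using absval_diff[of "X n" "X n - L"] by simp
  moreover have "B \<ge> 0" using assms(2)[of 0] absval_nonneg[of "X 0"] by simp
  ultimately show "absval L \<le> B + e" using assms(2)[of n] \<open>e > 0\<close> by linarith
qed

lemma sums_absval_le:
  fixes s :: "'a :: ultrametric_field"
  assumes "f sums s" and "\<And>n. absval (f n) \<le> B"
  shows "absval s \<le> B"
proof -
  have "B \<ge> 0" using assms(2)[of 0] absval_nonneg[of "f 0"] by linarith
  hence "absval (\<Sum>i<n. f i) \<le> B" for n using assms(2) by (intro absval_sum_le)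
  thus ?thesis using assms(1) unfolding sums_def by (rule absval_lim_le[rotated])
qed

text \<open>By the strong triangle inequality a distance along the sequence is at most the largest
  single step in between. Hence a series converges as soon as its terms tend to 0.\<close>

lemma Cauchy_ultrametric:
  fixes X :: "nat \<Rightarrow> 'a :: ultrametric_field"
  assumes "(\<lambda>n. absval (X (Suc n) - X n)) \<longlonglongrightarrow> 0"
  shows "Cauchy X"
proof (rule metric_CauchyI)
  fix e :: real assume e: "e > 0"
  then obtain N where N: "\<And>n. n \<ge> N \<Longrightarrow> absval (X (Suc n) - X n) < e"
    using LIMSEQ_D[OF assms e] by (auto simp: absval_nonneg)
  have *: "absval (X n - X N) < e" if "n \<ge> N" for n
    using that
  proof (induction n rule: dec_induct)
    case (step n)
    show ?case
      using absval_add[of "X (Suc n) - X n" "X n - X N"] N[of n] step by simp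
  qed (use e in simp)
  have "dist (X m) (X n) < e" if "m \<ge> N" "n \<ge> N" for m n
    using absval_diff[of "X m - X N" "X n - X N"] *[OF that(1)] *[OF that(2)]
    unfolding dist_absval by simp
  thus "\<exists>M. \<forall>m\<ge>M. \<forall>n\<ge>M. dist (X m) (X n) < e" by blast
qed

lemma summable_ultrametric_iff:
  fixes f :: "nat \<Rightarrow> 'a :: {ultrametric_field, complete_space}"
  shows "summable f \<longleftrightarrow> (\<lambda>n. absval (f n)) \<longlonglongrightarrow> 0"
proof
  assume "summable f"
  then obtain s where s: "f sums s" by (auto simp: summable_def)
  hence "(\<lambda>n. (\<Sum>i<Suc n. f i) - (\<Sum>i<n. f i)) \<longlonglongrightarrow> s - s"
    unfolding sums_def by (intro tendsto_diff filterlim_compose[OF _ filterlim_Suc])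
  thus "(\<lambda>n. absval (f n)) \<longlonglongrightarrow> 0" by (simp add: tendsto_absval)
next
  assume "(\<lambda>n. absval (f n)) \<longlonglongrightarrow> 0"
  hence "Cauchy (\<lambda>n. \<Sum>i<n. f i)" by (intro Cauchy_ultrametric) simp
  thus "summable f" by (simp add: Cauchy_convergent summable_iff_convergent)
qed

subsection \<open>Entire functions and Gauss norms\<close>

definition gterm :: "real \<Rightarrow> 'a::ultrametric_field fps \<Rightarrow> nat \<Rightarrow> real" where
  "gterm r p n = absval (fps_nth p n) * r ^ n"

lemma gterm_nonneg: "r \<ge> 0 \<Longrightarrow> gterm r p n \<ge> 0"
  by (simp add: gterm_def absval_nonneg)

lemma tendsto_0_squeeze:
  fixes f g :: "nat \<Rightarrow> real"
  assumes "g \<longlonglongrightarrow> c" "c = 0" "\<And>n. 0 \<le> f n" "\<And>n. f n \<le> g n"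
  shows "f \<longlonglongrightarrow> 0"
  by (rule tendsto_sandwich[OF _ _ tendsto_const assms(1)[unfolded assms(2)]]) (use assms in auto)

text \<open>An absolute value bounded by 1 is trivial, since the inverse of a small nonzero element
  would be large.\<close>

lemma trivial_absval_small:
  fixes y :: "'a :: ultrametric_field"
  assumes "\<not> (\<exists>x::'a. absval x > 1)" "absval y < 1"
  shows "y = 0"
proof (rule ccontr)
  assume "y \<noteq> 0"
  hence "absval (inverse y) > 1" using assms(2) by (simp add: absval_inverse one_less_inverse)
  thus False using assms(1) by blast
qed

text \<open>The definition only sees radii that are absolute values of points. Powers of one point
  with absolute value above 1 exceed every radius; if there is no such point, convergence at 1
  forces almost all coefficients to vanish.\<close>

lemma entire_iff:
  fixes p :: "'a :: {ultrametric_field, complete_space} fps"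
  shows "entire p \<longleftrightarrow> (\<forall>r>0. gterm r p \<longlonglongrightarrow> 0)"
proof
  assume p: "entire p"
  have *: "(\<lambda>n. gterm (absval x) p n) \<longlonglongrightarrow> 0" for x :: 'a
  proof -
    have "summable (\<lambda>n. fps_nth p n * x ^ n)" using p unfolding entire_def by blast
    thus ?thesis by (simp add: summable_ultrametric_iff gterm_def absval_mult absval_power)
  qed
  show "\<forall>r>0. gterm r p \<longlonglongrightarrow> 0"
  proof (intro allI impI)
    fix r :: real assume r: "r > 0"
    show "gterm r p \<longlonglongrightarrow> 0"
    proof (cases "\<exists>x::'a. absval x > 1")
      case True
      then obtain x :: 'a where x: "absval x > 1" by blast
      then obtain k where k: "r < absval x ^ k" using real_arch_pow by blast
      show ?thesis
      proof (rule tendsto_0_squeeze)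
        show "(\<lambda>n. gterm (absval (x ^ k)) p n) \<longlonglongrightarrow> 0" by (rule *)
        show "gterm r p n \<le> gterm (absval (x ^ k)) p n" for n
          using r k by (auto simp: gterm_def absval_power absval_nonneg intro!: mult_left_mono power_mono)
        show "0 \<le> gterm r p n" for n using r by (simp add: gterm_nonneg)
      qed simp
    next
      case False
      have "(\<lambda>n. gterm 1 p n) \<longlonglongrightarrow> 0" using *[of 1] by simp
      hence "\<forall>\<^sub>F n in sequentially. gterm 1 p n < 1" by (rule order_tendstoD) simp
      hence "\<forall>\<^sub>F n in sequentially. gterm r p n = 0"
        by eventually_elim (use trivial_absval_small[OF False] in \<open>auto simp: gterm_def\<close>)
      thus ?thesis by (rule tendsto_eventually)
    qed
  qed
next
  assume *: "\<forall>r>0. gterm r p \<longlonglongrightarrow> 0"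
  show "entire p" unfolding entire_def
  proof
    fix x :: 'a
    show "summable (\<lambda>n. fps_nth p n * x ^ n)"
    proof (cases "x = 0")
      case True
      hence "summable (\<lambda>n. fps_nth p n * x ^ n)" by (intro summable_finite[of "{0}"]) auto
      thus ?thesis .
    next
      case False
      hence "gterm (absval x) p \<longlonglongrightarrow> 0" using * by simp
      thus ?thesis by (simp add: summable_ultrametric_iff gterm_def[abs_def] absval_mult absval_power)
    qed
  qed
qed

text \<open>\<open>N\<close> is the largest index at which the Gauss norm of radius \<open>r\<close> is attained; it will turn out
  to be the number of zeros in the disc \<open>absval x \<le> r\<close>.\<close>

definition isdom :: "real \<Rightarrow> 'a::ultrametric_field fps \<Rightarrow> nat \<Rightarrow> bool" where
  "isdom r p N \<longleftrightarrow> gterm r p N > 0 \<and> (\<forall>k. gterm r p k \<le> gterm r p N) \<and> (\<forall>k>N. gterm r p k < gterm r p N)"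

text \<open>This is sup |p_n| r^n, read off at the index where it is attained. The zero series has
  no such index and is treated apart.\<close>

definition gauss :: "real \<Rightarrow> 'a::ultrametric_field fps \<Rightarrow> real" where
  "gauss r p = (if p = 0 then 0 else gterm r p (SOME N. isdom r p N))"

lemma isdom_unique: "isdom r p M \<Longrightarrow> isdom r p N \<Longrightarrow> M = N"
  unfolding isdom_def by (metis leD linorder_neqE_nat)

lemma isdom_nz: "isdom r p N \<Longrightarrow> p \<noteq> 0"
  by (auto simp: isdom_def gterm_def)

lemma gauss_isdom: "isdom r p N \<Longrightarrow> gauss r p = gterm r p N"
  unfolding gauss_def by (metis isdom_nz isdom_unique someI)

lemma gauss_0 [simp]: "gauss r 0 = 0"
  by (simp add: gauss_def)

lemma isdom_exists:
  assumes "gterm r p \<longlonglongrightarrow> 0" and "p \<noteq> 0" and r: "r > 0"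
  shows "\<exists>N. isdom r p N"
proof -
  obtain m where m: "fps_nth p m \<noteq> 0" using assms(2) by (metis fps_ext fps_zero_nth)
  define t where "t = gterm r p m"
  have t: "t > 0" using m r by (simp add: t_def gterm_def)
  have "\<forall>\<^sub>F n in sequentially. gterm r p n < t" using order_tendstoD(2)[OF assms(1) t] .
  then obtain K where K: "\<And>n. n \<ge> K \<Longrightarrow> gterm r p n < t" by (auto simp: eventually_sequentially)
  define M where "M = Max (gterm r p ` {..K})"
  have mK: "m < K" using K[of m] by (force simp: t_def)
  have M1: "gterm r p n \<le> M" if "n \<le> K" for n using that by (simp add: M_def)
  have tM: "t \<le> M" using M1[of m] mK by (simp add: t_def)
  define S where "S = {n. n \<le> K \<and> gterm r p n = M}"
  have "M \<in> gterm r p ` {..K}" unfolding M_def by (intro Max_in) auto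
  hence "finite S" "S \<noteq> {}" by (auto simp: S_def)
  define N where "N = Max S"
  have "N \<in> S" unfolding N_def using \<open>finite S\<close> \<open>S \<noteq> {}\<close> by (rule Max_in)
  hence N: "N \<le> K" "gterm r p N = M" by (auto simp: S_def)
  have le: "gterm r p k \<le> M" for k
    using M1[of k] K[of k] tM by (cases "k \<le> K") auto
  have "gterm r p k < M" if "k > N" for k
  proof (cases "k \<le> K")
    case True
    hence "k \<notin> S" using that Max_ge[OF \<open>finite S\<close>, of k] by (auto simp: N_def)
    thus ?thesis using le[of k] True by (auto simp: S_def)
  next
    case False thus ?thesis using K[of k] tM by simp
  qed
  thus ?thesis using N le t tM unfolding isdom_def by (intro exI[of _ N]) auto
qed

lemma entire_isdom:
  fixes p :: "'a :: {ultrametric_field, complete_space} fps"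
  assumes "entire p" "p \<noteq> 0" "r > 0"
  obtains N where "isdom r p N"
  using assms isdom_exists unfolding entire_iff by blast

text \<open>Gauss's lemma. In the coefficient of index i + j every product other than the one with
  indices i and j has a factor beyond its dominant index, so it is strictly smaller and cannot
  cancel the main term.\<close>

lemma isdom_mult:
  assumes p: "isdom r p i" and q: "isdom r q j" and r: "r > 0"
  shows "isdom r (p * q) (i + j)" and "gauss r (p * q) = gauss r p * gauss r q"
proof -
  define A where "A = gterm r p i"
  define B where "B = gterm r q j"
  have A: "A > 0" "\<And>k. gterm r p k \<le> A" "\<And>k. k > i \<Longrightarrow> gterm r p k < A"
    using p by (auto simp: isdom_def A_def)
  have B: "B > 0" "\<And>k. gterm r q k \<le> B" "\<And>k. k > j \<Longrightarrow> gterm r q k < B"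
    using q by (auto simp: isdom_def B_def)
  define T where "T k m = fps_nth p k * fps_nth q (m - k)" for k m
  have T: "absval (T k m) * r ^ m = gterm r p k * gterm r q (m - k)" if "k \<le> m" for k m
    using that by (simp add: T_def gterm_def absval_mult flip: power_add)
  have coef: "fps_nth (p * q) m = (\<Sum>k\<le>m. T k m)" for m
    by (simp add: fps_mult_nth T_def atLeast0AtMost)
  have Tle: "absval (T k m) \<le> A * B / r ^ m" if "k \<le> m" for k m
  proof -
    have "absval (T k m) * r ^ m \<le> A * B"
      unfolding T[OF that] using A B r by (intro mult_mono gterm_nonneg) auto
    thus ?thesis using r by (simp add: field_simps)
  qed
  have Tless: "absval (T k m) < A * B / r ^ m" if "k \<le> m" "k > i \<or> m - k > j" for k m
  proof -
    have "gterm r p k * gterm r q (m - k) < A * B"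
    proof (cases "k > i")
      case True
      have "gterm r p k * gterm r q (m - k) \<le> gterm r p k * B"
        using B r by (intro mult_left_mono gterm_nonneg) auto
      also have "\<dots> < A * B" using A(3)[OF True] B(1) by simp
      finally show ?thesis .
    next
      case False
      hence *: "m - k > j" using that by simp
      have "gterm r p k * gterm r q (m - k) \<le> A * gterm r q (m - k)"
        using A r by (intro mult_right_mono gterm_nonneg) auto
      also have "\<dots> < A * B" using B(3)[OF *] A(1) by simp
      finally show ?thesis .
    qed
    hence "absval (T k m) * r ^ m < A * B" unfolding T[OF that(1)] .
    thus ?thesis using r by (simp add: field_simps)
  qed
  have pos: "A * B / r ^ m > 0" for m using A(1) B(1) r by simp
  have le: "gterm r (p * q) m \<le> A * B" for m
  proof -
    have "absval (fps_nth (p * q) m) \<le> A * B / r ^ m"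
      unfolding coef using Tle pos[of m] by (intro absval_sum_le) auto
    thus ?thesis using r by (simp add: gterm_def field_simps)
  qed
  have less: "gterm r (p * q) m < A * B" if "m > i + j" for m
  proof -
    have "absval (fps_nth (p * q) m) < A * B / r ^ m"
      unfolding coef using pos[of m] that by (intro absval_sum_less Tless) auto
    thus ?thesis using r by (simp add: gterm_def field_simps)
  qed
  have eq: "gterm r (p * q) (i + j) = A * B"
  proof -
    have 1: "absval (T i (i+j)) = A * B / r ^ (i + j)"
      using T[of i "i+j"] r by (simp add: A_def B_def field_simps)
    have 2: "absval (\<Sum>k\<in>{..i+j} - {i}. T k (i+j)) < A * B / r ^ (i+j)"
      using pos[of "i+j"] by (intro absval_sum_less Tless) auto
    have "fps_nth (p * q) (i+j) = T i (i+j) + (\<Sum>k\<in>{..i+j} - {i}. T k (i+j))"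
      unfolding coef by (intro sum.remove) auto
    hence "absval (fps_nth (p * q) (i+j)) = A * B / r ^ (i+j)"
      using absval_add_eq 1 2 by metis
    thus ?thesis using r by (simp add: gterm_def field_simps)
  qed
  show *: "isdom r (p * q) (i + j)"
    unfolding isdom_def eq using le less A(1) B(1) by auto
  show "gauss r (p * q) = gauss r p * gauss r q"
    using gauss_isdom[OF *] gauss_isdom[OF p] gauss_isdom[OF q] eq by (simp add: A_def B_def)
qed

lemma gauss_bounds:
  fixes p :: "'a :: {ultrametric_field, complete_space} fps"
  assumes "entire p" "r > 0"
  shows gterm_le_gauss: "gterm r p n \<le> gauss r p" and gauss_nonneg: "gauss r p \<ge> 0"
    and gauss_pos: "p \<noteq> 0 \<Longrightarrow> gauss r p > 0"
proof -
  have "gterm r p n \<le> gauss r p \<and> gauss r p \<ge> 0 \<and> (p \<noteq> 0 \<longrightarrow> gauss r p > 0)"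
  proof (cases "p = 0")
    case False
    then obtain N where "isdom r p N" using entire_isdom assms by metis
    thus ?thesis using gauss_isdom[of r p N] by (auto simp: isdom_def)
  qed (simp add: gterm_def)
  thus "gterm r p n \<le> gauss r p" "gauss r p \<ge> 0" "p \<noteq> 0 \<Longrightarrow> gauss r p > 0" by auto
qed

lemma gauss_le:
  fixes p :: "'a :: {ultrametric_field, complete_space} fps"
  assumes "entire p" "r > 0" "\<And>n. gterm r p n \<le> B"
  shows "gauss r p \<le> B"
proof (cases "p = 0")
  case True
  thus ?thesis using assms(3)[of 0] by (simp add: gterm_def)
next
  case False
  then obtain N where "isdom r p N" using entire_isdom assms by metis
  thus ?thesis using gauss_isdom[of r p N] assms(3) by simp
qed

lemma gauss_mult:
  fixes p q :: "'a :: {ultrametric_field, complete_space} fps"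
  assumes "entire p" "entire q" "r > 0"
  shows "gauss r (p * q) = gauss r p * gauss r q"
proof (cases "p = 0 \<or> q = 0")
  case False
  then obtain i j where "isdom r p i" "isdom r q j" using entire_isdom assms by metis
  thus ?thesis using isdom_mult assms by blast
qed auto

lemma gterm_add: "r \<ge> 0 \<Longrightarrow> gterm r (p + q) n \<le> max (gterm r p n) (gterm r q n)"
  using mult_right_mono[OF absval_add[of "fps_nth p n" "fps_nth q n"], of "r ^ n"]
  by (auto simp: gterm_def max_mult_distrib_right split: if_splits)

text \<open>Integers have absolute value at most 1, so differentiation costs nothing but the index
  shift, which is the factor 1 / r.\<close>

lemma gterm_deriv:
  assumes "r > 0"
  shows "gterm r (fps_deriv p) n \<le> gterm r p (Suc n) / r"
proof -
  have "absval (of_nat (Suc n) * fps_nth p (Suc n)) \<le> 1 * absval (fps_nth p (Suc n))"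
    unfolding absval_mult by (intro mult_right_mono absval_of_nat_le absval_nonneg)
  hence "absval (of_nat (Suc n) * fps_nth p (Suc n)) * r ^ n \<le> absval (fps_nth p (Suc n)) * r ^ n"
    using assms by (intro mult_right_mono) auto
  thus ?thesis using assms by (simp add: gterm_def)
qed

section \<open>Closure properties of entire functions\<close>

lemma entire_add:
  fixes p q :: "'a :: {ultrametric_field, complete_space} fps"
  assumes "entire p" "entire q" shows "entire (p + q)"
  unfolding entire_iff
proof (intro allI impI)
  fix r :: real assume r: "r > 0"
  have "(\<lambda>n. max (gterm r p n) (gterm r q n)) \<longlonglongrightarrow> max 0 0"
    using assms r unfolding entire_iff by (intro tendsto_max) auto
  thus "gterm r (p + q) \<longlonglongrightarrow> 0"
    by (rule tendsto_0_squeeze)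
      (use r in \<open>auto simp: gterm_nonneg gterm_add\<close>)
qed

lemma entire_deriv:
  fixes p :: "'a :: {ultrametric_field, complete_space} fps"
  assumes "entire p" shows "entire (fps_deriv p)"
  unfolding entire_iff
proof (intro allI impI)
  fix r :: real assume r: "r > 0"
  have "gterm r p \<longlonglongrightarrow> 0" using assms r unfolding entire_iff by blast
  hence "(\<lambda>n. gterm r p (Suc n) / r) \<longlonglongrightarrow> 0 / r"
    using filterlim_compose[OF _ filterlim_Suc, of "gterm r p"] r by (intro tendsto_intros) auto
  thus "gterm r (fps_deriv p) \<longlonglongrightarrow> 0"
    by (rule tendsto_0_squeeze)
      (use r gterm_deriv[of r p] in \<open>auto simp: gterm_nonneg\<close>)
qed

lemma entire_finite:
  fixes p :: "'a :: ultrametric_field fps"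
  assumes "\<And>n. n \<ge> N \<Longrightarrow> fps_nth p n = 0" shows "entire p"
  unfolding entire_def using assms by (intro allI summable_finite[of "{..<N}"]) auto

lemma entire_const [simp]: "entire (fps_const c)" by (rule entire_finite[of 1]) auto
lemma entire_0 [simp]: "entire 0" by (rule entire_finite[of 0]) auto
lemma entire_1 [simp]: "entire 1" by (rule entire_finite[of 1]) auto
lemma entire_X [simp]: "entire fps_X" by (rule entire_finite[of 2]) auto
lemma entire_of_poly [simp]: "entire (fps_of_poly p)"
  by (rule entire_finite[of "Suc (degree p)"]) (auto simp: coeff_eq_0)

lemma entire_mult:
  fixes p q :: "'a :: {ultrametric_field, complete_space} fps"
  assumes p: "entire p" and q: "entire q" shows "entire (p * q)"
proof -
  have bound: "gterm r (p * q) m \<le> gauss r p * gauss r q" if r: "r > 0" for r m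
  proof -
    have "absval (fps_nth (p * q) m) \<le> gauss r p * gauss r q / r ^ m"
      unfolding fps_mult_nth
    proof (rule absval_sum_le)
      fix k assume k: "k \<in> {0..m}"
      have "absval (fps_nth p k * fps_nth q (m - k)) * r ^ m = gterm r p k * gterm r q (m - k)"
        using k by (simp add: gterm_def absval_mult flip: power_add)
      also have "\<dots> \<le> gauss r p * gauss r q"
        using r p q by (intro mult_mono gterm_le_gauss gterm_nonneg gauss_nonneg) auto
      finally show "absval (fps_nth p k * fps_nth q (m - k)) \<le> gauss r p * gauss r q / r ^ m"
        using r by (simp add: field_simps)
    qed (use r p q in \<open>simp add: gauss_nonneg\<close>)
    thus ?thesis using r by (simp add: gterm_def field_simps)
  qed
  show ?thesis unfolding entire_iff
  proof (intro allI impI)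
    fix r :: real assume r: "r > 0"
    \<comment> \<open>The bound on the coefficients at radius 2 r becomes geometric decay at radius
      r.\<close>
    define C where "C = gauss (2*r) p * gauss (2*r) q"
    have le: "gterm r (p * q) m \<le> C * (1/2) ^ m" for m
    proof -
      have "gterm (2*r) (p * q) m = gterm r (p * q) m * 2 ^ m" by (simp add: gterm_def power_mult_distrib)
      thus ?thesis using bound[of "2*r" m] r by (simp add: C_def field_simps power_divide)
    qed
    have "(\<lambda>m. C * (1/2) ^ m) \<longlonglongrightarrow> C * 0" by (intro tendsto_intros LIMSEQ_power_zero) auto
    thus "gterm r (p * q) \<longlonglongrightarrow> 0"
      by (rule tendsto_0_squeeze)
        (use r le in \<open>auto simp: gterm_nonneg\<close>)
  qed
qed

lemma entire_uminus:
  fixes p :: "'a :: {ultrametric_field, complete_space} fps"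
  shows "entire p \<Longrightarrow> entire (- p)"
  using entire_mult[OF entire_const[of "-1::'a"], of p]
  by (metis fps_const_neg fps_const_1_eq_1 mult_minus1)

lemma entire_diff:
  fixes p q :: "'a :: {ultrametric_field, complete_space} fps"
  shows "entire p \<Longrightarrow> entire q \<Longrightarrow> entire (p - q)"
  using entire_add[of p "-q"] entire_uminus[of q] by simp

lemma gauss_add:
  fixes p q :: "'a :: {ultrametric_field, complete_space} fps"
  assumes "entire p" "entire q" "r > 0"
  shows "gauss r (p + q) \<le> max (gauss r p) (gauss r q)"
proof (rule gauss_le)
  show "entire (p + q)" using assms by (simp add: entire_add)
  fix n
  have "gterm r (p + q) n \<le> max (gterm r p n) (gterm r q n)" using assms by (simp add: gterm_add)
  also have "\<dots> \<le> max (gauss r p) (gauss r q)" using assms gterm_le_gauss by (intro max.mono) auto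
  finally show "gterm r (p + q) n \<le> max (gauss r p) (gauss r q)" .
qed fact

lemma gauss_deriv:
  fixes p :: "'a :: {ultrametric_field, complete_space} fps"
  assumes "entire p" "r > 0"
  shows "gauss r (fps_deriv p) \<le> gauss r p / r"
proof (rule gauss_le)
  fix n
  have "gterm r (fps_deriv p) n \<le> gterm r p (Suc n) / r" using assms by (simp add: gterm_deriv)
  also have "\<dots> \<le> gauss r p / r" using assms gterm_le_gauss by (intro divide_right_mono) auto
  finally show "gterm r (fps_deriv p) n \<le> gauss r p / r" .
qed (use assms in \<open>auto intro: entire_deriv\<close>)

lemma gauss_const: "r > 0 \<Longrightarrow> gauss r (fps_const c) = absval c"
proof (cases "c = 0")
  case False
  assume "r > 0"
  hence "isdom r (fps_const c) 0" using False by (auto simp: isdom_def gterm_def absval_nonneg)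
  from gauss_isdom[OF this] show ?thesis by (simp add: gterm_def)
qed simp

section \<open>Evaluation of entire functions and division by X - c\<close>

lemma entire_sums:
  assumes "entire p"
  shows "(\<lambda>n. fps_nth p n * x ^ n) sums entire_eval p x"
  using assms unfolding entire_def entire_eval_def by (blast intro: summable_sums)

lemma entire_eval_unique: "(\<lambda>n. fps_nth p n * x ^ n) sums s \<Longrightarrow> entire_eval p x = s"
  unfolding entire_eval_def by (metis sums_unique)

lemma entire_eval_add:
  assumes "entire p" "entire q"
  shows "entire_eval (p + q) x = entire_eval p x + entire_eval q x"
  using sums_add[OF entire_sums[OF assms(1)] entire_sums[OF assms(2)], of x]
  by (intro entire_eval_unique) (simp add: algebra_simps)

lemma entire_eval_cmult:
  assumes "entire p"
  shows "entire_eval (fps_const c * p) x = c * entire_eval p x"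
  using sums_mult_ultrametric[OF entire_sums[OF assms], of c x]
  by (intro entire_eval_unique) (simp add: algebra_simps)

lemma entire_eval_const [simp]: "entire_eval (fps_const c) x = c"
proof (rule entire_eval_unique)
  have "(\<lambda>n. fps_nth (fps_const c) n * x ^ n) sums (\<Sum>n\<in>{0}. fps_nth (fps_const c) n * x ^ n)"
    by (rule sums_finite) auto
  thus "(\<lambda>n. fps_nth (fps_const c) n * x ^ n) sums c" by simp
qed

lemma entire_eval_0 [simp]: "entire_eval 0 x = 0"
  using entire_eval_const[of 0 x] by simp

lemma entire_eval_1 [simp]: "entire_eval 1 x = 1"
  using entire_eval_const[of 1 x] by simp

lemma entire_eval_X_mult:
  assumes "entire p"
  shows "entire_eval (fps_X * p) x = x * entire_eval p x"
proof (rule entire_eval_unique)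
  have "(\<lambda>n. fps_nth (fps_X * p) (Suc n) * x ^ Suc n) sums (x * entire_eval p x)"
    using sums_mult_ultrametric[OF entire_sums[OF assms], of x x] by (simp add: algebra_simps)
  from sums_Suc[OF this] show "(\<lambda>n. fps_nth (fps_X * p) n * x ^ n) sums (x * entire_eval p x)"
    by simp
qed

lemma entire_eval_uminus:
  fixes p :: "'a :: {ultrametric_field, complete_space} fps"
  assumes "entire p"
  shows "entire_eval (- p) x = - entire_eval p x"
  using entire_eval_cmult[OF assms, of "-1" x]
  by (metis fps_const_neg fps_const_1_eq_1 mult_minus1)

lemma entire_eval_diff:
  fixes p :: "'a :: {ultrametric_field, complete_space} fps"
  assumes "entire p" "entire q"
  shows "entire_eval (p - q) x = entire_eval p x - entire_eval q x"
  using entire_eval_add[OF assms(1) entire_uminus[OF assms(2)], of x] assms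
  by (simp add: entire_eval_uminus)

lemma entire_eval_linear_mult:
  fixes p :: "'a :: {ultrametric_field, complete_space} fps"
  assumes "entire p"
  shows "entire_eval ((fps_X - fps_const c) * p) x = (x - c) * entire_eval p x"
  using entire_eval_diff[of "fps_X * p" "fps_const c * p" x] assms
  by (simp add: left_diff_distrib entire_mult entire_eval_X_mult entire_eval_cmult)

lemma entire_eval_bound:
  fixes p :: "'a :: {ultrametric_field, complete_space} fps"
  assumes "entire p" "r > 0" "absval x \<le> r"
  shows "absval (entire_eval p x) \<le> gauss r p"
proof (rule sums_absval_le[OF entire_sums[OF assms(1)]])
  fix n
  have "absval (fps_nth p n * x ^ n) \<le> gterm r p n"
    unfolding gterm_def absval_mult absval_power using assms
    by (intro mult_left_mono power_mono) (auto simp: absval_nonneg)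
  also have "\<dots> \<le> gauss r p" using assms by (intro gterm_le_gauss)
  finally show "absval (fps_nth p n * x ^ n) \<le> gauss r p" .
qed

text \<open>Horner's scheme for power series: the coefficients of the quotient are the tails
  \<open>S (Suc n)\<close>, and \<open>rec\<close> is the Horner recursion. The norm bound on the
  quotient is the source of the Lipschitz estimate below.\<close>

lemma entire_factor:
  fixes p :: "'a :: {ultrametric_field, complete_space} fps"
  assumes p: "entire p"
  obtains s where "entire s" "p = fps_const (entire_eval p c) + (fps_X - fps_const c) * s"
    "\<And>r. r > 0 \<Longrightarrow> absval c \<le> r \<Longrightarrow> gauss r s \<le> gauss r p / r"
proof -
  define S where "S m = (\<Sum>k. fps_nth p (m + k) * c ^ k)" for m
  have bnd: "absval (fps_nth p (m + k) * c ^ k) \<le> gterm r p (m + k) / r ^ m"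
    if "r > 0" "absval c \<le> r" for r m k
  proof -
    have "absval (fps_nth p (m + k) * c ^ k) * r ^ m \<le> gterm r p (m + k)"
      unfolding gterm_def absval_mult absval_power power_add mult.assoc using that
      by (subst mult.commute[of "absval c ^ k"]) (intro mult_left_mono power_mono, auto simp: absval_nonneg)
    thus ?thesis using that by (simp add: field_simps)
  qed
  have sums: "(\<lambda>k. fps_nth p (m + k) * c ^ k) sums S m" for m
  proof -
    define r where "r = absval c + 1"
    have r: "r > 0" "absval c \<le> r" using absval_nonneg[of c] by (auto simp: r_def)
    have "(\<lambda>k. gterm r p (k + m) / r ^ m) \<longlonglongrightarrow> 0 / r ^ m"
      using p r unfolding entire_iff by (intro tendsto_intros LIMSEQ_ignore_initial_segment) auto
    hence "(\<lambda>k. absval (fps_nth p (m + k) * c ^ k)) \<longlonglongrightarrow> 0"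
      by (rule tendsto_0_squeeze) (use bnd[OF r, of m] in \<open>auto simp: absval_nonneg add.commute\<close>)
    thus ?thesis unfolding S_def by (intro summable_sums) (simp add: summable_ultrametric_iff)
  qed
  have S0: "S 0 = entire_eval p c" by (simp add: S_def entire_eval_def)
  have rec: "S m = fps_nth p m + c * S (Suc m)" for m
  proof -
    have "(\<lambda>k. c * (fps_nth p (Suc m + k) * c ^ k)) sums (c * S (Suc m))"
      by (intro sums_mult_ultrametric sums)
    hence "(\<lambda>k. fps_nth p (m + Suc k) * c ^ Suc k) sums (c * S (Suc m))"
      by (simp add: algebra_simps)
    from sums_Suc[OF this] have "(\<lambda>k. fps_nth p (m + k) * c ^ k) sums (c * S (Suc m) + fps_nth p m)"
      by simp
    from sums_unique2[OF sums this] show ?thesis by (simp add: add.commute)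
  qed
  have Sle: "absval (S m) \<le> gauss r p / r ^ m" if "r > 0" "absval c \<le> r" for r m
  proof (rule sums_absval_le[OF sums])
    fix k
    have "gterm r p (m + k) / r ^ m \<le> gauss r p / r ^ m"
      using that p by (intro divide_right_mono gterm_le_gauss) auto
    with bnd[OF that, of m k] show "absval (fps_nth p (m + k) * c ^ k) \<le> gauss r p / r ^ m" by linarith
  qed
  define s where "s = Abs_fps (\<lambda>n. S (Suc n))"
  have sle: "gterm r s n \<le> gauss r p / r" if "r > 0" "absval c \<le> r" for r n
    using Sle[OF that, of "Suc n"] that by (simp add: s_def gterm_def field_simps)
  have "entire s" unfolding entire_iff
  proof (intro allI impI)
    fix r :: real assume r: "r > 0"
    define R where "R = max r (absval c)"
    have R: "R > 0" "r \<le> R" "absval c \<le> 2 * R" using r by (auto simp: R_def)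
    define C where "C = gauss (2*R) p / (2*R)"
    have "gterm r s n \<le> C * (1/2) ^ n" for n
    proof -
      have "gterm r s n * 2 ^ n \<le> gterm (2 * R) s n"
      proof -
        have "absval (fps_nth s n) * (r * 2) ^ n \<le> absval (fps_nth s n) * (2 * R) ^ n"
          using R r by (intro mult_left_mono power_mono) (auto simp: absval_nonneg)
        thus ?thesis by (simp add: gterm_def power_mult_distrib mult.assoc)
      qed
      also have "\<dots> \<le> C" unfolding C_def using R by (intro sle) auto
      finally show ?thesis by (simp add: field_simps)
    qed
    moreover have "(\<lambda>n. C * (1/2) ^ n) \<longlonglongrightarrow> C * 0"
      by (intro tendsto_intros LIMSEQ_power_zero) auto
    ultimately show "gterm r s \<longlonglongrightarrow> 0"
      by (intro tendsto_0_squeeze[where g = "\<lambda>n. C * (1/2) ^ n" and c = "C * 0"]) (use r in \<open>auto simp: gterm_nonneg\<close>)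
  qed
  moreover have "p = fps_const (entire_eval p c) + (fps_X - fps_const c) * s"
  proof (rule fps_ext)
    fix n
    show "fps_nth p n = fps_nth (fps_const (entire_eval p c) + (fps_X - fps_const c) * s) n"
      using rec[of n] S0 by (cases n) (auto simp: s_def left_diff_distrib algebra_simps)
  qed
  moreover have "gauss r s \<le> gauss r p / r" if "r > 0" "absval c \<le> r" for r
    using that sle \<open>entire s\<close> by (intro gauss_le)
  ultimately show ?thesis using that by blast
qed

lemma entire_factor_zero:
  fixes p :: "'a :: {ultrametric_field, complete_space} fps"
  assumes p: "entire p" "entire_eval p c = 0"
  obtains s where "entire s" "p = (fps_X - fps_const c) * s"
  using entire_factor[OF p(1), of c] p(2) by auto

text \<open>Dividing p by X - x leaves only a constant multiple and a linear factor to evaluate, so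
  no double series has to be rearranged.\<close>

lemma entire_eval_mult:
  fixes p q :: "'a :: {ultrametric_field, complete_space} fps"
  assumes "entire p" "entire q"
  shows "entire_eval (p * q) x = entire_eval p x * entire_eval q x"
proof -
  obtain s where s: "entire s" "p = fps_const (entire_eval p x) + (fps_X - fps_const x) * s"
    using entire_factor[OF assms(1)] by metis
  have "p * q = fps_const (entire_eval p x) * q + (fps_X - fps_const x) * (s * q)"
    by (subst s(2)) (simp add: algebra_simps)
  thus ?thesis using s assms
    by (simp add: entire_eval_add entire_eval_cmult entire_eval_linear_mult entire_mult entire_diff)
qed

lemma entire_eval_lipschitz:
  fixes p :: "'a :: {ultrametric_field, complete_space} fps"
  assumes "entire p" "r > 0" "absval x \<le> r" "absval y \<le> r"
  shows "absval (entire_eval p x - entire_eval p y) \<le> absval (x - y) * (gauss r p / r)"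
proof -
  obtain s where s: "entire s" "p = fps_const (entire_eval p y) + (fps_X - fps_const y) * s"
    "gauss r s \<le> gauss r p / r"
    using entire_factor[OF assms(1), of y] assms by metis
  have "entire_eval p x = entire_eval p y + (x - y) * entire_eval s x"
    using s(1) by (subst s(2)) (simp add: entire_eval_add entire_eval_linear_mult entire_mult entire_diff)
  hence "absval (entire_eval p x - entire_eval p y) = absval (x - y) * absval (entire_eval s x)"
    by (simp add: absval_mult)
  also have "\<dots> \<le> absval (x - y) * (gauss r p / r)"
    using entire_eval_bound[OF s(1) assms(2,3)] s(3) by (intro mult_left_mono) (auto simp: absval_nonneg)
  finally show ?thesis .
qed

lemma entire_eval_of_poly: "entire_eval (fps_of_poly p) x = poly p x"
proof (rule entire_eval_unique)
  have "(\<lambda>n. fps_nth (fps_of_poly p) n * x ^ n) sums (\<Sum>n\<le>degree p. fps_nth (fps_of_poly p) n * x ^ n)"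
    by (rule sums_finite) (auto simp: coeff_eq_0)
  thus "(\<lambda>n. fps_nth (fps_of_poly p) n * x ^ n) sums poly p x" by (simp add: poly_altdef)
qed

subsection \<open>Zeros of entire functions\<close>

lemma isdom_linear:
  assumes r: "r > 0"
  shows "isdom r (fps_X - fps_const c) (if absval c \<le> r then 1 else 0)"
    and "gauss r (fps_X - fps_const c) = max r (absval c)"
proof -
  have g: "gterm r (fps_X - fps_const c) n = (if n = 0 then absval c else if n = 1 then r else 0)" for n
    by (auto simp: gterm_def)
  show *: "isdom r (fps_X - fps_const c) (if absval c \<le> r then 1 else 0)"
    using r by (auto simp: isdom_def g absval_nonneg)
  show "gauss r (fps_X - fps_const c) = max r (absval c)"
    using gauss_isdom[OF *] g by auto
qed

lemma isdom_const: "r > 0 \<Longrightarrow> c \<noteq> 0 \<Longrightarrow> isdom r (fps_const c) 0"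
  by (auto simp: isdom_def gterm_def absval_nonneg)

text \<open>A root outside the disc contributes the same factor to the Gauss norm and to the value
  at x. A root inside contributes r to the norm and at least d to the value; the dominant index N
  counts these.\<close>

lemma split_poly_lower_bound:
  fixes A :: "'a :: {ultrametric_field, complete_space} multiset"
  assumes r: "r > 0" and c: "c \<noteq> 0" and x: "absval x \<le> r"
  shows "\<exists>N. isdom r (fps_of_poly (smult c (\<Prod>\<rho>\<in>#A. [:-\<rho>, 1:]))) N \<and>
    (\<forall>d\<ge>0. (\<forall>\<rho>\<in>#A. absval \<rho> \<le> r \<longrightarrow> d \<le> absval (x - \<rho>)) \<longrightarrow>
       gauss r (fps_of_poly (smult c (\<Prod>\<rho>\<in>#A. [:-\<rho>, 1:]))) * d ^ N
         \<le> absval (poly (smult c (\<Prod>\<rho>\<in>#A. [:-\<rho>, 1:])) x) * r ^ N)"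
proof (induction A)
  case empty
  show ?case using isdom_const[OF r c] r
    by (intro exI[of _ 0]) (simp add: fps_of_poly_const gauss_const)
next
  case (add \<rho> A)
  define Q where "Q = smult c (\<Prod>\<rho>\<in>#A. [:-\<rho>, 1:])"
  from add obtain N where N: "isdom r (fps_of_poly Q) N"
    "\<And>d. d \<ge> 0 \<Longrightarrow> (\<forall>\<rho>\<in>#A. absval \<rho> \<le> r \<longrightarrow> d \<le> absval (x - \<rho>)) \<Longrightarrow>
       gauss r (fps_of_poly Q) * d ^ N \<le> absval (poly Q x) * r ^ N"
    unfolding Q_def by blast
  have Q': "smult c (\<Prod>\<rho>\<in>#add_mset \<rho> A. [:-\<rho>, 1:]) = [:-\<rho>, 1:] * Q" by (simp add: Q_def)
  have l: "fps_of_poly [:-\<rho>, 1:] = fps_X - fps_const \<rho>"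
    by (simp add: fps_of_poly_pCons)
  note dom = isdom_mult[OF isdom_linear(1)[OF r, of \<rho>] N(1) r]
  show ?case unfolding Q' fps_of_poly_mult l
  proof (intro exI conjI allI impI)
    show "isdom r ((fps_X - fps_const \<rho>) * fps_of_poly Q) ((if absval \<rho> \<le> r then 1 else 0) + N)"
      by (rule dom(1))
    fix d :: real assume d: "d \<ge> 0"
      "\<forall>\<rho>\<in>#add_mset \<rho> A. absval \<rho> \<le> r \<longrightarrow> d \<le> absval (x - \<rho>)"
    have IH: "gauss r (fps_of_poly Q) * d ^ N \<le> absval (poly Q x) * r ^ N" using N(2)[of d] d by simp
    have g0: "gauss r (fps_of_poly Q) \<ge> 0" using r by (simp add: gauss_nonneg)
    have p: "absval (poly ([:-\<rho>, 1:] * Q) x) = absval (x - \<rho>) * absval (poly Q x)"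
      by (simp flip: absval_mult add: algebra_simps)
    show "gauss r ((fps_X - fps_const \<rho>) * fps_of_poly Q) * d ^ ((if absval \<rho> \<le> r then 1 else 0) + N)
      \<le> absval (poly ([:-\<rho>, 1:] * Q) x) * r ^ ((if absval \<rho> \<le> r then 1 else 0) + N)"
    proof (cases "absval \<rho> \<le> r")
      case True
      have "r * d * (gauss r (fps_of_poly Q) * d ^ N) \<le> r * absval (x - \<rho>) * (absval (poly Q x) * r ^ N)"
      proof (rule mult_mono[OF _ IH])
        show "r * d \<le> r * absval (x - \<rho>)" using d True r by simp
      qed (use r d g0 in \<open>auto simp: absval_nonneg\<close>)
      thus ?thesis using True unfolding p dom(2) isdom_linear(2)[OF r] by (simp add: mult_ac max_def)
    next
      case False
      hence "absval (\<rho> - x) = absval \<rho>" using x by (intro absval_diff_eq) auto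
      hence *: "absval (x - \<rho>) = absval \<rho>" by (simp add: absval_minus_commute)
      have "absval \<rho> * (gauss r (fps_of_poly Q) * d ^ N) \<le> absval \<rho> * (absval (poly Q x) * r ^ N)"
        using IH by (intro mult_left_mono) (auto simp: absval_nonneg)
      thus ?thesis using False * unfolding p dom(2) isdom_linear(2)[OF r] by (simp add: mult_ac max_def)
    qed
  qed
qed

text \<open>The preceding estimate, with d the distance from x to the nearest root in the disc. A
  small value at x therefore forces a root close to x.\<close>

lemma poly_root_near:
  fixes P :: "'a :: {ultrametric_field, complete_space, alg_closed_field} poly"
  assumes r: "r > 0" and dom: "isdom r (fps_of_poly P) N" "N > 0" and x: "absval x \<le> r"
  obtains \<rho> where "poly P \<rho> = 0" "absval \<rho> \<le> r"
    "gauss r (fps_of_poly P) * absval (x - \<rho>) ^ N \<le> absval (poly P x) * r ^ N"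
proof -
  have "P \<noteq> 0" using isdom_nz[OF dom(1)] by auto
  then obtain A where A: "P = smult (lead_coeff P) (\<Prod>x\<in>#A. [:-x, 1:])"
    using alg_closed_imp_factorization by blast
  have lc: "lead_coeff P \<noteq> 0" using \<open>P \<noteq> 0\<close> by simp
  obtain N' where "isdom r (fps_of_poly P) N'"
    and *: "\<And>d. d \<ge> 0 \<Longrightarrow> (\<forall>\<rho>\<in>#A. absval \<rho> \<le> r \<longrightarrow> d \<le> absval (x - \<rho>)) \<Longrightarrow>
       gauss r (fps_of_poly P) * d ^ N' \<le> absval (poly P x) * r ^ N'"
    using split_poly_lower_bound[OF r lc x, of A] unfolding A[symmetric] by blast
  hence N': "N' = N" using dom(1) isdom_unique by blast
  define B where "B = filter_mset (\<lambda>\<rho>. absval \<rho> \<le> r) A"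
  \<comment> \<open>With no root in the disc the estimate would hold for every d \<ge> 0. The value
    d = D turns it into (1 + t)^N \<le> t, which is impossible for N > 0.\<close>
  have "B \<noteq> {#}"
  proof
    assume "B = {#}"
    hence "\<forall>\<rho>\<in>#A. \<not> absval \<rho> \<le> r" by (auto simp: B_def)
    define D where "D = r * (1 + absval (poly P x) / gauss r (fps_of_poly P))"
    have g: "gauss r (fps_of_poly P) > 0" using r \<open>P \<noteq> 0\<close> by (intro gauss_pos) auto
    define t where "t = absval (poly P x) / gauss r (fps_of_poly P)"
    have t: "t \<ge> 0" using g by (simp add: t_def absval_nonneg)
    have "D \<ge> 0" using g r by (simp add: D_def absval_nonneg)
    hence "gauss r (fps_of_poly P) * D ^ N \<le> absval (poly P x) * r ^ N"
      using *[of D] \<open>\<forall>\<rho>\<in>#A. \<not> absval \<rho> \<le> r\<close> N' by auto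
    moreover have "absval (poly P x) = t * gauss r (fps_of_poly P)" using g by (simp add: t_def)
    ultimately have "(gauss r (fps_of_poly P) * r ^ N) * (1 + t) ^ N \<le> (gauss r (fps_of_poly P) * r ^ N) * t"
      unfolding D_def t_def[symmetric] power_mult_distrib by (simp only: mult_ac)
    hence "(1 + t) ^ N \<le> t" using g r by simp
    moreover have "(1 + t) ^ 1 \<le> (1 + t) ^ N" using dom(2) t by (intro power_increasing) auto
    ultimately show False by simp
  qed
  define \<rho> where "\<rho> = arg_min_on (\<lambda>\<rho>. absval (x - \<rho>)) (set_mset B)"
  have "\<rho> \<in># B" unfolding \<rho>_def using \<open>B \<noteq> {#}\<close> by (intro arg_min_if_finite) auto
  have min: "absval (x - \<rho>) \<le> absval (x - \<sigma>)" if "\<sigma> \<in># B" for \<sigma>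
    unfolding \<rho>_def using that by (intro arg_min_least) auto
  show ?thesis
  proof
    show "absval \<rho> \<le> r" using \<open>\<rho> \<in># B\<close> by (simp add: B_def)
    have "\<rho> \<in># A" using \<open>\<rho> \<in># B\<close> by (simp add: B_def)
    hence "[:-\<rho>, 1:] dvd (\<Prod>x\<in>#A. [:-x, 1:])" by (intro dvd_prod_mset) auto
    hence "[:-\<rho>, 1:] dvd P" by (subst A) (rule dvd_smult)
    thus "poly P \<rho> = 0" by (simp add: poly_eq_0_iff_dvd)
    show "gauss r (fps_of_poly P) * absval (x - \<rho>) ^ N \<le> absval (poly P x) * r ^ N"
      using *[of "absval (x - \<rho>)"] min N' by (auto simp: absval_nonneg B_def)
  qed
qed

text \<open>Roots of the Taylor polynomials are continued to roots of the next one, and the resulting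
  sequence converges.\<close>

lemma entire_has_zero:
  fixes p :: "'a :: {ultrametric_field, complete_space, alg_closed_field} fps"
  assumes p: "entire p" and r: "r > 0" and dom: "isdom r p N" "N > 0"
  obtains c where "absval c \<le> r" "entire_eval p c = 0"
proof -
  define P where "P k = (\<Sum>i\<le>k. monom (fps_nth p i) i)" for k
  have coeff: "coeff (P k) i = (if i \<le> k then fps_nth p i else 0)" for k i
    by (auto simp: P_def coeff_sum if_distrib cong: if_cong)
  have poly: "poly (P k) x = (\<Sum>i<Suc k. fps_nth p i * x ^ i)" for k x
    by (simp only: P_def poly_sum poly_monom lessThan_Suc_atMost)
  have gt: "gterm r (fps_of_poly (P k)) i = (if i \<le> k then gterm r p i else 0)" for k i
    by (simp add: gterm_def coeff)
  have domk: "isdom r (fps_of_poly (P k)) N" if "k \<ge> N" for k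
    using dom(1) that unfolding isdom_def gt by auto
  define G where "G = gauss r p"
  have G: "G > 0" using isdom_nz[OF dom(1)] p r by (auto simp: G_def gauss_pos)
  have gk: "gauss r (fps_of_poly (P k)) = G" if "k \<ge> N" for k
    using gauss_isdom[OF domk[OF that]] gauss_isdom[OF dom(1)] gt that by (simp add: G_def)
  have "\<exists>X. \<forall>k. (absval (X k) \<le> r \<and> poly (P (N + k)) (X k) = 0) \<and>
      G * absval (X k - X (Suc k)) ^ N \<le> absval (poly (P (N + Suc k)) (X k)) * r ^ N"
  proof (rule dependent_nat_choice)
    obtain \<rho> where "poly (P N) \<rho> = 0" "absval \<rho> \<le> r"
      using poly_root_near[OF r domk[OF order_refl] dom(2), of 0] r by auto
    thus "\<exists>x. absval x \<le> r \<and> poly (P (N + 0)) x = 0" by auto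
  next
    fix x k assume x: "absval x \<le> r \<and> poly (P (N + k)) x = 0"
    have *: "N + Suc k \<ge> N" by simp
    obtain \<rho> where "poly (P (N + Suc k)) \<rho> = 0" "absval \<rho> \<le> r"
       "G * absval (x - \<rho>) ^ N \<le> absval (poly (P (N + Suc k)) x) * r ^ N"
      using poly_root_near[OF r domk[OF *] dom(2), of x] x unfolding gk[OF *] by metis
    thus "\<exists>y. (absval y \<le> r \<and> poly (P (N + Suc k)) y = 0) \<and>
         G * absval (x - y) ^ N \<le> absval (poly (P (N + Suc k)) x) * r ^ N" by blast
  qed
  then obtain X where X: "\<And>k. absval (X k) \<le> r" "\<And>k. poly (P (N + k)) (X k) = 0"
    "\<And>k. G * absval (X k - X (Suc k)) ^ N \<le> absval (poly (P (N + Suc k)) (X k)) * r ^ N"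
    by blast
  \<comment> \<open>\<open>X k\<close> is a root of the previous Taylor polynomial, so the next one
    takes there just the value of its top term, and these terms tend to 0.\<close>
  have step: "G * absval (X k - X (Suc k)) ^ N \<le> gterm r p (N + Suc k) * r ^ N" for k
  proof -
    have "poly (P (N + Suc k)) (X k) = fps_nth p (N + Suc k) * X k ^ (N + Suc k)"
      using X(2)[of k] by (simp add: poly)
    hence "absval (poly (P (N + Suc k)) (X k)) \<le> gterm r p (N + Suc k)"
      unfolding gterm_def using X(1)[of k]
      by (simp only: absval_mult absval_power) (intro mult_left_mono power_mono, auto simp: absval_nonneg)
    hence "absval (poly (P (N + Suc k)) (X k)) * r ^ N \<le> gterm r p (N + Suc k) * r ^ N"
      using r by (intro mult_right_mono) auto
    thus ?thesis using X(3)[of k] by linarith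
  qed
  have g0: "gterm r p \<longlonglongrightarrow> 0" using p r by (simp add: entire_iff)
  have "(\<lambda>k. absval (X (Suc k) - X k)) \<longlonglongrightarrow> 0"
  proof -
    have "(\<lambda>k. gterm r p (k + Suc N) * r ^ N / G) \<longlonglongrightarrow> 0 * r ^ N / G"
      using G by (intro tendsto_intros LIMSEQ_ignore_initial_segment g0) auto
    hence "(\<lambda>k. absval (X k - X (Suc k)) ^ N) \<longlonglongrightarrow> 0"
      by (rule tendsto_0_squeeze) (use step G in \<open>auto simp: absval_nonneg field_simps\<close>)
    hence "(\<lambda>k. root N (absval (X k - X (Suc k)) ^ N)) \<longlonglongrightarrow> root N 0" by (rule tendsto_real_root)
    thus ?thesis using dom(2) by (simp add: real_root_power_cancel absval_nonneg absval_minus_commute)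
  qed
  hence "Cauchy X" by (rule Cauchy_ultrametric)
  then obtain c where c: "X \<longlonglongrightarrow> c" by (auto simp: Cauchy_convergent_iff convergent_def)
  have cr: "absval c \<le> r" using absval_lim_le[OF c X(1)] .
  \<comment> \<open>All these polynomials have the same Gauss norm G, hence the common Lipschitz
    constant G / r; this carries the zeros \<open>X k\<close> over to the limit c.\<close>
  have "(\<lambda>k. poly (P (N + k)) c) \<longlonglongrightarrow> 0" unfolding tendsto_absval
  proof (rule tendsto_0_squeeze)
    have "(\<lambda>k. absval (X k - c)) \<longlonglongrightarrow> 0" using c by (simp add: tendsto_absval)
    thus "(\<lambda>k. absval (X k - c) * (G / r)) \<longlonglongrightarrow> 0 * (G / r)" using r by (intro tendsto_intros) auto
    fix k
    show "absval (poly (P (N + k)) c - 0) \<le> absval (X k - c) * (G / r)"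
      using entire_eval_lipschitz[of "fps_of_poly (P (N + k))" r c "X k"] r cr X(1,2)[of k] gk[of "N + k"]
      by (simp add: entire_eval_of_poly absval_minus_commute)
  qed (auto simp: absval_nonneg)
  moreover have "(\<lambda>k. poly (P (N + k)) c) \<longlonglongrightarrow> entire_eval p c"
    using LIMSEQ_ignore_initial_segment[OF entire_sums[OF p, of c, unfolded sums_def], of "Suc N"]
    by (simp add: poly add.commute)
  ultimately have "entire_eval p c = 0" using LIMSEQ_unique by blast
  with cr show ?thesis using that by blast
qed

subsection \<open>Meromorphic functions and orders\<close>

abbreviation (input) mero :: "'a::{ultrametric_field, complete_space} fls \<Rightarrow> bool" where
  "mero \<equiv> meromorphic_fun"

abbreviation lin :: "'a::field \<Rightarrow> 'a fls" where
  "lin c \<equiv> fls_X - fls_const c"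

lemma lin_conv: "lin c = fps_to_fls (fps_X - fps_const c)"
  by simp

lemma X_minus_const_nonzero [simp]: "fps_X - fps_const (c :: 'a :: field) \<noteq> 0"
proof
  assume "fps_X - fps_const c = 0"
  hence "fps_nth (fps_X - fps_const c) 1 = 0" by simp
  thus False by simp
qed

lemma lin_nonzero [simp]: "lin (c :: 'a :: field) \<noteq> 0"
  unfolding lin_conv by (simp del: fps_to_fls_minus)

lemma fls_X_neq_const [simp]: "fls_X \<noteq> fls_const (c :: 'a :: field)"
  using lin_nonzero[of c] by (metis right_minus_eq)

lemma entire_linear [simp]: "entire (fps_X - fps_const (c :: 'a :: {ultrametric_field, complete_space}))"
  by (simp add: entire_diff)

lemma entire_power [simp]: "entire p \<Longrightarrow> entire (p ^ n :: 'a :: {ultrametric_field, complete_space} fps)"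
  by (induction n) (auto simp: entire_mult)

lemma entire_eval_linear [simp]:
  "entire_eval (fps_X - fps_const c) x = x - (c :: 'a :: {ultrametric_field, complete_space})"
  using entire_eval_linear_mult[of 1 c x] by simp

text \<open>Induction on the dominant index at a radius beyond |c|: dividing out a zero at c lowers
  it by exactly 1, so the process stops.\<close>

lemma entire_order_exists:
  fixes p :: "'a :: {ultrametric_field, complete_space} fps"
  assumes "entire p" "p \<noteq> 0"
  obtains k s where "entire s" "p = (fps_X - fps_const c) ^ k * s" "entire_eval s c \<noteq> 0"
proof -
  define r where "r = absval c + 1"
  have r: "r > 0" "absval c \<le> r" using absval_nonneg[of c] by (auto simp: r_def)
  obtain N where "isdom r p N" using entire_isdom assms r by metis
  hence "\<exists>k s. entire s \<and> p = (fps_X - fps_const c) ^ k * s \<and> entire_eval s c \<noteq> 0"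
    using assms(1)
  proof (induction N arbitrary: p rule: less_induct)
    case (less N)
    show ?case
    proof (cases "entire_eval p c = 0")
      case False
      thus ?thesis using less by (intro exI[of _ 0] exI[of _ p]) auto
    next
      case True
      then obtain s where s: "entire s" "p = (fps_X - fps_const c) * s"
        using entire_factor_zero less.prems by metis
      have "s \<noteq> 0" using s isdom_nz[OF less.prems(1)] by auto
      then obtain M where M: "isdom r s M" using entire_isdom s r by metis
      hence "isdom r p (1 + M)"
        using isdom_mult(1)[OF isdom_linear(1)[OF r(1), of c] M r(1)] s r by simp
      hence "N = 1 + M" using less.prems isdom_unique by blast
      with less.IH[OF _ M s(1)] obtain k t where t: "entire t" "s = (fps_X - fps_const c) ^ k * t"
        "entire_eval t c \<noteq> 0" by auto
      thus ?thesis using s(2) by (intro exI[of _ "Suc k"] exI[of _ t]) (auto simp: mult_ac)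
    qed
  qed
  thus ?thesis using that by blast
qed

lemma entire_eval_nz: "entire_eval p c \<noteq> 0 \<Longrightarrow> p \<noteq> 0"
  by auto

text \<open>After cancelling the smaller power of X - c, the entire function \<open>p * q'\<close>
  would vanish at c although neither factor does.\<close>

lemma has_order_at_unique_aux:
  fixes F :: "'a :: {ultrametric_field, complete_space} fls"
  assumes "has_order_at F c k" "has_order_at F c l" "k < l"
  shows False
proof -
  from assms(1) obtain p q where p: "entire p" "entire q" "entire_eval p c \<noteq> 0" "entire_eval q c \<noteq> 0"
    "F = lin c powi k * (fps_to_fls p / fps_to_fls q)" unfolding has_order_at_def by blast
  from assms(2) obtain p' q' where p': "entire p'" "entire q'" "entire_eval p' c \<noteq> 0" "entire_eval q' c \<noteq> 0"
    "F = lin c powi l * (fps_to_fls p' / fps_to_fls q')" unfolding has_order_at_def by blast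
  note nz = entire_eval_nz[OF p(3)] entire_eval_nz[OF p(4)] entire_eval_nz[OF p'(3)] entire_eval_nz[OF p'(4)]
  define m where "m = nat (l - k)"
  have m: "l = k + int m" "m > 0" using assms(3) by (auto simp: m_def)
  have "lin c powi k * (fps_to_fls p / fps_to_fls q) = lin c powi k * (lin c ^ m * (fps_to_fls p' / fps_to_fls q'))"
    using p(5) p'(5) by (simp add: m power_int_add mult.assoc)
  moreover have "lin c powi k \<noteq> 0" by (simp add: power_int_eq_0_iff)
  ultimately have "fps_to_fls p / fps_to_fls q = lin c ^ m * (fps_to_fls p' / fps_to_fls q')"
    using mult_left_cancel by blast
  hence "fps_to_fls p * fps_to_fls q' = lin c ^ m * fps_to_fls p' * fps_to_fls q"
    using nz by (simp add: field_simps)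
  hence "fps_to_fls (p * q') = fps_to_fls ((fps_X - fps_const c) ^ m * p' * q)"
    by (simp add: fls_times_fps_to_fls fps_to_fls_power)
  hence "p * q' = (fps_X - fps_const c) ^ m * p' * q" by (simp only: fps_to_fls_eq_iff)
  also have "\<dots> = (fps_X - fps_const c) * ((fps_X - fps_const c) ^ (m - 1) * p' * q)"
    using m(2) by (cases m) (auto simp: mult_ac)
  finally have "entire_eval (p * q') c = 0"
    using p p' by (simp add: entire_eval_linear_mult entire_mult)
  thus False using p p' by (simp add: entire_eval_mult)
qed

lemma has_order_at_unique:
  fixes F :: "'a :: {ultrametric_field, complete_space} fls"
  shows "has_order_at F c k \<Longrightarrow> has_order_at F c l \<Longrightarrow> k = l"
  using has_order_at_unique_aux[of F c] by (metis linorder_neqE)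

lemma has_order_at_nz: "has_order_at F c k \<Longrightarrow> F \<noteq> 0"
  unfolding has_order_at_def by (auto simp: power_int_eq_0_iff)

lemma omega_eq:
  fixes F :: "'a :: {ultrametric_field, complete_space} fls"
  assumes "has_order_at F c k"
  shows "omega c F = k"
  unfolding omega_def using assms has_order_at_unique has_order_at_nz by (metis the_equality)

lemma has_order_at_mult:
  fixes F :: "'a :: {ultrametric_field, complete_space} fls"
  assumes "has_order_at F c k" "has_order_at G c l"
  shows "has_order_at (F * G) c (k + l)"
proof -
  from assms(1) obtain p q where p: "entire p" "entire q" "entire_eval p c \<noteq> 0" "entire_eval q c \<noteq> 0"
    "F = lin c powi k * (fps_to_fls p / fps_to_fls q)" unfolding has_order_at_def by blast
  from assms(2) obtain p' q' where p': "entire p'" "entire q'" "entire_eval p' c \<noteq> 0" "entire_eval q' c \<noteq> 0"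
    "G = lin c powi l * (fps_to_fls p' / fps_to_fls q')" unfolding has_order_at_def by blast
  show ?thesis unfolding has_order_at_def
    by (rule exI[of _ "p * p'"], rule exI[of _ "q * q'"])
      (use p p' in \<open>auto simp: entire_mult entire_eval_mult power_int_add fls_times_fps_to_fls\<close>)
qed

lemma has_order_at_inverse:
  fixes F :: "'a :: {ultrametric_field, complete_space} fls"
  assumes "has_order_at F c k"
  shows "has_order_at (inverse F) c (- k)"
proof -
  from assms(1) obtain p q where p: "entire p" "entire q" "entire_eval p c \<noteq> 0" "entire_eval q c \<noteq> 0"
    "F = lin c powi k * (fps_to_fls p / fps_to_fls q)" unfolding has_order_at_def by blast
  show ?thesis unfolding has_order_at_def
    by (rule exI[of _ q], rule exI[of _ p])
      (use p in \<open>auto simp: power_int_minus field_simps\<close>)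
qed

lemma entire_has_order_at:
  fixes p :: "'a :: {ultrametric_field, complete_space} fps"
  assumes "entire p" "p \<noteq> 0"
  obtains k :: nat where "has_order_at (fps_to_fls p) c (int k)" "k > 0 \<longleftrightarrow> entire_eval p c = 0"
proof -
  obtain k s where s: "entire s" "p = (fps_X - fps_const c) ^ k * s" "entire_eval s c \<noteq> 0"
    using entire_order_exists assms by metis
  have "fps_to_fls p = lin c ^ k * fps_to_fls s"
    by (simp add: s(2) fls_times_fps_to_fls fps_to_fls_power)
  hence "has_order_at (fps_to_fls p) c (int k)"
    unfolding has_order_at_def using s by (intro exI[of _ s] exI[of _ 1]) auto
  moreover have "k > 0 \<longleftrightarrow> entire_eval p c = 0"
  proof (cases k)
    case 0
    thus ?thesis using s by simp
  next
    case (Suc m)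
    hence "p = (fps_X - fps_const c) * ((fps_X - fps_const c) ^ m * s)" using s by (simp add: mult_ac)
    hence "entire_eval p c = 0"
      using s by (metis entire_eval_linear_mult entire_linear entire_mult entire_power cancel_comm_monoid_add_class.diff_cancel mult_zero_left)
    thus ?thesis using Suc by simp
  qed
  ultimately show ?thesis using that by blast
qed

lemma meromorphic_has_order_at:
  assumes "mero F" "F \<noteq> 0"
  shows "has_order_at F c (omega c F)"
proof -
  obtain p q where p: "entire p" "entire q" "q \<noteq> 0" "F = fps_to_fls p / fps_to_fls q"
    using assms(1) unfolding meromorphic_fun_def by blast
  have "p \<noteq> 0" using assms p by auto
  then obtain k l where "has_order_at (fps_to_fls p) c k" "has_order_at (fps_to_fls q) c l"
    using entire_has_order_at p by metis
  hence "has_order_at F c (k + - l)"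
    unfolding p(4) field_class.field_divide_inverse by (intro has_order_at_mult has_order_at_inverse)
  thus ?thesis using omega_eq by metis
qed

section \<open>The field of meromorphic functions and its derivation\<close>

lemma mero_intro:
  "entire p \<Longrightarrow> entire q \<Longrightarrow> q \<noteq> 0 \<Longrightarrow> mero (fps_to_fls p / fps_to_fls q)"
  unfolding meromorphic_fun_def by blast

lemma mero_fps [simp]: "entire p \<Longrightarrow> mero (fps_to_fls p)"
  using mero_intro[of p 1] by simp

lemma mero_const [simp]: "mero (fls_const c)"
  using mero_fps[of "fps_const c"] by simp

lemma mero_0 [simp]: "mero 0" and mero_1 [simp]: "mero 1"
  using mero_const[of 0] mero_const[of 1] by auto

lemma mero_X [simp]: "mero fls_X"
  using mero_fps[of fps_X] by simp

lemma mero_common_denominator: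
  assumes "mero F" "mero G"
  obtains p p' q where "entire p" "entire p'" "entire q" "q \<noteq> 0"
    "F = fps_to_fls p / fps_to_fls q" "G = fps_to_fls p' / fps_to_fls q"
proof -
  obtain p q where p: "entire p" "entire q" "q \<noteq> 0" "F = fps_to_fls p / fps_to_fls q"
    using assms(1) unfolding meromorphic_fun_def by blast
  obtain p' q' where p': "entire p'" "entire q'" "q' \<noteq> 0" "G = fps_to_fls p' / fps_to_fls q'"
    using assms(2) unfolding meromorphic_fun_def by blast
  show ?thesis
    by (rule that[of "p * q'" "p' * q" "q * q'"])
      (use p p' in \<open>simp_all add: entire_mult fls_times_fps_to_fls\<close>)
qed

lemma mero_mult [simp]:
  assumes "mero F" "mero G" shows "mero (F * G)"
proof -
  obtain p p' q where "entire p" "entire p'" "entire q" "q \<noteq> 0"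
    "F = fps_to_fls p / fps_to_fls q" "G = fps_to_fls p' / fps_to_fls q"
    using mero_common_denominator[OF assms] .
  thus ?thesis using mero_intro[of "p * p'" "q * q"]
    by (simp add: entire_mult fls_times_fps_to_fls)
qed

lemma mero_inverse [simp]:
  assumes "mero F" shows "mero (inverse F)"
proof (cases "F = 0")
  case False
  obtain p q where p: "entire p" "entire q" "q \<noteq> 0" "F = fps_to_fls p / fps_to_fls q"
    using assms(1) unfolding meromorphic_fun_def by blast
  moreover have "p \<noteq> 0" using False p by auto
  ultimately show ?thesis using mero_intro[of q p] by simp
qed auto

lemma mero_divide [simp]:
  assumes "mero F" "mero G" shows "mero (F / G)"
  using assms by (simp add: field_class.field_divide_inverse)

lemma mero_add [simp]:
  assumes "mero F" "mero G" shows "mero (F + G)"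
proof -
  obtain p p' q where "entire p" "entire p'" "entire q" "q \<noteq> 0"
    "F = fps_to_fls p / fps_to_fls q" "G = fps_to_fls p' / fps_to_fls q"
    using mero_common_denominator[OF assms] .
  thus ?thesis using mero_intro[of "p + p'" q] by (simp add: entire_add add_divide_distrib)
qed

lemma mero_uminus [simp]:
  assumes "mero F" shows "mero (- F)"
  using mero_mult[OF mero_const[of "-1"] assms] by simp

lemma mero_diff [simp]:
  assumes "mero F" "mero G" shows "mero (F - G)"
  using mero_add[OF assms(1) mero_uminus[OF assms(2)]] by simp

lemma mero_power [simp]:
  assumes "mero F" shows "mero (F ^ n)"
  using assms by (induction n) auto

lemma fls_deriv_quotient:
  fixes p q :: "'a :: field fls"
  assumes "q \<noteq> 0"
  shows "fls_deriv (p / q) = (fls_deriv p * q - p * fls_deriv q) / q ^ 2"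
proof -
  have "fls_deriv (p / q * q) = fls_deriv p" using assms by simp
  hence "fls_deriv (p / q) * q + p / q * fls_deriv q = fls_deriv p"
    unfolding fls_deriv_mult by (simp only: algebra_simps)
  hence "fls_deriv (p / q) * q * q + p / q * fls_deriv q * q = fls_deriv p * q"
    by (metis distrib_right)
  thus ?thesis using assms by (simp add: field_simps power2_eq_square)
qed

lemma mero_deriv [simp]:
  assumes "mero F" shows "mero (fls_deriv F)"
proof -
  obtain p q where p: "entire p" "entire q" "q \<noteq> 0" "F = fps_to_fls p / fps_to_fls q"
    using assms(1) unfolding meromorphic_fun_def by blast
  hence "fls_deriv F = (fps_to_fls (fps_deriv p) * fps_to_fls q - fps_to_fls p * fps_to_fls (fps_deriv q)) / fps_to_fls q ^ 2"
    by (simp add: fls_deriv_quotient fls_deriv_fps_to_fls)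
  thus ?thesis using p by (simp add: entire_deriv)
qed

section \<open>Arithmetic of orders\<close>

lemma omega_0 [simp]: "omega c 0 = 0" by (simp add: omega_def)

lemma omega_mult:
  assumes "mero F" "mero G" "F \<noteq> 0" "G \<noteq> 0"
  shows "omega c (F * G) = omega c F + omega c G"
  using assms meromorphic_has_order_at has_order_at_mult omega_eq by metis

lemma omega_inverse:
  assumes "mero F"
  shows "omega c (inverse F) = - omega c F"
  using assms meromorphic_has_order_at has_order_at_inverse omega_eq
  by (metis add.inverse_neutral inverse_zero omega_0)

lemma omega_divide:
  assumes "mero F" "mero G" "F \<noteq> 0" "G \<noteq> 0"
  shows "omega c (F / G) = omega c F - omega c G"
  using assms by (simp add: field_class.field_divide_inverse omega_mult omega_inverse)

lemma omega_const [simp]: "omega c (fls_const (a :: 'a :: {ultrametric_field, complete_space})) = 0"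
proof (cases "a = 0")
  case False
  hence "has_order_at (fls_const a) c 0"
    unfolding has_order_at_def by (intro exI[of _ "fps_const a"] exI[of _ 1]) auto
  thus ?thesis by (rule omega_eq)
qed auto

lemma omega_1 [simp]: "omega c (1 :: 'a :: {ultrametric_field, complete_space} fls) = 0"
  using omega_const[of c 1] by simp

lemma omega_uminus:
  assumes "mero F"
  shows "omega c (- F) = omega c F"
proof (cases "F = 0")
  case False
  hence "omega c (fls_const (-1) * F) = omega c F"
    using assms omega_mult[of "fls_const (-1)" F c] omega_const[of c "-1"] by simp
  thus ?thesis by simp
qed auto

lemma omega_power:
  assumes "mero F" "F \<noteq> 0"
  shows "omega c (F ^ n) = int n * omega c F"
  using assms by (induction n) (auto simp: omega_mult algebra_simps)

lemma omega_lin: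
  fixes c d :: "'a :: {ultrametric_field, complete_space}"
  shows "omega c (lin d) = (if c = d then 1 else 0)"
proof -
  have "has_order_at (lin d) c (if c = d then 1 else 0)"
  proof (cases "c = d")
    case True thus ?thesis
      unfolding has_order_at_def by (intro exI[of _ 1]) auto
  next
    case False
    thus ?thesis
      unfolding has_order_at_def by (intro exI[of _ "fps_X - fps_const d"] exI[of _ 1]) auto
  qed
  thus ?thesis by (rule omega_eq)
qed

lemma omega_entire:
  fixes p :: "'a :: {ultrametric_field, complete_space} fps"
  assumes "entire p"
  shows "omega c (fps_to_fls p) \<ge> 0"
    and "p \<noteq> 0 \<Longrightarrow> omega c (fps_to_fls p) > 0 \<longleftrightarrow> entire_eval p c = 0"
proof -
  have "p = 0 \<or> (omega c (fps_to_fls p) \<ge> 0 \<and> (omega c (fps_to_fls p) > 0 \<longleftrightarrow> entire_eval p c = 0))"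
    using entire_has_order_at[OF assms, of c] omega_eq by (metis of_nat_0_le_iff of_nat_0_less_iff)
  thus "omega c (fps_to_fls p) \<ge> 0"
    "p \<noteq> 0 \<Longrightarrow> omega c (fps_to_fls p) > 0 \<longleftrightarrow> entire_eval p c = 0" by auto
qed

text \<open>Order at least \<open>k\<close>; unlike \<^const>\<open>omega\<close> this treats the zero function as having
  infinite order.\<close>

definition ordge :: "'a::ultrametric_field \<Rightarrow> int \<Rightarrow> 'a fls \<Rightarrow> bool" where
  "ordge c k F \<longleftrightarrow> F = 0 \<or> k \<le> omega c F"

lemma ordge_iff:
  assumes "mero F"
  shows "ordge c k F \<longleftrightarrow>
    (\<exists>p q. entire p \<and> entire q \<and> entire_eval q c \<noteq> 0 \<and> F = lin c powi k * (fps_to_fls p / fps_to_fls q))"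
    (is "_ \<longleftrightarrow> ?R")
proof
  assume *: "ordge c k F"
  show ?R
  proof (cases "F = 0")
    case True thus ?thesis by (intro exI[of _ 0] exI[of _ 1]) auto
  next
    case False
    define l where "l = omega c F"
    define m where "m = nat (l - k)"
    have m: "l = k + int m" using * False by (auto simp: ordge_def l_def m_def)
    obtain p q where p: "entire p" "entire q" "entire_eval p c \<noteq> 0" "entire_eval q c \<noteq> 0"
      "F = lin c powi l * (fps_to_fls p / fps_to_fls q)"
      using meromorphic_has_order_at[OF assms False, of c] unfolding has_order_at_def l_def by blast
    hence "F = lin c powi k * (fps_to_fls ((fps_X - fps_const c) ^ m * p) / fps_to_fls q)"
      by (simp add: m power_int_add fls_times_fps_to_fls fps_to_fls_power)
    thus ?thesis using p by (intro exI[of _ "(fps_X - fps_const c) ^ m * p"] exI[of _ q]) (auto simp: entire_mult)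
  qed
next
  assume ?R
  then obtain p q where p: "entire p" "entire q" "entire_eval q c \<noteq> 0"
    "F = lin c powi k * (fps_to_fls p / fps_to_fls q)" by blast
  show "ordge c k F"
  proof (cases "F = 0")
    case False
    hence "p \<noteq> 0" using p by auto
    then obtain m :: nat where m: "has_order_at (fps_to_fls p) c (int m)"
      using entire_has_order_at p by metis
    have "has_order_at (lin c powi k) c k"
      unfolding has_order_at_def by (intro exI[of _ 1]) auto
    moreover have "has_order_at (fps_to_fls q) c 0"
      unfolding has_order_at_def using p by (intro exI[of _ q] exI[of _ 1]) auto
    ultimately have "has_order_at F c (k + (int m + - 0))"
      unfolding p(4) field_class.field_divide_inverse using m by (intro has_order_at_mult has_order_at_inverse)
    thus ?thesis using omega_eq by (force simp: ordge_def)
  qed (simp add: ordge_def)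
qed

lemma ordge_add:
  assumes m: "mero F" "mero G" and "ordge c k F" "ordge c k G"
  shows "ordge c k (F + G)"
proof -
  obtain p q where p: "entire p" "entire q" "entire_eval q c \<noteq> 0"
    "F = lin c powi k * (fps_to_fls p / fps_to_fls q)"
    using assms(3) unfolding ordge_iff[OF m(1)] by blast
  obtain p' q' where p': "entire p'" "entire q'" "entire_eval q' c \<noteq> 0"
    "G = lin c powi k * (fps_to_fls p' / fps_to_fls q')"
    using assms(4) unfolding ordge_iff[OF m(2)] by blast
  note nz = entire_eval_nz[OF p(3)] entire_eval_nz[OF p'(3)]
  have "F + G = lin c powi k * (fps_to_fls (p * q' + p' * q) / fps_to_fls (q * q'))"
    using p p' nz by (simp add: fls_times_fps_to_fls add_divide_distrib ring_distribs)
  moreover have "entire_eval (q * q') c \<noteq> 0" using p p' by (simp add: entire_eval_mult)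
  moreover have "entire (p * q' + p' * q)" "entire (q * q')" using p p' by (auto simp: entire_mult entire_add)
  ultimately show ?thesis unfolding ordge_iff[OF mero_add[OF m]] by blast
qed

lemma ordge_mult:
  assumes m: "mero F" "mero G" and "ordge c k F" "ordge c l G"
  shows "ordge c (k + l) (F * G)"
  using assms omega_mult[OF m, of c] by (cases "F = 0 \<or> G = 0") (auto simp: ordge_def)

lemma ordge_uminus:
  shows "mero F \<Longrightarrow> ordge c k F \<Longrightarrow> ordge c k (- F)"
  by (auto simp: ordge_def omega_uminus)

lemma ordge_diff:
  assumes m: "mero F" "mero G" and "ordge c k F" "ordge c k G"
  shows "ordge c k (F - G)"
  using ordge_add[of F "-G" c k] assms ordge_uminus[of G c k] by simp

lemma ordge_mono: "ordge c k F \<Longrightarrow> l \<le> k \<Longrightarrow> ordge c l F"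
  by (auto simp: ordge_def)

lemma ordge_omega: "ordge c (omega c F) F" by (simp add: ordge_def)

lemma ordge_D: "ordge c k F \<Longrightarrow> F \<noteq> 0 \<Longrightarrow> k \<le> omega c F"
  by (simp add: ordge_def)

lemma omega_add_eq:
  assumes m: "mero F" "mero G" and nz: "F \<noteq> 0" "G \<noteq> 0"
    and less: "omega c F < omega c G"
  shows "F + G \<noteq> 0" "omega c (F + G) = omega c F"
proof -
  have uG: "omega c (-G) = omega c G" using omega_uminus m by blast
  show *: "F + G \<noteq> 0"
  proof
    assume "F + G = 0"
    hence "F = - G" by (simp add: eq_neg_iff_add_eq_0)
    thus False using uG less by simp
  qed
  have "ordge c (omega c F) (F + G)"
    using less by (intro ordge_add m) (auto simp: ordge_def)
  hence 1: "omega c F \<le> omega c (F + G)" using * by (rule ordge_D)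
  show "omega c (F + G) = omega c F"
  proof (rule ccontr)
    assume "omega c (F + G) \<noteq> omega c F"
    hence "ordge c (omega c F + 1) (F + G - G)"
      using 1 less m by (intro ordge_diff) (auto simp: ordge_def)
    thus False using nz by (simp add: ordge_def)
  qed
qed

lemma fls_deriv_power_int:
  fixes F :: "'a :: field_char_0 fls"
  assumes "F \<noteq> 0"
  shows "fls_deriv (F powi k) = of_int k * F powi (k - 1) * fls_deriv F"
proof (cases "k \<ge> 0")
  case True
  define m where "m = nat k"
  have k: "k = int m" using True by (simp add: m_def)
  show ?thesis
  proof (cases m)
    case (Suc l)
    have "k - 1 = int l" by (simp add: k Suc)
    hence "F powi (k - 1) = F ^ l" by simp
    moreover have "F powi k = F ^ Suc l" unfolding k Suc by (rule power_int_of_nat)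
    ultimately show ?thesis by (simp only: fls_deriv_power k Suc) simp
  qed (simp add: k)
next
  case False
  define m where "m = nat (- k)"
  have k: "k = - int m" and "m > 0" using False by (auto simp: m_def)
  have "fls_deriv (F powi k) = fls_deriv (inverse (F ^ m))" by (simp add: k power_int_minus)
  also have "\<dots> = - fls_deriv (F ^ m) / (F ^ m) ^ 2"
    using fls_deriv_quotient[of "F ^ m" 1] assms by (simp add: field_class.field_divide_inverse)
  also have "\<dots> = of_int k * (F ^ (m - 1) / (F ^ m) ^ 2) * fls_deriv F"
    by (simp add: fls_deriv_power k)
  also have "F ^ (m - 1) / (F ^ m) ^ 2 = F powi (k - 1)"
  proof -
    obtain l where l: "m = Suc l" using \<open>m > 0\<close> by (cases m) auto
    have "k - 1 = - int (Suc (Suc l))" by (simp add: k l)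
    hence "F powi (k - 1) = inverse (F ^ Suc (Suc l))"
      by (simp only: power_int_minus power_int_of_nat)
    moreover have "(F ^ m) ^ 2 = F ^ l * F ^ Suc (Suc l)"
      by (simp add: l power2_eq_square mult_ac)
    ultimately show ?thesis using assms by (simp add: l inverse_eq_divide del: power_Suc)
  qed
  finally show ?thesis .
qed

text \<open>Characteristic zero enters here: a nonzero order k stays nonzero as a field element, so
  the leading term of the derivative survives.\<close>

lemma omega_deriv:
  fixes F :: "'a :: {ultrametric_field, complete_space, field_char_0} fls"
  assumes F: "mero F" "F \<noteq> 0"
  shows "omega c F \<noteq> 0 \<Longrightarrow> fls_deriv F \<noteq> 0"
    and "omega c F \<noteq> 0 \<Longrightarrow> omega c (fls_deriv F) = omega c F - 1"
    and "omega c F = 0 \<Longrightarrow> ordge c 0 (fls_deriv F)"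
proof -
  define k where "k = omega c F"
  obtain p q where p: "entire p" "entire q" "entire_eval p c \<noteq> 0" "entire_eval q c \<noteq> 0"
    "F = lin c powi k * (fps_to_fls p / fps_to_fls q)"
    using meromorphic_has_order_at[OF F, of c] unfolding has_order_at_def k_def by blast
  note nz = entire_eval_nz[OF p(3)] entire_eval_nz[OF p(4)]
  define w where "w = fps_deriv p * q - p * fps_deriv q"
  have w: "entire w" using p by (auto simp: w_def entire_deriv entire_mult entire_diff)
  \<comment> \<open>The numerator of F' over \<open>q * q\<close> once (X - c)^(k - 1) is taken out.
    Its value at c is k p(c) q(c).\<close>
  define v where "v = fps_const (of_int k) * (p * q) + (fps_X - fps_const c) * w"
  have v: "entire v" using p w by (auto simp: v_def entire_mult entire_add)
  have vc: "entire_eval v c = of_int k * (entire_eval p c * entire_eval q c)"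
    using p w by (simp add: v_def entire_eval_add entire_eval_cmult entire_eval_linear_mult
        entire_mult entire_eval_mult)
  have dq: "fls_deriv (fps_to_fls p / fps_to_fls q) = fps_to_fls w / fps_to_fls (q * q)"
    using nz by (simp add: fls_deriv_quotient fls_deriv_fps_to_fls w_def fls_times_fps_to_fls power2_eq_square)
  have lk: "lin c powi k = lin c powi (k - 1) * lin c"
    using power_int_add[of "lin c" "k - 1" 1] by simp
  have "fls_deriv F = lin c powi k * (fps_to_fls w / fps_to_fls (q * q)) +
      of_int k * lin c powi (k - 1) * (fps_to_fls p / fps_to_fls q)"
    unfolding p(5) fls_deriv_mult dq fls_deriv_power_int[OF lin_nonzero] by simp
  also have "\<dots> = lin c powi (k - 1) * (fps_to_fls v / fps_to_fls (q * q))"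
    using nz by (simp add: lk v_def fls_times_fps_to_fls field_simps fls_of_int)
  finally have eq: "fls_deriv F = lin c powi (k - 1) * (fps_to_fls v / fps_to_fls (q * q))" .
  have qq: "entire (q * q)" "entire_eval (q * q) c \<noteq> 0" using p by (auto simp: entire_mult entire_eval_mult)
  have "has_order_at (fls_deriv F) c (k - 1)" if "k \<noteq> 0"
    unfolding has_order_at_def using eq v vc p qq that by (intro exI[of _ v] exI[of _ "q * q"]) auto
  thus "omega c F \<noteq> 0 \<Longrightarrow> fls_deriv F \<noteq> 0" "omega c F \<noteq> 0 \<Longrightarrow> omega c (fls_deriv F) = omega c F - 1"
    using omega_eq has_order_at_nz unfolding k_def by blast+
  assume "omega c F = 0"
  hence k0: "k = 0" by (simp add: k_def)
  have "fls_deriv F = lin c powi 0 * (fps_to_fls w / fps_to_fls (q * q))"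
    unfolding p(5) k0 using dq by simp
  thus "ordge c 0 (fls_deriv F)"
    using w qq unfolding ordge_iff[OF mero_deriv[OF F(1)]] by blast
qed

text \<open>The second bound covers what the first misses at k = 0: without a pole at c there is
  none in the derivative, although k - 1 is negative.\<close>

lemma ordge_deriv:
  fixes F :: "'a :: {ultrametric_field, complete_space, field_char_0} fls"
  assumes F: "mero F" "ordge c k F"
  shows "ordge c (k - 1) (fls_deriv F)" "ordge c 0 F \<Longrightarrow> ordge c 0 (fls_deriv F)"
  using assms omega_deriv[of F c]
  by (cases "F = 0"; cases "omega c F = 0"; force simp: ordge_def)+

subsection \<open>Counting functions and Jensen's formula\<close>

text \<open>Since \<open>ln 0 = 0\<close>, a zero of order \<open>m\<close> at the origin contributes the customary \<open>m * ln r\<close>.\<close>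

definition Nr :: "('a::ultrametric_field \<Rightarrow> int) \<Rightarrow> real \<Rightarrow> real" where
  "Nr d r = (\<Sum>z | absval z \<le> r \<and> d z \<noteq> 0. of_int (d z) * (ln r - ln (absval z)))"

definition locfin :: "('a::ultrametric_field \<Rightarrow> int) \<Rightarrow> bool" where
  "locfin d \<longleftrightarrow> (\<forall>r. finite {z. absval z \<le> r \<and> d z \<noteq> 0})"

lemma Nr_superset:
  assumes "finite S" "{z. absval z \<le> r \<and> d z \<noteq> 0} \<subseteq> S" "S \<subseteq> {z. absval z \<le> r}"
  shows "Nr d r = (\<Sum>z\<in>S. of_int (d z) * (ln r - ln (absval z)))"
  unfolding Nr_def using assms by (intro sum.mono_neutral_left) auto

lemma Nr_add_at:
  assumes "finite {z. absval z \<le> r \<and> d z \<noteq> 0}" "finite {z. absval z \<le> r \<and> e z \<noteq> 0}"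
  shows "Nr (\<lambda>z. d z + e z) r = Nr d r + Nr e r"
proof -
  define S where "S = {z. absval z \<le> r \<and> d z \<noteq> 0} \<union> {z. absval z \<le> r \<and> e z \<noteq> 0}"
  have S: "finite S" "S \<subseteq> {z. absval z \<le> r}" using assms by (auto simp: S_def)
  have "Nr d r = (\<Sum>z\<in>S. of_int (d z) * (ln r - ln (absval z)))"
    "Nr e r = (\<Sum>z\<in>S. of_int (e z) * (ln r - ln (absval z)))"
    "Nr (\<lambda>z. d z + e z) r = (\<Sum>z\<in>S. of_int (d z + e z) * (ln r - ln (absval z)))"
    using S by (intro Nr_superset; force simp: S_def)+
  thus ?thesis by (simp add: sum.distrib distrib_right)
qed

lemma Nr_cmult: "Nr (\<lambda>z. k * d z) r = of_int k * Nr d r"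
proof (cases "k = 0")
  case False
  thus ?thesis by (simp add: Nr_def sum_distrib_left mult.assoc)
qed (simp add: Nr_def)

lemma Nr_single:
  assumes "absval c \<le> r"
  shows "Nr (\<lambda>z. if z = c then 1 else 0) r = ln r - ln (absval c)"
proof -
  have "{z. absval z \<le> r \<and> (if z = c then 1 else 0) \<noteq> (0::int)} = {c}" using assms by auto
  thus ?thesis by (simp add: Nr_def)
qed

lemma weight_nonneg:
  assumes "r \<ge> 1" "absval (z :: 'a :: ultrametric_field) \<le> r"
  shows "ln r - ln (absval z) \<ge> 0"
proof (cases "z = 0")
  case False
  hence "absval z > 0" by simp
  thus ?thesis using assms by simp
qed (use assms in simp)

lemma Nr_nonneg: "r \<ge> 1 \<Longrightarrow> (\<And>z. d z \<ge> 0) \<Longrightarrow> Nr d r \<ge> 0"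
  unfolding Nr_def by (intro sum_nonneg mult_nonneg_nonneg) (auto dest: weight_nonneg)

lemma locfin_comp2:
  assumes "locfin d" "locfin e" "f 0 0 = 0"
  shows "locfin (\<lambda>z. f (d z) (e z))"
  unfolding locfin_def
proof
  fix r
  have "{z. absval z \<le> r \<and> f (d z) (e z) \<noteq> 0} \<subseteq>
        {z. absval z \<le> r \<and> d z \<noteq> 0} \<union> {z. absval z \<le> r \<and> e z \<noteq> 0}"
    using assms(3) by auto
  thus "finite {z. absval z \<le> r \<and> f (d z) (e z) \<noteq> 0}"
    using assms(1,2) finite_subset unfolding locfin_def by blast
qed

lemma locfin_comp: "locfin d \<Longrightarrow> f 0 = 0 \<Longrightarrow> locfin (\<lambda>z. f (d z))"
  using locfin_comp2[of d d "\<lambda>x y. f x"] by simp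

lemma locfin_add [intro]: "locfin d \<Longrightarrow> locfin e \<Longrightarrow> locfin (\<lambda>z. d z + e z)"
  using locfin_comp2[of d e "(+)"] by simp

lemma locfin_diff [intro]: "locfin d \<Longrightarrow> locfin e \<Longrightarrow> locfin (\<lambda>z. d z - e z)"
  using locfin_comp2[of d e "(-)"] by simp

lemma locfin_uminus [intro]: "locfin d \<Longrightarrow> locfin (\<lambda>z. - d z)"
  using locfin_comp[of d uminus] by simp

lemma locfin_cmult [intro]: "locfin d \<Longrightarrow> locfin (\<lambda>z. k * d z)"
  using locfin_comp[of d "(*) k"] by simp

lemma locfin_max0 [intro]: "locfin d \<Longrightarrow> locfin (\<lambda>z. max 0 (d z))"
  using locfin_comp[of d "max 0"] by simp

lemma Nr_add: "locfin d \<Longrightarrow> locfin e \<Longrightarrow> Nr (\<lambda>z. d z + e z) r = Nr d r + Nr e r"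
  unfolding locfin_def by (intro Nr_add_at) auto

lemma Nr_uminus: "Nr (\<lambda>z. - d z) r = - Nr d r"
  using Nr_cmult[of "-1" d r] by simp

lemma Nr_diff: "locfin d \<Longrightarrow> locfin e \<Longrightarrow> Nr (\<lambda>z. d z - e z) r = Nr d r - Nr e r"
  using Nr_add[of d "\<lambda>z. - e z" r] Nr_uminus[of e r] by (simp add: locfin_uminus)

lemma Nr_mono:
  assumes "locfin d" "locfin e" "\<And>z. d z \<le> e z" "r \<ge> 1"
  shows "Nr d r \<le> Nr e r"
proof -
  have "Nr (\<lambda>z. e z - d z) r \<ge> 0" using assms by (intro Nr_nonneg) auto
  thus ?thesis using Nr_diff[OF assms(2,1), of r] by simp
qed

lemma Z_count_eq: "Z_count r F = Nr (\<lambda>z. max 0 (omega z F)) r"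
proof -
  have "{z. absval z \<le> r \<and> max 0 (omega z F) \<noteq> 0} = {z. omega z F > 0 \<and> absval z \<le> r}" by auto
  thus ?thesis unfolding Z_count_def Nr_def by (auto intro: sum.cong)
qed

text \<open>Induction on the dominant index. At index 0 the constant term dominates and there is no
  zero in the disc; otherwise \<open>entire_has_zero\<close> supplies a zero c, and removing X - c
  lowers the index by 1 and divides the norm by r.\<close>

lemma jensen_entire:
  fixes p :: "'a :: {ultrametric_field, complete_space, alg_closed_field} fps"
  assumes p: "entire p" "p \<noteq> 0" and r: "r > 0"
  shows "finite {z. absval z \<le> r \<and> omega z (fps_to_fls p) \<noteq> 0} \<and>
    ln (gauss r p) = Nr (\<lambda>z. omega z (fps_to_fls p)) r + ln (absval (fps_nth p (subdegree p)))"
proof -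
  obtain N where "isdom r p N" using entire_isdom assms by metis
  thus ?thesis using p
  proof (induction N arbitrary: p)
    case 0
    have "omega z (fps_to_fls p) = 0" if "absval z \<le> r" for z
    proof (rule ccontr)
      assume "omega z (fps_to_fls p) \<noteq> 0"
      hence "entire_eval p z = 0" using omega_entire[of p z] "0.prems" by linarith
      then obtain s where s: "entire s" "p = (fps_X - fps_const z) * s"
        using entire_factor_zero "0.prems" by metis
      have "s \<noteq> 0" using s "0.prems" by auto
      then obtain M where M: "isdom r s M" using entire_isdom s r by metis
      hence "isdom r p (1 + M)"
        using isdom_mult(1)[OF isdom_linear(1)[OF r(1), of z] M r(1)] s that by simp
      thus False using "0.prems" isdom_unique by force
    qed
    hence *: "{z. absval z \<le> r \<and> omega z (fps_to_fls p) \<noteq> 0} = {}" by auto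
    have "gterm r p 0 > 0" using "0.prems" by (auto simp: isdom_def)
    hence "fps_nth p 0 \<noteq> 0" by (simp add: gterm_def)
    hence "subdegree p = 0" by simp
    thus ?case unfolding Nr_def * using gauss_isdom[OF "0.prems"(1)] by (simp add: gterm_def)
  next
    case (Suc N)
    obtain c where c: "absval c \<le> r" "entire_eval p c = 0"
      using entire_has_zero[OF Suc.prems(2) r Suc.prems(1)] by auto
    obtain s where s: "entire s" "p = (fps_X - fps_const c) * s"
      using entire_factor_zero Suc.prems c by metis
    have s0: "s \<noteq> 0" using s Suc.prems by auto
    then obtain M where M: "isdom r s M" using entire_isdom s r by metis
    have *: "isdom r p (1 + M)" "gauss r p = r * gauss r s"
      using isdom_mult[OF isdom_linear(1)[OF r(1), of c] M r(1)] isdom_linear(2)[OF r, of c] s c by auto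
    have "Suc N = 1 + M" using isdom_unique[OF Suc.prems(1) *(1)] .
    hence "M = N" by simp
    note IH = Suc.IH[OF M[unfolded \<open>M = N\<close>] s(1) s0]
    have om: "omega z (fps_to_fls p) = (if z = c then 1 else 0) + omega z (fps_to_fls s)" for z
    proof -
      have "fps_to_fls p = lin c * fps_to_fls s" by (simp add: s(2) fls_times_fps_to_fls)
      thus ?thesis using s s0 by (simp add: omega_mult omega_lin)
    qed
    have fin1: "finite {z. absval z \<le> r \<and> (if z = c then 1 else 0) \<noteq> (0::int)}"
      by (rule finite_subset[of _ "{c}"]) (auto split: if_splits)
    have "{z. absval z \<le> r \<and> omega z (fps_to_fls p) \<noteq> 0} \<subseteq>
      insert c {z. absval z \<le> r \<and> omega z (fps_to_fls s) \<noteq> 0}" by (auto simp: om)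
    hence sub: "{z. absval z \<le> r \<and> omega z (fps_to_fls p) \<noteq> 0} \<subseteq>
      insert c {z. absval z \<le> r \<and> omega z (fps_to_fls s) \<noteq> 0}" .
    have fin2: "finite {z. absval z \<le> r \<and> omega z (fps_to_fls s) \<noteq> 0}" using IH by blast
    have fin: "finite {z. absval z \<le> r \<and> omega z (fps_to_fls p) \<noteq> 0}"
      using fin2 by (intro finite_subset[OF sub]) simp
    have N: "Nr (\<lambda>z. omega z (fps_to_fls p)) r = ln r - ln (absval c) + Nr (\<lambda>z. omega z (fps_to_fls s)) r"
      unfolding om using Nr_add_at[OF fin1 fin2] Nr_single[OF c(1)] by simp
    have g: "ln (gauss r p) = ln r + ln (gauss r s)"
      using * r gauss_pos[OF s(1) r s0] by (simp add: ln_mult)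
    define u where "u = fps_nth (fps_X - fps_const c) (subdegree (fps_X - fps_const c))"
    have "u \<noteq> 0" unfolding u_def by (rule nth_subdegree_nonzero) simp
    have p_lead: "fps_nth p (subdegree p) = u * fps_nth s (subdegree s)" unfolding u_def
      unfolding s(2) using s0 by (simp add: subdegree_mult fps_mult_nth_outside_subdegrees del: fps_sub_nth)
    \<comment> \<open>The lowest coefficient u of X - c is -c, or 1 if c = 0. The convention ln 0 =
      0 makes both cases agree.\<close>
    have "ln (absval u) = ln (absval c)"
    proof (cases "c = 0")
      case True thus ?thesis by (simp add: u_def)
    next
      case False
      hence "subdegree (fps_X - fps_const c) = 0" by simp
      thus ?thesis by (simp add: u_def)
    qed
    hence "ln (absval (fps_nth p (subdegree p))) = ln (absval c) + ln (absval (fps_nth s (subdegree s)))"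
      using s0 \<open>u \<noteq> 0\<close> by (simp add: p_lead absval_mult ln_mult)
    thus ?case using N g IH fin by simp
  qed
qed

subsection \<open>The Gauss norms of a meromorphic function\<close>

text \<open>The extension of the Gauss norm to quotients. A representation as a quotient is not
  unique; multiplicativity of \<open>gauss\<close> makes the value independent of it, which is
  \<open>nrm_eq\<close>.\<close>

definition nrm :: "real \<Rightarrow> 'a::ultrametric_field fls \<Rightarrow> real" where
  "nrm r F = (THE c. \<exists>p q. entire p \<and> entire q \<and> q \<noteq> 0 \<and> F = fps_to_fls p / fps_to_fls q \<and>
     c = gauss r p / gauss r q)"

lemma nrm_eq:
  fixes p q :: "'a :: {ultrametric_field, complete_space} fps"
  assumes p: "entire p" "entire q" "q \<noteq> 0" and r: "r > 0"
  shows "nrm r (fps_to_fls p / fps_to_fls q) = gauss r p / gauss r q"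
  unfolding nrm_def
proof (rule the_equality)
  show "\<exists>p' q'. entire p' \<and> entire q' \<and> q' \<noteq> 0 \<and> fps_to_fls p / fps_to_fls q = fps_to_fls p' / fps_to_fls q' \<and>
     gauss r p / gauss r q = gauss r p' / gauss r q'" using p by blast
next
  fix c
  assume "\<exists>p' q'. entire p' \<and> entire q' \<and> q' \<noteq> 0 \<and> fps_to_fls p / fps_to_fls q = fps_to_fls p' / fps_to_fls q' \<and>
     c = gauss r p' / gauss r q'"
  then obtain p' q' where p': "entire p'" "entire q'" "q' \<noteq> 0"
    "fps_to_fls p / fps_to_fls q = fps_to_fls p' / fps_to_fls q'" "c = gauss r p' / gauss r q'" by blast
  have "fps_to_fls (p * q') = fps_to_fls (p' * q)"
    using p'(3,4) p(3) by (simp add: fls_times_fps_to_fls field_simps)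
  hence "p * q' = p' * q" by (simp only: fps_to_fls_eq_iff)
  hence "gauss r p * gauss r q' = gauss r p' * gauss r q" using p p' r by (metis gauss_mult)
  moreover have "gauss r q > 0" "gauss r q' > 0" using p p' r by (auto simp: gauss_pos)
  ultimately show "c = gauss r p / gauss r q" using p'(5) by (simp add: frac_eq_eq)
qed

context
  fixes r :: real assumes r: "r > 0"
begin

lemma nrm_pos:
  assumes "mero F" "F \<noteq> 0" shows "nrm r F > 0"
proof -
  obtain p q where p: "entire p" "entire q" "q \<noteq> 0" "F = fps_to_fls p / fps_to_fls q"
    using assms(1) unfolding meromorphic_fun_def by blast
  have "p \<noteq> 0" using assms p by auto
  thus ?thesis using p r by (simp add: nrm_eq gauss_pos)
qed

lemma nrm_0 [simp]: "nrm r (0 :: 'a :: {ultrametric_field, complete_space} fls) = 0"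
  using nrm_eq[OF _ _ _ r, of 0 1] by simp

lemma nrm_nonneg:
  assumes "mero F" shows "nrm r F \<ge> 0"
  using nrm_pos[OF assms] by (cases "F = 0") auto

lemma nrm_const:
  "nrm r (fls_const c) = absval (c :: 'a :: {ultrametric_field, complete_space})"
  using nrm_eq[OF _ _ _ r, of "fps_const c" 1] gauss_const[OF r, of c] gauss_const[OF r, of "1::'a"] by simp

lemma nrm_1 [simp]: "nrm r (1 :: 'a :: {ultrametric_field, complete_space} fls) = 1"
  using nrm_const[of 1] by simp

lemma nrm_mult:
  assumes "mero F" "mero G"
  shows "nrm r (F * G) = nrm r F * nrm r G"
proof -
  obtain p p' q where p: "entire p" "entire p'" "entire q" "q \<noteq> 0"
    "F = fps_to_fls p / fps_to_fls q" "G = fps_to_fls p' / fps_to_fls q"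
    using mero_common_denominator[OF assms] .
  have "F * G = fps_to_fls (p * p') / fps_to_fls (q * q)" using p by (simp add: fls_times_fps_to_fls)
  hence "nrm r (F * G) = gauss r (p * p') / gauss r (q * q)"
    using p r by (simp only: nrm_eq entire_mult no_zero_divisors not_False_eq_True)
  thus ?thesis using p r by (simp add: nrm_eq gauss_mult)
qed

lemma nrm_inverse:
  assumes "mero F"
  shows "nrm r (inverse F) = inverse (nrm r F)"
proof (cases "F = 0")
  case False
  hence "nrm r F * nrm r (inverse F) = 1" using assms by (simp flip: nrm_mult)
  thus ?thesis by (metis inverse_unique)
qed auto

lemma nrm_divide:
  assumes "mero F" "mero G"
  shows "nrm r (F / G) = nrm r F / nrm r G"
  using assms by (simp add: field_class.field_divide_inverse nrm_mult nrm_inverse)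

lemma nrm_power:
  assumes "mero F"
  shows "nrm r (F ^ n) = nrm r F ^ n"
  using assms by (induction n) (auto simp: nrm_mult)

lemma nrm_add:
  assumes "mero F" "mero G"
  shows "nrm r (F + G) \<le> max (nrm r F) (nrm r G)"
proof -
  obtain p p' q where p: "entire p" "entire p'" "entire q" "q \<noteq> 0"
    "F = fps_to_fls p / fps_to_fls q" "G = fps_to_fls p' / fps_to_fls q"
    using mero_common_denominator[OF assms] .
  have "F + G = fps_to_fls (p + p') / fps_to_fls q" using p by (simp add: add_divide_distrib)
  hence "nrm r (F + G) = gauss r (p + p') / gauss r q"
    using p r by (simp only: nrm_eq entire_add not_False_eq_True)
  also have "\<dots> \<le> max (gauss r p) (gauss r p') / gauss r q"
    using p r by (intro divide_right_mono gauss_add gauss_nonneg)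
  also have "\<dots> = max (nrm r F) (nrm r G)"
    using p r gauss_pos[of q r] by (simp add: nrm_eq max_divide_distrib_right)
  finally show ?thesis .
qed

lemma nrm_uminus:
  assumes "mero F"
  shows "nrm r (- F) = nrm r F"
  using nrm_mult[OF mero_const[of "-1"] assms] nrm_const[of "-1::'a"] by simp

lemma nrm_diff:
  assumes "mero F" "mero G"
  shows "nrm r (F - G) \<le> max (nrm r F) (nrm r G)"
  using nrm_add[of F "-G"] nrm_uminus[of G] assms by simp

text \<open>The ultrametric lemma on the logarithmic derivative: each term of the quotient rule
  holds one derivative, so 1 / r is gained at every radius, with no exceptional set.\<close>

lemma nrm_deriv:
  assumes "mero F"
  shows "nrm r (fls_deriv F) \<le> nrm r F / r"
proof -
  obtain p q where p: "entire p" "entire q" "q \<noteq> 0" "F = fps_to_fls p / fps_to_fls q"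
    using assms(1) unfolding meromorphic_fun_def by blast
  have pos: "gauss r q > 0" using p r by (auto simp: gauss_pos)
  have "fls_deriv F = fps_to_fls (fps_deriv p * q - p * fps_deriv q) / fps_to_fls (q * q)"
    using p by (simp add: fls_deriv_quotient fls_deriv_fps_to_fls fls_times_fps_to_fls power2_eq_square)
  hence "nrm r (fls_deriv F) = gauss r (fps_deriv p * q - p * fps_deriv q) / gauss r (q * q)"
    using p r by (simp only: nrm_eq entire_mult entire_diff entire_deriv no_zero_divisors not_False_eq_True)
  also have "\<dots> = gauss r (fps_deriv p * q + - (p * fps_deriv q)) / gauss r (q * q)" by simp
  also have "\<dots> \<le> (gauss r p * gauss r q / r) / gauss r (q * q)"
  proof (intro divide_right_mono gauss_nonneg)
    have "gauss r (- (p * fps_deriv q)) = gauss r (p * fps_deriv q)"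
      using gauss_mult[of "fps_const (-1)" "p * fps_deriv q" r] p r gauss_const[OF r, of "-1::'a"]
      by (metis absval_1 absval_minus entire_const entire_deriv entire_mult fps_const_1_eq_1 fps_const_neg mult_1 mult_minus1)
    hence "gauss r (fps_deriv p * q + - (p * fps_deriv q)) \<le>
      max (gauss r (fps_deriv p * q)) (gauss r (p * fps_deriv q))"
      using gauss_add[of "fps_deriv p * q" "- (p * fps_deriv q)" r] p r
      by (simp add: entire_mult entire_deriv entire_uminus)
    also have "\<dots> \<le> gauss r p * gauss r q / r"
    proof (rule max.boundedI)
      have "gauss r (fps_deriv p) * gauss r q \<le> gauss r p / r * gauss r q"
        using p r by (intro mult_right_mono gauss_deriv gauss_nonneg) auto
      thus "gauss r (fps_deriv p * q) \<le> gauss r p * gauss r q / r"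
        using p r by (simp add: gauss_mult entire_deriv)
      have "gauss r p * gauss r (fps_deriv q) \<le> gauss r p * (gauss r q / r)"
        using p r by (intro mult_left_mono gauss_deriv gauss_nonneg) auto
      thus "gauss r (p * fps_deriv q) \<le> gauss r p * gauss r q / r"
        using p r by (simp add: gauss_mult entire_deriv)
    qed
    finally show "gauss r (fps_deriv p * q + - (p * fps_deriv q)) \<le> gauss r p * gauss r q / r" .
  qed (use p r in \<open>auto simp: entire_mult\<close>)
  also have "\<dots> = gauss r p / gauss r q / r" using p r pos by (simp add: gauss_mult)
  finally show ?thesis using p r by (simp add: nrm_eq)
qed

lemma nrm_add_eq:
  assumes "mero F" "mero G" "nrm r G < nrm r F"
  shows "nrm r (F + G) = nrm r F"
  using nrm_add[of F G] nrm_diff[of "F + G" G] assms by (auto simp: max_def split: if_splits)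

end

lemma jensen:
  fixes F :: "'a :: {ultrametric_field, complete_space, alg_closed_field} fls"
  assumes F: "mero F" "F \<noteq> 0"
  shows "locfin (\<lambda>z. omega z F)"
    and "\<exists>C. \<forall>r>0. ln (nrm r F) = Nr (\<lambda>z. omega z F) r + C"
proof -
  obtain p q where p: "entire p" "entire q" "q \<noteq> 0" "F = fps_to_fls p / fps_to_fls q"
    using assms(1) unfolding meromorphic_fun_def by blast
  have p0: "p \<noteq> 0" using F p by auto
  have lf: "locfin (\<lambda>z. omega z (fps_to_fls s))" if "entire s" "s \<noteq> 0" for s :: "'a fps"
    unfolding locfin_def
  proof
    fix r
    have "finite {z. absval z \<le> max r 1 \<and> omega z (fps_to_fls s) \<noteq> 0}"
      using jensen_entire[OF that, of "max r 1"] by simp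
    thus "finite {z. absval z \<le> r \<and> omega z (fps_to_fls s) \<noteq> 0}"
      by (rule finite_subset[rotated]) auto
  qed
  have om: "omega z F = omega z (fps_to_fls p) - omega z (fps_to_fls q)" for z
    using p p0 by (simp add: omega_divide)
  show "locfin (\<lambda>z. omega z F)" unfolding om using p p0 by (intro locfin_diff lf)
  have "ln (nrm r F) = Nr (\<lambda>z. omega z F) r +
      (ln (absval (fps_nth p (subdegree p))) - ln (absval (fps_nth q (subdegree q))))" if r: "r > 0" for r
  proof -
    have "gauss r p > 0" "gauss r q > 0" using p p0 r by (auto simp: gauss_pos)
    hence "ln (nrm r F) = ln (gauss r p) - ln (gauss r q)"
      using p r by (simp add: nrm_eq ln_div)
    moreover have "Nr (\<lambda>z. omega z F) r = Nr (\<lambda>z. omega z (fps_to_fls p)) r - Nr (\<lambda>z. omega z (fps_to_fls q)) r"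
      unfolding om using p p0 by (intro Nr_diff lf)
    ultimately show ?thesis using jensen_entire[OF p(1) p0 r] jensen_entire[OF p(2,3) r] by simp
  qed
  thus "\<exists>C. \<forall>r>0. ln (nrm r F) = Nr (\<lambda>z. omega z F) r + C" by blast
qed

subsection \<open>The characteristic function\<close>

definition Zc :: "'a::{ultrametric_field, complete_space, alg_closed_field} fls \<Rightarrow> real \<Rightarrow> real" where
  "Zc F = Nr (\<lambda>z. max 0 (omega z F))"

definition Nc :: "'a::{ultrametric_field, complete_space, alg_closed_field} fls \<Rightarrow> real \<Rightarrow> real" where
  "Nc F = Nr (\<lambda>z. max 0 (- omega z F))"

text \<open>Nevanlinna's characteristic with the Gauss norm in the proximity term. By Jensen's
  formula it is max (Z + C) N for a constant C, hence \<open>T_char\<close> up to a bounded term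
  where the latter is meaningful.\<close>

definition Tc :: "'a::{ultrametric_field, complete_space, alg_closed_field} fls \<Rightarrow> real \<Rightarrow> real" where
  "Tc F r = max (ln (nrm r F)) 0 + Nc F r"

text \<open>Radii start at 1, where ln r and all weights of the counting functions are
  nonnegative.\<close>

definition lebd :: "(real \<Rightarrow> real) \<Rightarrow> (real \<Rightarrow> real) \<Rightarrow> bool" where
  "lebd A B \<longleftrightarrow> (\<exists>C. \<forall>r\<ge>1. A r \<le> B r + C)"

lemma lebdE:
  assumes "lebd A B" obtains C where "\<And>r. r \<ge> 1 \<Longrightarrow> A r \<le> B r + C"
  using assms unfolding lebd_def by blast

lemma lebdI: "(\<And>r. r \<ge> 1 \<Longrightarrow> A r \<le> B r + C) \<Longrightarrow> lebd A B"
  unfolding lebd_def by blast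

context
  fixes F :: "'a :: {ultrametric_field, complete_space, alg_closed_field} fls"
  assumes F: "mero F" "F \<noteq> 0"
begin

lemma locfin_omega [intro]: "locfin (\<lambda>z. omega z F)"
  using jensen F by blast

lemma locfin_zeros [intro]: "locfin (\<lambda>z. max 0 (omega z F))"
  by (intro locfin_max0 locfin_omega)

lemma locfin_poles [intro]: "locfin (\<lambda>z. max 0 (- omega z F))"
  by (intro locfin_max0 locfin_uminus locfin_omega)

lemma jensen_Zc_Nc:
  obtains C where "\<And>r. r > 0 \<Longrightarrow> ln (nrm r F) = Zc F r - Nc F r + C"
proof -
  obtain C where C: "\<forall>r>0. ln (nrm r F) = Nr (\<lambda>z. omega z F) r + C" using jensen F by blast
  have "Nr (\<lambda>z. omega z F) r = Zc F r - Nc F r" for r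
  proof -
    have "(\<lambda>z. omega z F) = (\<lambda>z. max 0 (omega z F) - max 0 (- omega z F))"
      by (auto simp: max_def)
    thus ?thesis unfolding Zc_def Nc_def by (metis Nr_diff locfin_zeros locfin_poles)
  qed
  with C show ?thesis using that by force
qed

lemma Zc_nonneg: "r \<ge> 1 \<Longrightarrow> Zc F r \<ge> 0"
  unfolding Zc_def by (intro Nr_nonneg) auto

lemma Nc_nonneg: "r \<ge> 1 \<Longrightarrow> Nc F r \<ge> 0"
  unfolding Nc_def by (intro Nr_nonneg) auto

lemma Nc_le_Tc: "Nc F r \<le> Tc F r"
  unfolding Tc_def by simp

lemma Tc_nonneg: "r \<ge> 1 \<Longrightarrow> Tc F r \<ge> 0"
  using Nc_nonneg Nc_le_Tc by (meson order_trans)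

end

lemma omega_uminus_const [simp]:
  "omega c (- fls_const (a :: 'a :: {ultrametric_field, complete_space})) = 0"
  using omega_const[of c "-a"] by simp

lemma omega_diff_const:
  assumes F: "mero F" "F \<noteq> 0"
  shows "omega z F < 0 \<Longrightarrow> omega z (F - fls_const c) = omega z F"
    and "omega z F > 0 \<Longrightarrow> c \<noteq> 0 \<Longrightarrow> omega z (F - fls_const c) = 0"
    and "omega z F = 0 \<Longrightarrow> omega z (F - fls_const c) \<ge> 0"
proof -
  note * = omega_add_eq[OF F(1) mero_const[of "-c"] F(2)]
    omega_add_eq[OF mero_const[of "-c"] F(1) _ F(2)]
  show "omega z (F - fls_const c) = omega z F" if "omega z F < 0"
    using *(2)[of z] that by (cases "c = 0") auto
  show "omega z (F - fls_const c) = 0" if "omega z F > 0" "c \<noteq> 0"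
  proof -
    have "omega z (fls_const (-c) + F) = 0" using *(4)[of z] that by auto
    thus ?thesis by simp
  qed
  show "omega z (F - fls_const c) \<ge> 0" if "omega z F = 0"
    using ordge_diff[OF F(1) mero_const[of c], of z 0] that by (auto simp: ordge_def)
qed

lemma Nc_diff_const:
  assumes F: "mero F" "F \<noteq> 0"
  shows "Nc (F - fls_const c) = Nc F"
proof -
  have "max 0 (- omega z (F - fls_const c)) = max 0 (- omega z F)" for z
    using omega_diff_const[OF F, of z c]
    by (cases "c = 0"; cases "omega z F" "0::int" rule: linorder_cases) auto
  thus ?thesis by (simp add: Nc_def)
qed

text \<open>The needed half of the first main theorem. Subtracting c keeps the poles and raises the
  positive part of ln |F|_r by at most ln M; Jensen's formula turns this into a bound for the
  zeros.\<close>

lemma Zc_diff_const_le: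
  assumes F: "mero F" "F \<noteq> 0" "F \<noteq> fls_const c"
  shows "lebd (Zc (F - fls_const c)) (Tc F)"
proof -
  have G: "mero (F - fls_const c)" "F - fls_const c \<noteq> 0" using F by auto
  obtain C where C: "\<And>r. r > 0 \<Longrightarrow> ln (nrm r (F - fls_const c)) = Zc (F - fls_const c) r - Nc (F - fls_const c) r + C"
    using jensen_Zc_Nc[OF G] by metis
  show ?thesis
  proof (rule lebdI)
    fix r :: real assume r: "r \<ge> 1"
    define M where "M = max (absval c) 1"
    have "nrm r (F - fls_const c) \<le> max (nrm r F) (absval c)"
      using nrm_diff[of r F "fls_const c"] nrm_const[of r c] r F by simp
    also have "\<dots> \<le> max (nrm r F) 1 * M"
    proof (rule max.boundedI)
      have "nrm r F * 1 \<le> max (nrm r F) 1 * M" using r F nrm_nonneg[of r F] by (intro mult_mono) (auto simp: M_def)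
      thus "nrm r F \<le> max (nrm r F) 1 * M" by simp
      have "1 * absval c \<le> max (nrm r F) 1 * M" using absval_nonneg[of c] by (intro mult_mono) (auto simp: M_def)
      thus "absval c \<le> max (nrm r F) 1 * M" by simp
    qed
    finally have "ln (nrm r (F - fls_const c)) \<le> ln (max (nrm r F) 1 * M)"
      using nrm_pos[OF _ G, of r] r by simp
    also have "\<dots> = ln (max (nrm r F) 1) + ln M"
      using nrm_pos[of r F] r F by (intro ln_mult_pos) (auto simp: M_def)
    also have "ln (max (nrm r F) 1) = max (ln (nrm r F)) 0"
      using nrm_pos[of r F] r F by (auto simp: max_def)
    finally have "ln (nrm r (F - fls_const c)) \<le> max (ln (nrm r F)) 0 + ln M" .
    thus "Zc (F - fls_const c) r \<le> Tc F r + (ln M - C)"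
      using C[of r] r Nc_diff_const[OF F(1,2), of c] by (simp add: Tc_def)
  qed
qed

lemma Zc_le:
  assumes F: "mero F" "F \<noteq> 0"
  shows "lebd (Zc F) (Tc F)"
  using Zc_diff_const_le[of F 0] assms by simp

lemma omega_log_deriv:
  fixes F :: "'a :: {ultrametric_field, complete_space, field_char_0} fls"
  assumes F: "mero F" "F \<noteq> 0" "fls_deriv F \<noteq> 0"
  shows "omega z (fls_deriv F / F) = omega z (fls_deriv F) - omega z F"
  using F by (intro omega_divide) auto

lemma omega_deriv_ge0:
  fixes F :: "'a :: {ultrametric_field, complete_space, field_char_0} fls"
  assumes F: "mero F" "F \<noteq> 0" "fls_deriv F \<noteq> 0" "omega z F = 0"
  shows "omega z (fls_deriv F) \<ge> 0"
  using omega_deriv(3)[OF F(1,2,4)] F(3) by (simp add: ordge_def)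

lemma nrm_log_deriv:
  assumes F: "mero F" "F \<noteq> 0" "fls_deriv F \<noteq> 0" and r: "r > 0"
  shows "ln (nrm r (fls_deriv F)) \<le> ln (nrm r F) - ln r"
proof -
  have "ln (nrm r (fls_deriv F)) \<le> ln (nrm r F / r)"
    using nrm_deriv[OF r F(1)] nrm_pos[OF r mero_deriv[OF F(1)] F(3)] by simp
  also have "\<dots> = ln (nrm r F) - ln r" using nrm_pos[OF r F(1,2)] r by (simp add: ln_div)
  finally show ?thesis .
qed

text \<open>The poles of F'/F are simple and lie at zeros and poles of F, which gives 2 T(F). Since
  |F'/F|_r \<le> 1 / r, Jensen's formula bounds the zeros by these poles less ln r.\<close>

lemma Zc_log_deriv:
  fixes F :: "'a :: {ultrametric_field, complete_space, alg_closed_field, field_char_0} fls"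
  assumes F: "mero F" "F \<noteq> 0" "fls_deriv F \<noteq> 0"
  shows "lebd (Zc (fls_deriv F / F)) (\<lambda>r. 2 * Tc F r - ln r)"
proof -
  define L where "L = fls_deriv F / F"
  have L: "mero L" "L \<noteq> 0" using F by (auto simp: L_def)
  obtain C where C: "\<And>r. r > 0 \<Longrightarrow> ln (nrm r L) = Zc L r - Nc L r + C"
    using jensen_Zc_Nc[OF L] by metis
  obtain D where D: "\<And>r. r \<ge> 1 \<Longrightarrow> Zc F r \<le> Tc F r + D" using Zc_le[OF F(1,2)] by (metis lebdE)
  have le: "Nc L r \<le> Zc F r + Nc F r" if "r \<ge> 1" for r
  proof -
    have "Nc L r \<le> Nr (\<lambda>z. max 0 (omega z F) + max 0 (- omega z F)) r"
      unfolding Nc_def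
    proof (rule Nr_mono[OF _ _ _ that])
      fix z
      show "max 0 (- omega z L) \<le> max 0 (omega z F) + max 0 (- omega z F)"
        using omega_deriv(2)[OF F(1,2), of z] omega_deriv_ge0[OF F, of z] omega_log_deriv[OF F, of z]
        by (cases "omega z F = 0") (auto simp: L_def)
    qed (use F L in auto)
    also have "\<dots> = Zc F r + Nc F r" unfolding Zc_def Nc_def using F by (intro Nr_add) auto
    finally show ?thesis .
  qed
  show ?thesis
  proof (rule lebdI)
    fix r :: real assume r: "r \<ge> 1"
    have "ln (nrm r L) = ln (nrm r (fls_deriv F)) - ln (nrm r F)"
      using F r nrm_pos[of r F] nrm_pos[of r "fls_deriv F"] by (simp add: L_def nrm_divide ln_div)
    also have "\<dots> \<le> - ln r" using nrm_log_deriv[OF F, of r] r by simp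
    finally show "Zc (fls_deriv F / F) r \<le> 2 * Tc F r - ln r + (D - C)"
      using C[of r] D[OF r] le[OF r] Nc_le_Tc[OF F(1,2), of r] r unfolding L_def[symmetric] by simp
  qed
qed

lemma exists_value:
  assumes F: "mero F" "ordge z 0 F" and nc: "\<And>c. F \<noteq> fls_const c"
  obtains c where "omega z (F - fls_const c) > 0"
proof -
  obtain p q where p: "entire p" "entire q" "entire_eval q z \<noteq> 0" "F = fps_to_fls p / fps_to_fls q"
    using F(2) unfolding ordge_iff[OF F(1)] by auto
  note q0 = entire_eval_nz[OF p(3)]
  define c where "c = entire_eval p z / entire_eval q z"
  define w where "w = p - fps_const c * q"
  have w: "entire w" "entire_eval w z = 0"
    using p by (auto simp: w_def entire_diff entire_mult entire_eval_diff entire_eval_cmult c_def)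
  have eq: "F - fls_const c = fps_to_fls w / fps_to_fls q"
    using q0 by (simp add: p(4) w_def fls_times_fps_to_fls field_simps)
  have "w \<noteq> 0" using eq nc[of c] by auto
  hence "omega z (fps_to_fls w) > 0" using omega_entire[OF w(1)] w by blast
  moreover have "omega z (fps_to_fls q) = 0"
    using omega_entire[OF p(2), of z] q0 p(3) by linarith
  ultimately have "omega z (F - fls_const c) > 0"
    unfolding eq using w p q0 \<open>w \<noteq> 0\<close> by (simp add: omega_divide)
  thus ?thesis using that by blast
qed

lemma Nr_unbounded:
  assumes "locfin d" "\<And>z. d z \<ge> 0" "d z0 \<ge> 1" "r \<ge> 1" "r \<ge> absval z0"
  shows "ln r - ln (absval z0) \<le> Nr d r"
proof -
  have l: "locfin (\<lambda>z. if z = z0 then 1 else 0 :: int)"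
    unfolding locfin_def by (auto intro: finite_subset[of _ "{z0}"])
  have "Nr (\<lambda>z. if z = z0 then 1 else 0) r \<le> Nr d r"
    using assms(2,3) by (intro Nr_mono l assms) auto
  thus ?thesis using assms by (simp add: Nr_single)
qed

text \<open>The origin is either a pole or a zero of F - c for some c, and this one point already
  contributes ln r to a counting function below T(F).\<close>

lemma Tc_unbounded:
  assumes F: "mero F" and nc: "\<And>c. F \<noteq> fls_const c"
  shows "filterlim (Tc F) at_top at_top"
proof -
  have F0: "F \<noteq> 0" using nc[of 0] by simp
  have "\<exists>z0 C. \<forall>r\<ge>max 1 (absval (z0::'a)). ln r + C \<le> Tc F r"
  proof (cases "omega (0::'a) F < 0")
    case True
    have "ln r - ln (absval (0::'a)) \<le> Nc F r" if "r \<ge> max 1 (absval (0::'a))" for r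
      unfolding Nc_def using F F0 True that by (intro Nr_unbounded) auto
    hence "ln r + - ln (absval (0::'a)) \<le> Tc F r" if "r \<ge> max 1 (absval (0::'a))" for r
      using Nc_le_Tc[OF F F0, of r] that by fastforce
    thus ?thesis by blast
  next
    case False
    hence "ordge (0::'a) 0 F" by (simp add: ordge_def)
    then obtain c where c: "omega 0 (F - fls_const c) > 0" using exists_value F nc by metis
    have G: "mero (F - fls_const c)" "F - fls_const c \<noteq> 0" using F nc by auto
    obtain D where D: "\<And>r. r \<ge> 1 \<Longrightarrow> Zc (F - fls_const c) r \<le> Tc F r + D"
      using Zc_diff_const_le[OF F F0 nc] by (metis lebdE)
    have "ln r - ln (absval (0::'a)) \<le> Zc (F - fls_const c) r" if "r \<ge> max 1 (absval (0::'a))" for r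
      unfolding Zc_def using G c that by (intro Nr_unbounded) auto
    hence "ln r + - D \<le> Tc F r" if "r \<ge> max 1 (absval (0::'a))" for r
      using D[of r] that by force
    thus ?thesis by blast
  qed
  then obtain z0 :: 'a and C where C: "\<And>r. r \<ge> max 1 (absval z0) \<Longrightarrow> ln r + C \<le> Tc F r" by blast
  show ?thesis
  proof (rule filterlim_at_top_mono)
    show "LIM r at_top. C + ln r :> at_top"
      by (intro filterlim_tendsto_add_at_top[OF tendsto_const] ln_at_top)
    show "\<forall>\<^sub>F r in at_top. C + ln r \<le> Tc F r"
      using eventually_ge_at_top[of "max 1 (absval z0)"] by eventually_elim (use C in \<open>simp add: add.commute\<close>)
  qed
qed

subsection \<open>Small functions\<close>

text \<open>Translates are related by their values only, so orders have to be recovered from values.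
  At x = z + v with v nonzero, cancelling v^k leaves a positive power of v on the right. Letting v
  run through the powers of w gives the claim; this is where a nontrivial absolute value is
  used.\<close>

lemma translate_order_aux:
  fixes s t :: "'a :: {ultrametric_field, complete_space} fps"
  assumes s: "entire s" and t: "entire t"
    and eq: "\<And>x. (x - z) ^ k * entire_eval s (x + c) = (x - z) ^ m * entire_eval t x"
    and km: "k < m" and w: "0 < absval (w::'a)" "absval w < 1"
  shows "entire_eval s (z + c) = 0"
proof -
  define r where "r = 1 + absval z + absval c"
  have r: "r > 0" using absval_nonneg[of z] absval_nonneg[of c] by (simp add: r_def)
  define M where "M = max (gauss r t) (gauss r s / r)"
  have le: "absval (entire_eval s (z + c)) \<le> absval v * M" if v: "v \<noteq> 0" "absval v \<le> 1" for v :: 'a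
  proof -
    have b: "absval (z + v) \<le> r" "absval (z + v + c) \<le> r" "absval (z + c) \<le> r"
      using absval_add[of z v] absval_add[of "z + v" c] absval_add[of z c]
        absval_nonneg[of z] absval_nonneg[of c] v by (auto simp: r_def)
    have "v ^ k * entire_eval s (z + v + c) = v ^ k * (v ^ (m - k) * entire_eval t (z + v))"
      using eq[of "z + v"] km by (simp add: mult.assoc flip: power_add)
    hence "entire_eval s (z + v + c) = v ^ (m - k) * entire_eval t (z + v)" using v by simp
    hence "absval (entire_eval s (z + v + c)) = absval v ^ (m - k) * absval (entire_eval t (z + v))"
      by (simp add: absval_mult absval_power)
    also have "\<dots> \<le> absval v ^ 1 * M"
    proof (rule mult_mono)
      show "absval v ^ (m - k) \<le> absval v ^ 1" using km v by (intro power_decreasing) (auto simp: absval_nonneg)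
      show "absval (entire_eval t (z + v)) \<le> M" using entire_eval_bound[OF t r b(1)] by (simp add: M_def)
    qed (auto simp: absval_nonneg)
    finally have 1: "absval (entire_eval s (z + v + c)) \<le> absval v * M" by simp
    have "absval (entire_eval s (z + v + c) - entire_eval s (z + c)) \<le> absval (z + v + c - (z + c)) * (gauss r s / r)"
      by (rule entire_eval_lipschitz[OF s r b(2,3)])
    also have "\<dots> \<le> absval v * M" by (simp add: M_def mult_left_mono absval_nonneg del: times_divide_eq_right)
    finally have 2: "absval (entire_eval s (z + v + c) - entire_eval s (z + c)) \<le> absval v * M" .
    show ?thesis
      using absval_diff[of "entire_eval s (z + v + c)" "entire_eval s (z + v + c) - entire_eval s (z + c)"] 1 2
      by simp
  qed
  have "(\<lambda>j. absval w ^ j * M) \<longlonglongrightarrow> 0 * M"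
    using w by (intro tendsto_intros LIMSEQ_power_zero) (auto simp: abs_of_nonneg[OF absval_nonneg])
  hence "absval (entire_eval s (z + c)) \<le> 0 * M"
  proof (rule LIMSEQ_le_const)
    show "\<exists>N. \<forall>j\<ge>N. absval (entire_eval s (z + c)) \<le> absval w ^ j * M"
    proof (intro exI[of _ 0] allI impI)
      fix j :: nat
      have "w ^ j \<noteq> 0" "absval (w ^ j) \<le> 1" using w by (auto simp: absval_power absval_nonneg power_le_one)
      from le[OF this] show "absval (entire_eval s (z + c)) \<le> absval w ^ j * M" by (simp add: absval_power)
    qed
  qed
  thus ?thesis using absval_nonneg[of "entire_eval s (z + c)"] by simp
qed

lemma translate_order_entire:
  fixes p p' :: "'a :: {ultrametric_field, complete_space} fps"
  assumes p: "entire p" "p \<noteq> 0" "entire p'" "p' \<noteq> 0"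
    and eq: "\<And>x. entire_eval p' x = entire_eval p (x + c)" and w: "0 < absval (w::'a)" "absval w < 1"
  shows "omega z (fps_to_fls p') = omega (z + c) (fps_to_fls p)"
proof -
  have lin_eval: "entire_eval ((fps_X - fps_const d) ^ k * s) x = (x - d) ^ k * entire_eval s x"
    if "entire s" for d k s and x :: 'a
    using that by (induction k) (auto simp: entire_eval_linear_mult mult.assoc entire_mult)
  have om: "omega d (fps_to_fls ((fps_X - fps_const d) ^ k * s)) = int k"
    if "entire s" "entire_eval s d \<noteq> 0" for d k and s :: "'a fps"
  proof (rule omega_eq)
    have "fps_to_fls ((fps_X - fps_const d) ^ k * s) = lin d powi int k * (fps_to_fls s / fps_to_fls 1)"
      by (simp add: fls_times_fps_to_fls fps_to_fls_power)
    thus "has_order_at (fps_to_fls ((fps_X - fps_const d) ^ k * s)) d (int k)"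
      unfolding has_order_at_def using that by (metis entire_1 entire_eval_1 zero_neq_one)
  qed
  obtain k s where s: "entire s" "p = (fps_X - fps_const (z + c)) ^ k * s" "entire_eval s (z + c) \<noteq> 0"
    using entire_order_exists p by metis
  obtain m t where t: "entire t" "p' = (fps_X - fps_const z) ^ m * t" "entire_eval t z \<noteq> 0"
    using entire_order_exists p by metis
  have e: "(x - z) ^ k * entire_eval s (x + c) = (x - z) ^ m * entire_eval t x" for x
    using eq[of x] s t by (simp add: lin_eval)
  have e': "(x - (z + c)) ^ m * entire_eval t (x + - c) = (x - (z + c)) ^ k * entire_eval s x" for x
    using e[of "x - c"] by (simp add: algebra_simps)
  have "\<not> k < m" using translate_order_aux[OF s(1) t(1) e _ w] s by blast
  moreover have "\<not> m < k" using translate_order_aux[OF t(1) s(1) e' _ w] t by auto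
  ultimately have "k = m" by simp
  thus ?thesis using s t om by metis
qed

lemma is_translate_omega:
  fixes F G :: "'a :: {ultrametric_field, complete_space} fls"
  assumes "is_translate c F G" "F \<noteq> 0" "G \<noteq> 0" and w: "0 < absval (w::'a)" "absval w < 1"
  shows "omega z G = omega (z + c) F" and "mero G"
proof -
  obtain p q p' q' where *: "entire p" "entire q" "entire p'" "entire q'" "q \<noteq> 0" "q' \<noteq> 0"
    "F = fps_to_fls p / fps_to_fls q" "G = fps_to_fls p' / fps_to_fls q'"
    "\<And>x. entire_eval p' x = entire_eval p (x + c)" "\<And>x. entire_eval q' x = entire_eval q (x + c)"
    using assms(1) unfolding is_translate_def by blast
  have nz: "p \<noteq> 0" "p' \<noteq> 0" using assms * by auto
  show "omega z G = omega (z + c) F"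
    using translate_order_entire[OF *(1) nz(1) *(3) nz(2) *(9) w, of z]
      translate_order_entire[OF *(2,5,4,6) *(10) w, of z] * nz by (simp add: omega_divide)
  show "mero G" using * by (auto simp: mero_intro)
qed

text \<open>For |z| > |c| the weights agree because |z - c| = |z|. Only the finitely many points
  with |z| \<le> |c| differ, and their contribution does not depend on r.\<close>

lemma Nr_translate:
  assumes d: "locfin d"
  shows "\<exists>C. \<forall>r\<ge>max 1 (absval c). Nr (\<lambda>z. d (z + c)) r = Nr d r + C"
proof -
  define S where "S = {z. absval z \<le> absval c \<and> d z \<noteq> 0}"
  define C where "C = (\<Sum>z\<in>S. of_int (d z) * (ln (absval z) - ln (absval (z - c))))"
  have "Nr (\<lambda>z. d (z + c)) r = Nr d r + C" if r: "r \<ge> max 1 (absval c)" for r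
  proof -
    have le: "absval (z + c) \<le> r" "absval (z - c) \<le> r" if "absval z \<le> r" for z
      using absval_add[of z c] absval_diff[of z c] that r by auto
    have bij: "bij_betw (\<lambda>z. z + c) {z. absval z \<le> r \<and> d (z + c) \<noteq> 0} {z. absval z \<le> r \<and> d z \<noteq> 0}"
      by (rule bij_betw_byWitness[of _ "\<lambda>z. z - c"]) (use le in auto)
    have "Nr (\<lambda>z. d (z + c)) r = (\<Sum>z | absval z \<le> r \<and> d (z + c) \<noteq> 0.
        of_int (d (z + c)) * (ln r - ln (absval (z + c - c))))" by (simp add: Nr_def)
    also have "\<dots> = (\<Sum>z | absval z \<le> r \<and> d z \<noteq> 0. of_int (d z) * (ln r - ln (absval (z - c))))"
      using sum.reindex_bij_betw[OF bij, of "\<lambda>z. of_int (d z) * (ln r - ln (absval (z - c)))"] by simp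
    also have "\<dots> = Nr d r + (\<Sum>z | absval z \<le> r \<and> d z \<noteq> 0. of_int (d z) * (ln (absval z) - ln (absval (z - c))))"
      unfolding Nr_def sum.distrib[symmetric] by (intro sum.cong) (auto simp: algebra_simps)
    also have "(\<Sum>z | absval z \<le> r \<and> d z \<noteq> 0. of_int (d z) * (ln (absval z) - ln (absval (z - c)))) = C"
      unfolding C_def
    proof (rule sum.mono_neutral_right)
      show "finite {z. absval z \<le> r \<and> d z \<noteq> 0}" using d by (simp add: locfin_def)
      show "S \<subseteq> {z. absval z \<le> r \<and> d z \<noteq> 0}" using r by (auto simp: S_def)
      show "\<forall>z\<in>{z. absval z \<le> r \<and> d z \<noteq> 0} - S. of_int (d z) * (ln (absval z) - ln (absval (z - c))) = 0"
      proof
        fix z assume "z \<in> {z. absval z \<le> r \<and> d z \<noteq> 0} - S"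
        hence "absval c < absval z" by (auto simp: S_def)
        thus "of_int (d z) * (ln (absval z) - ln (absval (z - c))) = 0" by (simp add: absval_diff_eq)
      qed
    qed
    finally show ?thesis .
  qed
  thus ?thesis by blast
qed

text \<open>Under the trivial absolute value every entire function is a polynomial, so every
  meromorphic function would be rational.\<close>

lemma transcendental_imp_nontrivial_absval:
  fixes f :: "'a :: {ultrametric_field, complete_space} fls"
  assumes "transcendental_fun f"
  obtains w :: 'a where "0 < absval w" "absval w < 1"
proof (rule ccontr)
  assume no: "\<not> thesis"
  note result = that
  have triv: "x = 0" if x: "absval x < 1" for x :: 'a
    by (rule ccontr) (use no result[OF _ x] in auto)
  have poly: "\<exists>P. p = fps_of_poly P" if "entire p" for p :: "'a fps"
  proof -
    have "gterm 1 p \<longlonglongrightarrow> 0" using that by (simp add: entire_iff)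
    hence "\<forall>\<^sub>F n in sequentially. gterm 1 p n < 1" by (rule order_tendstoD) simp
    then obtain N where N: "\<And>n. n \<ge> N \<Longrightarrow> gterm 1 p n < 1" by (auto simp: eventually_sequentially)
    hence z: "fps_nth p n = 0" if "n \<ge> N" for n using triv[of "fps_nth p n"] that by (auto simp: gterm_def)
    have "p = fps_of_poly (\<Sum>i<N. monom (fps_nth p i) i)"
      by (rule fps_ext) (use z in \<open>auto simp: coeff_sum if_distrib cong: if_cong\<close>)
    thus ?thesis by blast
  qed
  obtain p q where p: "entire p" "entire q" "q \<noteq> 0" "f = fps_to_fls p / fps_to_fls q"
    using assms unfolding transcendental_fun_def meromorphic_fun_def by blast
  obtain P Q where "p = fps_of_poly P" "q = fps_of_poly Q" using poly p by metis
  hence "rational_fun f" unfolding rational_fun_def using p by (intro exI[of _ P] exI[of _ Q]) auto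
  thus False using assms by (simp add: transcendental_fun_def)
qed

lemma transcendental_nonconst: "transcendental_fun f \<Longrightarrow> f \<noteq> fls_const c"
proof
  assume "transcendental_fun f" "f = fls_const c"
  moreover have "rational_fun (fls_const c)"
    unfolding rational_fun_def by (intro exI[of _ "[:c:]"] exI[of _ 1]) (auto simp: fps_of_poly_const)
  ultimately show False by (simp add: transcendental_fun_def)
qed

lemma N_count_eq:
  assumes "mero F"
  shows "N_count r F = Nc F r"
  using omega_inverse[OF assms] by (simp add: N_count_def Z_count_eq Nc_def flip: inverse_eq_divide)

text \<open>Translation and the passage from \<open>T_char\<close> to \<open>Tc\<close> change
  everything by bounded terms only. As T(f) is unbounded, these are absorbed by part of
  \<epsilon>.\<close>

lemma small_wrt_bound:
  fixes f \<alpha> :: "'a :: {ultrametric_field, complete_space, alg_closed_field} fls"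
  assumes "small_wrt \<alpha> f" and f: "transcendental_fun f" and \<alpha>: "mero \<alpha>" "\<alpha> \<noteq> 0"
    and \<epsilon>: "\<epsilon> > 0"
  shows "\<forall>\<^sub>F r in at_top. Zc \<alpha> r + Nc \<alpha> r \<le> \<epsilon> * Tc f r"
proof -
  have fm: "mero f" using f by (simp add: transcendental_fun_def)
  have f0: "f \<noteq> 0" using transcendental_nonconst[OF f, of 0] by simp
  obtain w :: 'a where w: "0 < absval w" "absval w < 1" using transcendental_imp_nontrivial_absval[OF f] by metis
  obtain c A F where tr: "is_translate c \<alpha> A" "is_translate c f F" "A \<noteq> 0" "F \<noteq> 0"
    "((\<lambda>r. T_char r A / T_char r F) \<longlongrightarrow> 0) at_top"
    using assms(1) unfolding small_wrt_def by blast
  note A = is_translate_omega[OF tr(1) \<alpha>(2) tr(3) w] and F = is_translate_omega[OF tr(2) f0 tr(4) w]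
  define R0 where "R0 = max 1 (absval c)"
  have tr_Nr: "\<exists>C. \<forall>r\<ge>R0. Zc G' r = Zc G r + C" "\<exists>C. \<forall>r\<ge>R0. Nc G' r = Nc G r + C"
    if "mero G" "G \<noteq> 0" "\<And>z. omega z G' = omega (z + c) G" for G G' :: "'a fls"
    unfolding Zc_def Nc_def that(3) R0_def
    using Nr_translate[OF locfin_zeros[OF that(1,2)], of c] Nr_translate[OF locfin_poles[OF that(1,2)], of c]
    by auto
  obtain C1 C2 where C12: "\<And>r. r \<ge> R0 \<Longrightarrow> Zc A r = Zc \<alpha> r + C1" "\<And>r. r \<ge> R0 \<Longrightarrow> Nc A r = Nc \<alpha> r + C2"
    using tr_Nr[OF \<alpha> A(1)] by metis
  obtain C3 C4 where C34: "\<And>r. r \<ge> R0 \<Longrightarrow> Zc F r = Zc f r + C3" "\<And>r. r \<ge> R0 \<Longrightarrow> Nc F r = Nc f r + C4"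
    using tr_Nr[OF fm f0 F(1)] by metis
  define cA where "cA = ln (absval (fls_nth A 0))"
  define cF where "cF = ln (absval (fls_nth F 0))"
  have TA: "T_char r A = max (Zc A r + cA) (Nc A r)" for r
    by (simp add: T_char_def Z_count_eq N_count_eq[OF A(2)] cA_def Zc_def)
  have TF: "T_char r F = max (Zc F r + cF) (Nc F r)" for r
    by (simp add: T_char_def Z_count_eq N_count_eq[OF F(2)] cF_def Zc_def)
  obtain C5 where C5: "\<And>r. r > 0 \<Longrightarrow> ln (nrm r f) = Zc f r - Nc f r + C5" using jensen_Zc_Nc[OF fm f0] by metis
  have T: "Tc f r = max (Zc f r + C5) (Nc f r)" if "r > 0" for r
    using C5[OF that] by (simp add: Tc_def max_def)
  define D where "D = \<bar>C3\<bar> + \<bar>C4\<bar> + \<bar>C5\<bar> + \<bar>cF\<bar>"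
  have R0: "R0 \<ge> 1" by (simp add: R0_def)
  have TF1: "T_char r F \<le> Tc f r + D" and TF2: "Tc f r \<le> T_char r F + D" if "r \<ge> R0" for r
    using C34[OF that] R0 that unfolding TF T[OF less_le_trans[OF zero_less_one order_trans[OF R0 that]]] D_def
    by (auto simp: max_def)
  define E where "E = \<bar>C1\<bar> + \<bar>C2\<bar> + \<bar>cA\<bar>"
  have TA1: "Zc \<alpha> r + Nc \<alpha> r \<le> 2 * T_char r A + E" if "r \<ge> R0" for r
    using C12[OF that] unfolding TA E_def by (auto simp: max_def)
  have lim: "filterlim (Tc f) at_top at_top" using fm transcendental_nonconst[OF f] by (rule Tc_unbounded)
  \<comment> \<open>The first entry makes \<open>T_char r F\<close> positive, the second absorbs the
    constants into half of \<epsilon>. The ratio is taken below \<epsilon> / 4 because the zeros and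
    poles of \<alpha> together cost twice \<open>T_char r A\<close>.\<close>
  define B where "B = max (D + 1) ((\<epsilon> * D / 2 + E) / (\<epsilon> / 2))"
  have "\<forall>\<^sub>F r in at_top. Tc f r \<ge> B" using lim by (simp add: filterlim_at_top)
  moreover have "\<forall>\<^sub>F r in at_top. \<bar>T_char r A / T_char r F\<bar> < \<epsilon> / 4"
    using tendstoD[OF tr(5), of "\<epsilon> / 4"] \<epsilon> by (simp add: dist_real_def)
  ultimately show ?thesis using eventually_ge_at_top[of R0]
  proof eventually_elim
    case (elim r)
    have "Tc f r \<ge> D + 1" using elim by (simp add: B_def)
    hence pos: "T_char r F > 0" using TF2[OF elim(3)] by simp
    have "T_char r A / T_char r F < \<epsilon> / 4" using elim(2) by (rule order_le_less_trans[OF abs_ge_self])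
    hence "T_char r A < \<epsilon> / 4 * T_char r F" using pos by (simp add: field_simps)
    also have "\<dots> \<le> \<epsilon> / 4 * (Tc f r + D)" using TF1[OF elim(3)] \<epsilon> by (intro mult_left_mono) auto
    finally have 1: "T_char r A < \<epsilon> / 4 * (Tc f r + D)" .
    have "Zc \<alpha> r + Nc \<alpha> r \<le> \<epsilon> / 2 * Tc f r + (\<epsilon> * D / 2 + E)"
      using TA1[OF elim(3)] 1 by (simp add: field_simps)
    also have "\<epsilon> * D / 2 + E \<le> \<epsilon> / 2 * Tc f r"
    proof -
      have "(\<epsilon> * D / 2 + E) / (\<epsilon> / 2) \<le> Tc f r" using elim(1) by (simp add: B_def)
      thus ?thesis using \<epsilon> by (simp add: field_simps)
    qed
    finally show "Zc \<alpha> r + Nc \<alpha> r \<le> \<epsilon> * Tc f r" by simp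
  qed
qed

subsection \<open>The polynomial P and the differential monomial\<close>

definition Fop :: "nat \<Rightarrow> 'a::field_char_0 \<Rightarrow> 'a fls \<Rightarrow> 'a fls" where
  "Fop n a f = fls_deriv f * f ^ n * (f - fls_const a)"

definition bval :: "nat \<Rightarrow> 'a::field_char_0 \<Rightarrow> 'a" where
  "bval n a = a * of_nat (n + 2) / of_nat (n + 1)"

definition Pop :: "nat \<Rightarrow> 'a::field_char_0 \<Rightarrow> 'a fls \<Rightarrow> 'a fls" where
  "Pop n a f = fls_const (1 / of_nat (n + 2)) * f ^ (n + 1) * (f - fls_const (bval n a))"

lemma of_nat_conv_fls_const: "(of_nat n :: 'a :: field_char_0 fls) = fls_const (of_nat n)"
  by (simp add: fls_of_nat)

lemma deriv_Pop: "fls_deriv (Pop n a f) = Fop n a f"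
proof -
  define k where "k = (fls_const (1 / of_nat (n + 2)) :: 'a fls)"
  have k2: "k * of_nat (n + 2) = 1"
    by (simp add: k_def of_nat_conv_fls_const del: of_nat_add of_nat_Suc)
  have b: "of_nat (n + 1) * fls_const (bval n a) = of_nat (n + 2) * fls_const a"
    by (simp add: bval_def of_nat_conv_fls_const mult.commute del: of_nat_add of_nat_Suc)
  have dk: "fls_deriv k = 0" by (simp add: k_def)
  have dp: "fls_deriv (f ^ (n + 1)) = of_nat (n + 1) * f ^ n * fls_deriv f"
    using fls_deriv_power[of f "n + 1"] by simp
  have "fls_deriv (Pop n a f) = k * (of_nat (n + 1) * f ^ n * fls_deriv f) * (f - fls_const (bval n a)) + k * f ^ (n + 1) * fls_deriv f"
    unfolding Pop_def k_def[symmetric] fls_deriv_mult dk dp by simp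
  also have "\<dots> = k * fls_deriv f * f ^ n * (of_nat (n + 1) * f - of_nat (n + 1) * fls_const (bval n a) + f)"
    by (simp add: algebra_simps)
  also have "\<dots> = k * fls_deriv f * f ^ n * (of_nat (n + 2) * (f - fls_const a))"
    unfolding b by (simp add: algebra_simps)
  also have "\<dots> = (k * of_nat (n + 2)) * (fls_deriv f * f ^ n * (f - fls_const a))"
    by (simp only: mult_ac)
  finally show ?thesis by (simp only: k2 Fop_def mult_1)
qed

lemma bval_nz: "a \<noteq> 0 \<Longrightarrow> bval n a \<noteq> 0"
  unfolding bval_def by (simp del: of_nat_Suc of_nat_add)

lemma bval_neq: "a \<noteq> 0 \<Longrightarrow> bval n a \<noteq> (a :: 'a :: field_char_0)"
proof
  assume "a \<noteq> 0" "bval n a = a"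
  hence "(of_nat (n + 2) :: 'a) = of_nat (n + 1)" by (simp add: bval_def divide_simps del: of_nat_Suc of_nat_add)
  thus False by (simp only: of_nat_eq_iff)
qed

definition nonconst :: "'a::{ultrametric_field, complete_space, alg_closed_field, field_char_0} fls \<Rightarrow> bool" where
  "nonconst f \<longleftrightarrow> meromorphic_fun f \<and> (\<forall>c. f \<noteq> fls_const c)"

context
  fixes f :: "'a :: {ultrametric_field, complete_space, alg_closed_field, field_char_0} fls"
  assumes f: "nonconst f"
begin

lemma nonconst_mero [simp]: "mero f" and nonconst_neq: "f \<noteq> fls_const c"
  using f by (auto simp: nonconst_def)

lemma nonconst_nz: "f \<noteq> 0"
  using nonconst_neq[of 0] by simp

lemma nonconst_deriv: "fls_deriv f \<noteq> 0"
  using nonconst_neq by (auto simp: fls_deriv_eq_0_iff)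

lemma Fop_mero: "mero (Fop n a f)"
  by (simp add: Fop_def)

lemma Pop_mero: "mero (Pop n a f)"
  by (simp add: Pop_def)

lemma Fop_nz: "Fop n a f \<noteq> 0"
  using nonconst_nz nonconst_deriv nonconst_neq by (simp add: Fop_def)

lemma Pop_nz: "Pop n a f \<noteq> 0"
proof -
  have "(of_nat (n + 2) :: 'a) \<noteq> 0" by (simp only: of_nat_eq_0_iff)
  thus ?thesis using nonconst_nz nonconst_neq by (simp add: Pop_def del: of_nat_add)
qed

lemma omega_Fop: "omega z (Fop n a f) = omega z (fls_deriv f) + int n * omega z f + omega z (f - fls_const a)"
  using nonconst_nz nonconst_deriv nonconst_neq by (simp add: Fop_def omega_mult omega_power)

lemma omega_Pop: "omega z (Pop n a f) = int (n + 1) * omega z f + omega z (f - fls_const (bval n a))"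
proof -
  have "(of_nat (n + 2) :: 'a) \<noteq> 0" by (simp only: of_nat_eq_0_iff)
  thus ?thesis using nonconst_nz nonconst_neq
    by (simp add: Pop_def omega_mult omega_power del: of_nat_add power_Suc of_nat_Suc power_add)
qed

lemma omega_diff_const_pos:
  assumes "omega z (f - fls_const c) > 0" "d \<noteq> c"
  shows "omega z (f - fls_const d) = 0"
proof -
  have "omega z ((f - fls_const c) - fls_const (d - c)) = 0"
    using assms nonconst_neq by (intro omega_diff_const(2)) auto
  thus ?thesis by (simp flip: fls_plus_const fls_minus_const)
qed

lemma omega_deriv_diff_const:
  assumes "omega z (f - fls_const c) \<noteq> 0"
  shows "omega z (fls_deriv f) = omega z (f - fls_const c) - 1"
  using omega_deriv(2)[of "f - fls_const c" z] assms nonconst_neq by simp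

lemma omega_cases:
  assumes a: "a \<noteq> 0" and b: "b \<noteq> 0" "b \<noteq> a"
  shows "omega z f > 0 \<and> omega z (f - fls_const a) = 0 \<and> omega z (f - fls_const b) = 0 \<and>
      omega z (fls_deriv f) = omega z f - 1
    \<or> omega z f < 0 \<and> omega z (f - fls_const a) = omega z f \<and> omega z (f - fls_const b) = omega z f \<and>
      omega z (fls_deriv f) = omega z f - 1
    \<or> omega z f = 0 \<and> omega z (f - fls_const a) > 0 \<and> omega z (f - fls_const b) = 0 \<and>
      omega z (fls_deriv f) = omega z (f - fls_const a) - 1
    \<or> omega z f = 0 \<and> omega z (f - fls_const a) = 0 \<and> omega z (f - fls_const b) > 0 \<and>
      omega z (fls_deriv f) = omega z (f - fls_const b) - 1
    \<or> omega z f = 0 \<and> omega z (f - fls_const a) = 0 \<and> omega z (f - fls_const b) = 0 \<and>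
      omega z (fls_deriv f) \<ge> 0"
proof -
  note A = omega_diff_const[OF nonconst_mero nonconst_nz, of z a]
  note B = omega_diff_const[OF nonconst_mero nonconst_nz, of z b]
  note D = omega_deriv_diff_const[of z 0] omega_deriv_diff_const[of z a] omega_deriv_diff_const[of z b]
    omega_deriv_ge0[OF nonconst_mero nonconst_nz nonconst_deriv, of z]
  have ab: "omega z (f - fls_const a) > 0 \<Longrightarrow> omega z (f - fls_const b) = 0"
    "omega z (f - fls_const b) > 0 \<Longrightarrow> omega z (f - fls_const a) = 0"
    using omega_diff_const_pos[of z a b] omega_diff_const_pos[of z b a] b by auto
  consider "omega z f > 0" | "omega z f < 0" | "omega z f = 0" "omega z (f - fls_const a) > 0"
    | "omega z f = 0" "omega z (f - fls_const a) = 0" "omega z (f - fls_const b) > 0"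
    | "omega z f = 0" "omega z (f - fls_const a) = 0" "omega z (f - fls_const b) = 0"
    using A(3) B(3) by linarith
  thus ?thesis
  proof cases
    case 1 thus ?thesis using A B D a b by simp
  next
    case 2 thus ?thesis using A B D a b by simp
  next
    case 3 thus ?thesis using A B D a b ab by simp
  next
    case 4 thus ?thesis using A B D a b ab by simp
  next
    case 5 thus ?thesis using A B D a b ab by simp
  qed
qed

text \<open>The five cases are f = 0, \<infinity>, a, b or none of these at z. Every later pointwise
  estimate is linear arithmetic on this table.\<close>

lemma omega_Fop_Pop_cases:
  fixes z a :: 'a and n :: nat
  assumes a: "a \<noteq> 0"
  defines "m \<equiv> omega z f" and "y \<equiv> omega z (Fop n a f)" and "p \<equiv> omega z (Pop n a f)"
    and "ma \<equiv> omega z (f - fls_const a)" and "mb \<equiv> omega z (f - fls_const (bval n a))"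
    and "l \<equiv> omega z (fls_deriv f / f)"
  shows "m > 0 \<and> ma = 0 \<and> mb = 0 \<and> l = - 1 \<and> y = int (n + 1) * m - 1 \<and> p = int (n + 1) * m
    \<or> m < 0 \<and> ma = m \<and> mb = m \<and> l = - 1 \<and> y = int (n + 2) * m - 1 \<and> p = int (n + 2) * m
    \<or> m = 0 \<and> ma > 0 \<and> mb = 0 \<and> l = ma - 1 \<and> y = 2 * ma - 1 \<and> p = 0
    \<or> m = 0 \<and> ma = 0 \<and> mb > 0 \<and> l = mb - 1 \<and> y = mb - 1 \<and> p = mb
    \<or> m = 0 \<and> ma = 0 \<and> mb = 0 \<and> l \<ge> 0 \<and> y = l \<and> p = 0"
proof -
  have l: "l = omega z (fls_deriv f) - m" unfolding l_def m_def
    by (rule omega_log_deriv[OF nonconst_mero nonconst_nz nonconst_deriv])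
  show ?thesis
    using omega_cases[OF a bval_nz[OF a, of n] bval_neq[OF a, of n], of z] l
    unfolding y_def p_def omega_Fop omega_Pop ma_def[symmetric] mb_def[symmetric] m_def[symmetric]
    by (elim disjE conjE) (auto simp: algebra_simps)
qed

text \<open>The first two bounds serve f in the Wronskian case and in the dependent case, where
  orders are truncated at 2 and at 1. The fourth serves g, the last the case F = c \<alpha>. The
  bound n \<ge> 11 enters through the multiplicities n + 1 \<ge> 12 and n + 2 \<ge> 13.\<close>

lemma Fop_local:
  fixes z a :: 'a and n :: nat
  assumes a: "a \<noteq> 0" and n: "n \<ge> 11"
  defines "m \<equiv> omega z f" and "y \<equiv> omega z (Fop n a f)" and "p \<equiv> max 0 (omega z (Pop n a f))"
    and "ma \<equiv> max 0 (omega z (f - fls_const a))" and "mb \<equiv> max 0 (omega z (f - fls_const (bval n a)))"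
    and "l \<equiv> max 0 (omega z (fls_deriv f / f))"
  shows "y \<ge> 0 \<Longrightarrow> p - y + min 2 y \<le> 3 * max 0 m + mb"
    and "y \<ge> 0 \<Longrightarrow> p - y + min 1 y \<le> 2 * max 0 m + mb"
    and "y < 0 \<Longrightarrow> y \<le> - 13 \<and> p = 0 \<and> m < 0"
    and "y \<ge> 0 \<Longrightarrow> min 2 y \<le> 2 * max 0 m + ma + l"
    and "p \<le> mb + 2 * max 0 y"
proof -
  have 1: "int (n + 1) * m \<ge> 12 * m" if "m > 0" using that n by (intro mult_right_mono) auto
  have 2: "int (n + 2) * m \<le> 13 * m" if "m < 0" using that n by (intro mult_right_mono_neg) auto
  note c = omega_Fop_Pop_cases[OF a, of z n]
  show "y \<ge> 0 \<Longrightarrow> p - y + min 2 y \<le> 3 * max 0 m + mb"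
    using c 1 2 unfolding m_def y_def p_def ma_def mb_def l_def by linarith
  show "y \<ge> 0 \<Longrightarrow> p - y + min 1 y \<le> 2 * max 0 m + mb"
    using c 1 2 unfolding m_def y_def p_def ma_def mb_def l_def by linarith
  show "y < 0 \<Longrightarrow> y \<le> - 13 \<and> p = 0 \<and> m < 0"
    using c 1 2 unfolding m_def y_def p_def ma_def mb_def l_def by linarith
  show "y \<ge> 0 \<Longrightarrow> min 2 y \<le> 2 * max 0 m + ma + l"
    using c 1 2 unfolding m_def y_def p_def ma_def mb_def l_def by linarith
  show "p \<le> mb + 2 * max 0 y"
    using c 1 2 unfolding m_def y_def p_def ma_def mb_def l_def by linarith
qed

text \<open>If |f|_r > |b|, then |f - b|_r = |f|_r and ln |P(f)|_r is (n + 2) ln |f|_r up to a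
  constant; otherwise the positive part of ln |f|_r is bounded.\<close>

lemma Tc_Pop:
  assumes a: "a \<noteq> 0"
  shows "lebd (\<lambda>r. real (n + 2) * Tc f r) (\<lambda>r. max 0 (ln (nrm r (Pop n a f))) + real (n + 2) * Nc f r)"
proof -
  define b where "b = bval n a"
  define k where "k = (1 / of_nat (n + 2) :: 'a)"
  have b: "b \<noteq> 0" using bval_nz[OF a] by (simp add: b_def)
  have k: "k \<noteq> 0" unfolding k_def by (simp del: of_nat_add of_nat_Suc)
  define C where "C = \<bar>ln (absval k)\<bar> + real (n + 2) * \<bar>ln (absval b)\<bar>"
  show ?thesis
  proof (rule lebdI)
    fix r :: real assume "r \<ge> 1"
    hence r: "r > 0" by simp
    have pos: "nrm r f > 0" "nrm r (f - fls_const b) > 0" "absval k > 0"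
      using r nonconst_nz nonconst_neq k by (auto intro!: nrm_pos)
    have "nrm r (Pop n a f) = absval k * nrm r f ^ (n + 1) * nrm r (f - fls_const b)"
      unfolding Pop_def b_def[symmetric] k_def[symmetric]
      by (simp only: nrm_mult[OF r] nrm_power[OF r] nrm_const[OF r] mero_mult mero_const mero_power mero_diff nonconst_mero)
    hence v: "ln (nrm r (Pop n a f)) = ln (absval k) + real (n + 1) * ln (nrm r f) + ln (nrm r (f - fls_const b))"
      using pos by (simp add: ln_mult ln_realpow del: power_Suc of_nat_Suc)
    have "real (n + 2) * max (ln (nrm r f)) 0 \<le> max 0 (ln (nrm r (Pop n a f))) + C"
    proof (cases "nrm r f > absval b")
      case True
      have "nrm r (f + fls_const (- b)) = nrm r f"
        using True nrm_const[OF r, of "-b"] by (intro nrm_add_eq[OF r]) auto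
      hence *: "nrm r (f - fls_const b) = nrm r f" by simp
      have "ln (nrm r (Pop n a f)) = ln (absval k) + real (n + 2) * ln (nrm r f)"
        unfolding v * by (simp add: algebra_simps)
      moreover have "C \<ge> \<bar>ln (absval k)\<bar>" by (simp add: C_def)
      ultimately show ?thesis by (auto simp: max_def abs_if split: if_splits)
    next
      case False
      hence "ln (nrm r f) \<le> ln (absval b)" using pos b by (intro ln_mono) auto
      hence "max (ln (nrm r f)) 0 \<le> \<bar>ln (absval b)\<bar>" by simp
      hence "real (n + 2) * max (ln (nrm r f)) 0 \<le> real (n + 2) * \<bar>ln (absval b)\<bar>"
        by (intro mult_left_mono) auto
      thus ?thesis unfolding C_def by linarith
    qed
    thus "real (n + 2) * Tc f r \<le> max 0 (ln (nrm r (Pop n a f))) + real (n + 2) * Nc f r + C"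
      unfolding Tc_def distrib_left by linarith
  qed
qed

lemma Nc_Pop: "a \<noteq> 0 \<Longrightarrow> Nc (Pop n a f) r = real (n + 2) * Nc f r"
proof -
  assume a: "a \<noteq> 0"
  have "max 0 (- omega z (Pop n a f)) = int (n + 2) * max 0 (- omega z f)" for z
  proof (cases "omega z f < 0")
    case True
    hence "int (n + 2) * omega z f < 0" by (simp add: mult_pos_neg)
    moreover have "omega z (Pop n a f) = int (n + 2) * omega z f"
      using omega_Fop_Pop_cases[OF a, of z n] True by linarith
    ultimately show ?thesis using True by (simp only: max_def) simp
  next
    case False
    hence "int (n + 1) * omega z f \<ge> 0" by simp
    hence "omega z (Pop n a f) \<ge> 0" using omega_Fop_Pop_cases[OF a, of z n] False by linarith
    thus ?thesis using False by simp
  qed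
  thus ?thesis unfolding Nc_def by (simp only: Nr_cmult of_int_of_nat_eq)
qed

text \<open>Since max 0 x = x + max 0 (-x), Jensen's formula for P(f) trades its poles for its zeros
  and the term max 0 (- ln |P(f)|_r). For r \<ge> 1 the derivative F is no larger than P(f), so F
  may replace it there.\<close>

lemma Tc_le_Zc_Pop:
  assumes a: "a \<noteq> 0"
  shows "lebd (\<lambda>r. real (n + 2) * Tc f r) (\<lambda>r. Zc (Pop n a f) r + max 0 (- ln (nrm r (Fop n a f))))"
proof -
  obtain C where C: "\<And>r. r \<ge> 1 \<Longrightarrow> real (n + 2) * Tc f r \<le> max 0 (ln (nrm r (Pop n a f))) + real (n + 2) * Nc f r + C"
    using Tc_Pop[OF a, of n] unfolding lebd_def by blast
  obtain D where D: "\<And>r. r > 0 \<Longrightarrow> ln (nrm r (Pop n a f)) = Zc (Pop n a f) r - Nc (Pop n a f) r + D"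
    using jensen_Zc_Nc[OF Pop_mero[of n a] Pop_nz[of n a]] by blast
  show ?thesis
  proof (rule lebdI)
    fix r :: real assume r: "r \<ge> 1"
    have "ln (nrm r (Fop n a f)) \<le> ln (nrm r (Pop n a f)) - ln r"
      using nrm_log_deriv[OF Pop_mero[of n a] Pop_nz[of n a], of r] r Fop_nz[of n a] by (simp add: deriv_Pop)
    moreover have "ln r \<ge> 0" using r by simp
    ultimately show "real (n + 2) * Tc f r \<le> Zc (Pop n a f) r + max 0 (- ln (nrm r (Fop n a f))) + (C + D)"
      using C[OF r] D[OF less_le_trans[OF zero_less_one r]] Nc_Pop[OF a, of n r] by linarith
  qed
qed

end

section \<open>From pointwise order estimates to inequalities between characteristics\<close>

lemma counting_bounds:
  assumes f: "nonconst f"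
  obtains C where "\<And>r. r \<ge> 1 \<Longrightarrow> Zc f r \<le> Tc f r + C" "\<And>r. r \<ge> 1 \<Longrightarrow> Zc (f - fls_const c) r \<le> Tc f r + C"
    "\<And>r. Nc f r \<le> Tc f r"
proof -
  note fm = nonconst_mero[OF f] nonconst_nz[OF f] nonconst_neq[OF f]
  obtain C D where CD: "\<And>r. r \<ge> 1 \<Longrightarrow> Zc f r \<le> Tc f r + C" "\<And>r. r \<ge> 1 \<Longrightarrow> Zc (f - fls_const c) r \<le> Tc f r + D"
    using Zc_le[OF fm(1,2)] Zc_diff_const_le[OF fm] unfolding lebd_def by blast
  show ?thesis
  proof (rule that[of "max C D"])
    fix r :: real assume r: "r \<ge> 1"
    show "Zc f r \<le> Tc f r + max C D" "Zc (f - fls_const c) r \<le> Tc f r + max C D"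
      using CD(1)[OF r] CD(2)[OF r] by linarith+
  qed (rule Nc_le_Tc[OF fm(1,2)])
qed

text \<open>Summing \<open>local_bound k\<close> over a disc yields \<open>(k + 3) * Tc f + 7 * Tc g - ln r\<close> and the
  contribution of \<open>\<alpha>\<close>; the \<open>- ln r\<close> comes from the logarithmic derivative of \<open>g\<close>.\<close>

definition local_bound where
  "local_bound k n a f g \<alpha> z =
     k * max 0 (omega z f) + max 0 (omega z (f - fls_const (bval n a))) + 2 * max 0 (- omega z f)
     + 2 * max 0 (omega z g) + max 0 (omega z (g - fls_const a)) + max 0 (omega z (fls_deriv g / g))
     + 2 * max 0 (- omega z g) + 2 * max 0 (omega z \<alpha>) + max 0 (- omega z \<alpha>)"

definition err where
  "err \<alpha> r = 2 * Zc \<alpha> r + Nc \<alpha> r + max 0 (- ln (nrm r \<alpha>))"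

text \<open>The summation shared by two choices of \<Theta>: the Wronskian quotient with k = s = 3,
  and (\<phi> - c) / \<phi>' with k = 2, s = 1. The term max 0 (- ln |F|_r) left over by
  \<open>Tc_le_Zc_Pop\<close> is paid by the lower bound for |\<Theta>|_r.\<close>

lemma Fop_ineq:
  fixes k :: int
  assumes f: "nonconst f" and g: "nonconst g" and \<alpha>: "mero \<alpha>" "\<alpha> \<noteq> 0"
    and a: "a \<noteq> 0" and \<Theta>: "mero \<Theta>" "\<Theta> \<noteq> 0" and k: "k \<ge> 0"
    and local: "\<And>z. max 0 (omega z (Pop n a f)) + omega z \<Theta> \<le>
      local_bound k n a f g \<alpha> z"
    and lower: "lebd (\<lambda>r. s * ln r + max 0 (- ln (nrm r (Fop n a f / \<alpha>)))) (\<lambda>r. ln (nrm r \<Theta>))"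
  shows "lebd (\<lambda>r. real (n + 2) * Tc f r)
    (\<lambda>r. (of_int k + 3) * Tc f r + 7 * Tc g r - (s + 1) * ln r + err \<alpha> r)"
proof -
  define b where "b = bval n a"
  note fm = nonconst_mero[OF f] nonconst_nz[OF f] nonconst_neq[OF f]
  note gm = nonconst_mero[OF g] nonconst_nz[OF g] nonconst_neq[OF g] nonconst_deriv[OF g]
  have fb: "mero (f - fls_const b)" "f - fls_const b \<noteq> 0" using fm by auto
  have ga: "mero (g - fls_const a)" "g - fls_const a \<noteq> 0" using gm by auto
  have gl: "mero (fls_deriv g / g)" "fls_deriv g / g \<noteq> 0" using gm by auto
  obtain C1 where C1: "\<And>r. r \<ge> 1 \<Longrightarrow> real (n + 2) * Tc f r \<le> Zc (Pop n a f) r + max 0 (- ln (nrm r (Fop n a f))) + C1"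
    using Tc_le_Zc_Pop[OF f a, of n] unfolding lebd_def by blast
  obtain C2 where C2: "\<And>r. r \<ge> 1 \<Longrightarrow> s * ln r + max 0 (- ln (nrm r (Fop n a f / \<alpha>))) \<le> ln (nrm r \<Theta>) + C2"
    using lower unfolding lebd_def by blast
  obtain C3 where C3: "\<forall>r>0. ln (nrm r \<Theta>) = Nr (\<lambda>z. omega z \<Theta>) r + C3" using jensen(2)[OF \<Theta>] by blast
  obtain C4 where C4: "\<And>r. r \<ge> 1 \<Longrightarrow> Zc f r \<le> Tc f r + C4" "\<And>r. r \<ge> 1 \<Longrightarrow> Zc (f - fls_const b) r \<le> Tc f r + C4"
    "\<And>r. Nc f r \<le> Tc f r" using counting_bounds[OF f, of b] by blast
  obtain C6 where C6: "\<And>r. r \<ge> 1 \<Longrightarrow> Zc g r \<le> Tc g r + C6" "\<And>r. r \<ge> 1 \<Longrightarrow> Zc (g - fls_const a) r \<le> Tc g r + C6"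
    "\<And>r. Nc g r \<le> Tc g r" using counting_bounds[OF g, of a] by blast
  obtain C8 where C8: "\<And>r. r \<ge> 1 \<Longrightarrow> Zc (fls_deriv g / g) r \<le> 2 * Tc g r - ln r + C8"
    using Zc_log_deriv[OF gm(1,2,4)] unfolding lebd_def by blast
  define C where "C = C1 + C2 + C3 + of_int k * C4 + C4 + 2 * C6 + C6 + C8"
  show ?thesis
  proof (rule lebdI)
    fix r :: real assume r: "r \<ge> 1"
    have lf: "locfin (\<lambda>z. max 0 (omega z F))" "locfin (\<lambda>z. max 0 (- omega z F))"
      if "mero F" "F \<noteq> 0" for F :: "'a fls"
      using that by auto
    note lfs = lf[OF fm(1,2)] lf[OF gm(1,2)] lf[OF fb] lf[OF ga] lf[OF gl] lf[OF \<alpha>]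
      lf[OF Pop_mero[OF f] Pop_nz[OF f]] locfin_omega[OF \<Theta>]
    have "Zc (Pop n a f) r + Nr (\<lambda>z. omega z \<Theta>) r = Nr (\<lambda>z. max 0 (omega z (Pop n a f)) + omega z \<Theta>) r"
      unfolding Zc_def by (intro Nr_add[symmetric] lfs)
    also have "\<dots> \<le> Nr (\<lambda>z. k * max 0 (omega z f) + max 0 (omega z (f - fls_const b)) + 2 * max 0 (- omega z f)
      + 2 * max 0 (omega z g) + max 0 (omega z (g - fls_const a)) + max 0 (omega z (fls_deriv g / g))
      + 2 * max 0 (- omega z g) + 2 * max 0 (omega z \<alpha>) + max 0 (- omega z \<alpha>)) r"
      using local r unfolding local_bound_def b_def[symmetric] by (intro Nr_mono locfin_add locfin_cmult lfs) auto
    also have "\<dots> = of_int k * Zc f r + Zc (f - fls_const b) r + 2 * Nc f r + 2 * Zc g r + Zc (g - fls_const a) r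
        + Zc (fls_deriv g / g) r + 2 * Nc g r + 2 * Zc \<alpha> r + Nc \<alpha> r"
      unfolding Zc_def Nc_def by (simp add: Nr_add Nr_cmult locfin_add locfin_cmult lfs)
    finally have 1: "Zc (Pop n a f) r + Nr (\<lambda>z. omega z \<Theta>) r \<le> of_int k * Zc f r + Zc (f - fls_const b) r
        + 2 * Nc f r + 2 * Zc g r + Zc (g - fls_const a) r
        + Zc (fls_deriv g / g) r + 2 * Nc g r + 2 * Zc \<alpha> r + Nc \<alpha> r" .
    have "of_int k * Zc f r \<le> of_int k * (Tc f r + C4)" using C4(1)[OF r] k by (intro mult_left_mono) auto
    hence 2: "of_int k * Zc f r \<le> of_int k * Tc f r + of_int k * C4" by (simp add: algebra_simps)
    have "nrm r (Fop n a f / \<alpha>) = nrm r (Fop n a f) / nrm r \<alpha>"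
      using r \<alpha> Fop_mero[OF f] by (intro nrm_divide) auto
    hence "ln (nrm r (Fop n a f / \<alpha>)) = ln (nrm r (Fop n a f)) - ln (nrm r \<alpha>)"
      using r nrm_pos[OF _ Fop_mero[OF f] Fop_nz[OF f], of r n a] nrm_pos[OF _ \<alpha>, of r] by (simp add: ln_div)
    hence 3: "max 0 (- ln (nrm r (Fop n a f))) \<le> max 0 (- ln (nrm r (Fop n a f / \<alpha>))) + max 0 (- ln (nrm r \<alpha>))"
      by simp
    have 4: "ln (nrm r \<Theta>) = Nr (\<lambda>z. omega z \<Theta>) r + C3" using C3 r by simp
    show "real (n + 2) * Tc f r \<le> (of_int k + 3) * Tc f r + 7 * Tc g r - (s + 1) * ln r + err \<alpha> r + C"
      unfolding distrib_right C_def err_def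
      using C1[OF r] C2[OF r] 1 2 3 4 C4(2)[OF r] C4(3)[of r] C6(1,2)[OF r] C6(3)[of r] C8[OF r] by linarith
  qed
qed

subsection \<open>A Wronskian for two functions sharing the value 1\<close>

definition wr3 :: "'a::field fls \<Rightarrow> 'a fls \<Rightarrow> 'a fls \<Rightarrow> 'a fls" where
  "wr3 x y z =
     x * (fls_deriv y * fls_deriv (fls_deriv z) - fls_deriv (fls_deriv y) * fls_deriv z)
   - y * (fls_deriv x * fls_deriv (fls_deriv z) - fls_deriv (fls_deriv x) * fls_deriv z)
   + z * (fls_deriv x * fls_deriv (fls_deriv y) - fls_deriv (fls_deriv x) * fls_deriv y)"

text \<open>The columns 1, 1 / (\<phi> - 1), 1 / (\<psi> - 1) span the same space as the four
  functions of the overview.\<close>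

abbreviation wron :: "'a::field fls \<Rightarrow> 'a fls \<Rightarrow> 'a fls" where
  "wron \<phi> \<psi> \<equiv> wr3 1 (inverse (\<phi> - 1)) (inverse (\<psi> - 1))"

text \<open>Used to clear a pole common to all columns: a factor of order \<zeta> costs 3
  \<zeta>.\<close>

lemma wr3_scale: "wr3 (\<theta> * x) (\<theta> * y) (\<theta> * z) = \<theta> ^ 3 * wr3 x y z"
proof -
  have d2: "fls_deriv (fls_deriv (\<theta> * x)) =
      \<theta> * fls_deriv (fls_deriv x) + (fls_deriv \<theta> * fls_deriv x + fls_deriv \<theta> * fls_deriv x) + fls_deriv (fls_deriv \<theta>) * x"
    for x by (simp add: algebra_simps)
  show ?thesis unfolding wr3_def d2 unfolding fls_deriv_mult by algebra
qed

lemma wr3_shift: "wr3 (1 + z) y z = wr3 1 y z" "wr3 (1 + z) (1 + y) z = wr3 1 y z"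
  unfolding wr3_def by (simp_all add: algebra_simps)

lemma wr3_1: "wr3 1 y z = fls_deriv y * fls_deriv (fls_deriv z) - fls_deriv (fls_deriv y) * fls_deriv z"
  by (simp add: wr3_def)

text \<open>Each product in the determinant holds one undifferentiated entry, one first and one
  second derivative, which together gain r^3.\<close>

lemma nrm_wr3_le:
  assumes m: "mero x" "mero y" "mero z" and r: "r > 0"
  shows "nrm r (wr3 x y z) \<le> nrm r x * nrm r y * nrm r z / r ^ 3"
proof -
  have d2: "nrm r (fls_deriv (fls_deriv u)) \<le> nrm r u / r ^ 2" if "mero u" for u :: "'a fls"
  proof -
    have "nrm r (fls_deriv (fls_deriv u)) \<le> nrm r (fls_deriv u) / r" using that r by (intro nrm_deriv) auto
    also have "\<dots> \<le> (nrm r u / r) / r" using that r by (intro divide_right_mono nrm_deriv) auto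
    finally show ?thesis by (simp add: power2_eq_square)
  qed
  have t: "nrm r (u * (fls_deriv v * fls_deriv (fls_deriv w))) \<le> nrm r u * nrm r v * nrm r w / r ^ 3"
    if "mero u" "mero v" "mero w" for u v w :: "'a fls"
  proof -
    have "nrm r (u * (fls_deriv v * fls_deriv (fls_deriv w))) = nrm r u * (nrm r (fls_deriv v) * nrm r (fls_deriv (fls_deriv w)))"
      using that r by (simp add: nrm_mult)
    also have "\<dots> \<le> nrm r u * ((nrm r v / r) * (nrm r w / r ^ 2))"
      using that r by (intro mult_left_mono mult_mono nrm_deriv d2) (auto simp: nrm_nonneg)
    finally show ?thesis by (simp add: power2_eq_square power3_eq_cube)
  qed
  define B where "B = nrm r x * nrm r y * nrm r z / r ^ 3"
  have d: "nrm r (u - v) \<le> B" if "nrm r u \<le> B" "nrm r v \<le> B" "mero u" "mero v" for u v :: "'a fls"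
    using nrm_diff[OF r that(3,4)] that by simp
  have s: "nrm r (u + v) \<le> B" if "nrm r u \<le> B" "nrm r v \<le> B" "mero u" "mero v" for u v :: "'a fls"
    using nrm_add[OF r that(3,4)] that by simp
  have eq: "wr3 x y z = ((x * (fls_deriv y * fls_deriv (fls_deriv z)) - x * (fls_deriv z * fls_deriv (fls_deriv y)))
    - (y * (fls_deriv x * fls_deriv (fls_deriv z)) - y * (fls_deriv z * fls_deriv (fls_deriv x))))
    + (z * (fls_deriv x * fls_deriv (fls_deriv y)) - z * (fls_deriv y * fls_deriv (fls_deriv x)))"
    by (simp add: wr3_def algebra_simps)
  show ?thesis unfolding eq B_def[symmetric] using m
    by (intro s d mero_diff mero_mult mero_deriv)
      (use t[of x y z] t[of x z y] t[of y x z] t[of y z x] t[of z x y] t[of z y x] in \<open>auto simp: B_def mult_ac\<close>)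
qed

lemma one_plus_inverse:
  fixes \<chi> :: "'a :: field fls"
  assumes "\<chi> \<noteq> 1"
  shows "1 + inverse (\<chi> - 1) = \<chi> * inverse (\<chi> - 1)"
  using assms by (simp add: field_simps)

lemma omega_shift1:
  fixes \<chi> :: "'a :: {ultrametric_field, complete_space, alg_closed_field, field_char_0} fls"
  assumes "mero \<chi>" "\<chi> \<noteq> 0"
  shows "omega z \<chi> < 0 \<Longrightarrow> omega z (\<chi> - 1) = omega z \<chi>"
    and "omega z \<chi> > 0 \<Longrightarrow> omega z (\<chi> - 1) = 0"
    and "omega z \<chi> = 0 \<Longrightarrow> omega z (\<chi> - 1) \<ge> 0"
  using omega_diff_const[OF assms, of z 1] by auto

text \<open>At a zero of \<chi> the shifted column 1 + 1 / (\<chi> - 1) = \<chi> / (\<chi> - 1)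
  vanishes to the order of \<chi>, at a pole the column 1 / (\<chi> - 1) does so. Both have the same
  derivative, so the better one may be put into the Wronskian.\<close>

lemma small_column:
  fixes \<chi> :: "'a :: {ultrametric_field, complete_space, alg_closed_field, field_char_0} fls"
  assumes "mero \<chi>" "\<chi> \<noteq> 0" "\<chi> \<noteq> 1"
  obtains A where "mero A" "fls_deriv A = fls_deriv (inverse (\<chi> - 1))"
    "omega z A = max 0 (omega z \<chi>) - omega z (\<chi> - 1)" "A \<noteq> 0"
proof (cases "omega z \<chi> > 0")
  case True
  have "omega z (1 + inverse (\<chi> - 1)) = omega z \<chi> - omega z (\<chi> - 1)"
    using assms by (simp add: one_plus_inverse omega_mult omega_inverse)
  moreover have "fls_deriv (1 + inverse (\<chi> - 1)) = fls_deriv (inverse (\<chi> - 1))"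
    by (simp only: fls_deriv_add fls_deriv_one add_0)
  moreover have "1 + inverse (\<chi> - 1) \<noteq> 0" using assms by (simp add: one_plus_inverse)
  moreover have "mero (1 + inverse (\<chi> - 1))" using assms by simp
  ultimately show ?thesis using True by (intro that[of "1 + inverse (\<chi> - 1)"]) simp_all
next
  case False
  thus ?thesis using assms by (intro that[of "inverse (\<chi> - 1)"]) (auto simp: omega_inverse)
qed

lemma ordge_wr3:
  fixes x y z :: "'a :: {ultrametric_field, complete_space, field_char_0} fls"
  assumes m: "mero x" "mero y" "mero z"
    and o: "ordge c 0 x" "ordge c 0 y" "ordge c 0 z"
  shows "ordge c 0 (wr3 x y z)"
proof -
  have d: "ordge c 0 (fls_deriv u)" "ordge c 0 (fls_deriv (fls_deriv u))"
    if u: "mero u" "ordge c 0 u" for u :: "'a fls"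
  proof -
    show 1: "ordge c 0 (fls_deriv u)" by (rule ordge_deriv(2)[OF u(1) u(2) u(2)])
    show "ordge c 0 (fls_deriv (fls_deriv u))" by (rule ordge_deriv(2)[OF mero_deriv[OF u(1)] 1 1])
  qed
  have p: "ordge c 0 (u * v)" if "mero u" "mero v" "ordge c 0 u" "ordge c 0 v" for u v :: "'a fls"
    using ordge_mult[OF that] by simp
  show ?thesis unfolding wr3_def
    by (intro ordge_add ordge_diff p d m o mero_add mero_diff mero_mult mero_deriv)
qed

context
  fixes \<phi> \<psi> :: "'a :: {ultrametric_field, complete_space, alg_closed_field, field_char_0} fls"
  assumes m: "mero \<phi>" "mero \<psi>"
    and nz: "\<phi> \<noteq> 0" "\<phi> \<noteq> 1" "\<psi> \<noteq> 0" "\<psi> \<noteq> 1"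
    and W: "wron \<phi> \<psi> \<noteq> 0"
begin

definition Theta where
  "Theta = inverse (\<phi> - 1) * (1 + inverse (\<psi> - 1)) * inverse (\<psi> - 1) / wron \<phi> \<psi>"

lemma Wr_mero: "mero (wron \<phi> \<psi>)"
  using m by (simp add: wr3_1)

lemma Theta_mero: "mero Theta"
  using m Wr_mero by (simp add: Theta_def)

lemma Theta_nz: "Theta \<noteq> 0"
  using nz W by (simp add: Theta_def one_plus_inverse)

text \<open>Two versions of the same Wronskian: the columns 1 + z, x, z give 3 ln r, and replacing x
  by 1 + x = \<phi> x adds - ln |\<phi>|_r. The maximum of both is the claim.\<close>

lemma nrm_Theta:
  assumes r: "r > 0"
  shows "3 * ln r + max 0 (- ln (nrm r \<phi>)) \<le> ln (nrm r Theta)"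
proof -
  define x where "x = inverse (\<phi> - 1)"
  define z where "z = inverse (\<psi> - 1)"
  define w where "w = wr3 1 x z"
  have mm: "mero x" "mero z" "mero w" using m Wr_mero by (auto simp: x_def z_def w_def)
  have nn: "x \<noteq> 0" "z \<noteq> 0" "w \<noteq> 0" "1 + z \<noteq> 0" "1 + x \<noteq> 0"
    using nz W by (auto simp: x_def z_def w_def one_plus_inverse)
  have pos: "nrm r x > 0" "nrm r z > 0" "nrm r w > 0" "nrm r (1 + z) > 0" "nrm r (1 + x) > 0" "nrm r \<phi> > 0"
    using mm nn r m nz by (auto intro!: nrm_pos)
  have 1: "ln (nrm r w) \<le> ln (nrm r u) + ln (nrm r (1 + z)) + ln (nrm r z) - 3 * ln r"
    if "w = wr3 (1 + z) u z" "mero u" "nrm r u > 0" for u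
  proof -
    have "nrm r w \<le> nrm r (1 + z) * nrm r u * nrm r z / r ^ 3"
      unfolding that(1) using that mm r by (intro nrm_wr3_le) auto
    hence "ln (nrm r w) \<le> ln (nrm r (1 + z) * nrm r u * nrm r z / r ^ 3)" using pos by simp
    thus ?thesis using pos that r by (simp add: ln_mult ln_div ln_realpow)
  qed
  have 2: "ln (nrm r w) \<le> ln (nrm r x) + ln (nrm r (1 + z)) + ln (nrm r z) - 3 * ln r"
    using mm pos by (intro 1) (auto simp: w_def wr3_shift(1))
  have "w = wr3 (1 + z) (1 + x) z" by (simp only: w_def wr3_shift(2))
  hence 3: "ln (nrm r w) \<le> ln (nrm r (1 + x)) + ln (nrm r (1 + z)) + ln (nrm r z) - 3 * ln r"
    using mm pos by (intro 1) auto
  have "nrm r (1 + x) = nrm r \<phi> * nrm r x"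
    using one_plus_inverse[OF nz(2)] mm m r by (simp add: nrm_mult flip: x_def)
  hence 4: "ln (nrm r (1 + x)) = ln (nrm r \<phi>) + ln (nrm r x)" using pos by (simp add: ln_mult)
  have "nrm r Theta = nrm r x * nrm r (1 + z) * nrm r z / nrm r w"
    unfolding Theta_def x_def[symmetric] z_def[symmetric] w_def[symmetric]
    using mm r by (simp add: nrm_mult nrm_divide)
  hence "ln (nrm r Theta) = ln (nrm r x) + ln (nrm r (1 + z)) + ln (nrm r z) - ln (nrm r w)"
    using pos by (simp add: ln_mult ln_div)
  with 2 3 4 show ?thesis by simp
qed

lemma omega_Theta:
  "omega z Theta = omega z \<psi> - omega z (\<phi> - 1) - 2 * omega z (\<psi> - 1) - omega z (wron \<phi> \<psi>)"
proof -
  have "Theta = inverse (\<phi> - 1) * (\<psi> * inverse (\<psi> - 1)) * inverse (\<psi> - 1) / wron \<phi> \<psi>"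
    unfolding Theta_def one_plus_inverse[OF nz(4)] ..
  thus ?thesis using nz W m Wr_mero by (simp add: omega_divide omega_mult omega_inverse)
qed

text \<open>This estimate needs no sharing and covers the zeros and poles of the small function, where
  the sharing of \<open>\<alpha>\<close> by \<open>F\<close> and \<open>G\<close> says nothing about \<open>F / \<alpha>\<close> and \<open>G / \<alpha>\<close>.\<close>

lemma omega_Theta_crude: "omega z Theta \<le> 3 - max 0 (omega z \<phi>)"
proof -
  obtain A where A: "mero A" "fls_deriv A = fls_deriv (inverse (\<phi> - 1))"
    "omega z A = max 0 (omega z \<phi>) - omega z (\<phi> - 1)" "A \<noteq> 0"
    using small_column[OF m(1) nz(1,2)] by metis
  obtain B where B: "mero B" "fls_deriv B = fls_deriv (inverse (\<psi> - 1))"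
    "omega z B = max 0 (omega z \<psi>) - omega z (\<psi> - 1)" "B \<noteq> 0"
    using small_column[OF m(2) nz(3,4)] by metis
  define x where "x = omega z A"
  define y where "y = omega z B"
  have w: "wron \<phi> \<psi> =
      fls_deriv A * fls_deriv (fls_deriv B) - fls_deriv (fls_deriv A) * fls_deriv B"
    by (simp add: wr3_1 A B)
  have oA: "ordge z (x - 1) (fls_deriv A)" "ordge z (x - 1 - 1) (fls_deriv (fls_deriv A))"
    unfolding x_def by (intro ordge_deriv(1) mero_deriv A(1) ordge_omega)+
  have oB: "ordge z (y - 1) (fls_deriv B)" "ordge z (y - 1 - 1) (fls_deriv (fls_deriv B))"
    unfolding y_def by (intro ordge_deriv(1) mero_deriv B(1) ordge_omega)+
  have mA: "mero (fls_deriv A)" "mero (fls_deriv (fls_deriv A))"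
    and mB: "mero (fls_deriv B)" "mero (fls_deriv (fls_deriv B))"
    by (intro mero_deriv A(1) B(1))+
  have "ordge z (x + y - 3) (fls_deriv A * fls_deriv (fls_deriv B) - fls_deriv (fls_deriv A) * fls_deriv B)"
  proof (intro ordge_diff mero_mult mA mB)
    show "ordge z (x + y - 3) (fls_deriv A * fls_deriv (fls_deriv B))"
      by (rule ordge_mono[OF ordge_mult[OF mA(1) mB(2) oA(1) oB(2)]]) simp
    show "ordge z (x + y - 3) (fls_deriv (fls_deriv A) * fls_deriv B)"
      by (rule ordge_mono[OF ordge_mult[OF mA(2) mB(1) oA(2) oB(1)]]) simp
  qed
  hence "x + y - 3 \<le> omega z (wron \<phi> \<psi>)"
    using W unfolding w by (simp add: ordge_D)
  thus ?thesis using omega_Theta[of z] A(3) B(3) omega_shift1[OF m(2) nz(3), of z]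
    unfolding x_def y_def by (cases "omega z \<psi>" "0::int" rule: linorder_cases) auto
qed

text \<open>At a common 1-point of multiplicity \<zeta> the numerator of \<Theta> has order -3
  \<zeta> and the Wronskian at least that, so they cancel. Elsewhere columns of order x and y,
  differentiated at most twice without acquiring poles, give the Wronskian order at least max 0 (x -
  2) + max 0 (y - 2); the truncations at 2 are what remains.\<close>

lemma omega_Theta_fine:
  assumes "max 0 (omega z (\<phi> - 1)) = max 0 (omega z (\<psi> - 1))"
  shows "omega z Theta \<le> min 2 \<bar>omega z \<phi>\<bar> + min 2 \<bar>omega z \<psi>\<bar> - max 0 (omega z \<phi>)"
proof (cases "omega z (\<phi> - 1) > 0")
  case True
  define \<zeta> where "\<zeta> = omega z (\<phi> - 1)"
  have \<zeta>: "\<zeta> > 0" "omega z (\<psi> - 1) = \<zeta>" using True assms by (auto simp: \<zeta>_def max_def split: if_splits)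
  have u: "omega z \<phi> = 0" "omega z \<psi> = 0"
    using omega_shift1[OF m(1) nz(1), of z] omega_shift1[OF m(2) nz(3), of z] \<zeta> \<zeta>_def by linarith+
  define \<theta> where "\<theta> = lin z ^ nat \<zeta>"
  have \<theta>: "mero \<theta>" "\<theta> \<noteq> 0" "omega z \<theta> = \<zeta>"
    using \<zeta> by (auto simp: \<theta>_def omega_power omega_lin)
  have "ordge z 0 (wr3 (\<theta> * 1) (\<theta> * inverse (\<phi> - 1)) (\<theta> * inverse (\<psi> - 1)))"
  proof (rule ordge_wr3)
    show "ordge z 0 (\<theta> * 1)" "ordge z 0 (\<theta> * inverse (\<phi> - 1))" "ordge z 0 (\<theta> * inverse (\<psi> - 1))"
      using \<theta> \<zeta> m nz by (auto simp: ordge_def omega_mult omega_inverse \<zeta>_def)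
  qed (use \<theta> m in auto)
  hence "ordge z 0 (\<theta> ^ 3 * wron \<phi> \<psi>)" unfolding wr3_scale .
  hence "0 \<le> 3 * \<zeta> + omega z (wron \<phi> \<psi>)"
    using ordge_D \<theta> W Wr_mero by (fastforce simp: omega_mult omega_power)
  thus ?thesis using omega_Theta[of z] u \<zeta> \<zeta>_def by simp
next
  case False
  hence \<zeta>: "omega z (\<phi> - 1) \<le> 0" "omega z (\<psi> - 1) \<le> 0" using assms by (auto simp: max_def split: if_splits)
  have u1: "max 0 (omega z \<phi>) - omega z (\<phi> - 1) = \<bar>omega z \<phi>\<bar>"
    using omega_shift1[OF m(1) nz(1), of z] \<zeta> by linarith
  have u2: "max 0 (omega z \<psi>) - omega z (\<psi> - 1) = \<bar>omega z \<psi>\<bar>"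
    using omega_shift1[OF m(2) nz(3), of z] \<zeta> by linarith
  obtain A where A: "mero A" "fls_deriv A = fls_deriv (inverse (\<phi> - 1))"
    "omega z A = \<bar>omega z \<phi>\<bar>" "A \<noteq> 0"
    using small_column[OF m(1) nz(1,2)] u1 by metis
  obtain B where B: "mero B" "fls_deriv B = fls_deriv (inverse (\<psi> - 1))"
    "omega z B = \<bar>omega z \<psi>\<bar>" "B \<noteq> 0"
    using small_column[OF m(2) nz(3,4)] u2 by metis
  define x where "x = omega z A"
  define y where "y = omega z B"
  have xy: "x \<ge> 0" "y \<ge> 0" using A B by (auto simp: x_def y_def)
  have w: "wron \<phi> \<psi> =
      fls_deriv A * fls_deriv (fls_deriv B) - fls_deriv (fls_deriv A) * fls_deriv B"
    by (simp add: wr3_1 A B)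
  have ord: "ordge z (max 0 (k - 1)) (fls_deriv E)" "ordge z (max 0 (k - 2)) (fls_deriv (fls_deriv E))"
    if E: "mero E" and k: "ordge z k E" "k \<ge> 0" for E :: "'a fls" and k
  proof -
    have mE: "mero (fls_deriv E)" using E by (rule mero_deriv)
    have o: "ordge z 0 E" by (rule ordge_mono[OF k])
    have d: "ordge z (k - 1) (fls_deriv E)" by (rule ordge_deriv(1)[OF E k(1)])
    have d0: "ordge z 0 (fls_deriv E)" by (rule ordge_deriv(2)[OF E o o])
    have dd: "ordge z (k - 1 - 1) (fls_deriv (fls_deriv E))" by (rule ordge_deriv(1)[OF mE d])
    have dd0: "ordge z 0 (fls_deriv (fls_deriv E))" by (rule ordge_deriv(2)[OF mE d0 d0])
    show "ordge z (max 0 (k - 1)) (fls_deriv E)" using d d0 by (simp add: max_def)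
    show "ordge z (max 0 (k - 2)) (fls_deriv (fls_deriv E))" using dd dd0 by (simp add: max_def)
  qed
  have oA: "ordge z (max 0 (x - 1)) (fls_deriv A)" "ordge z (max 0 (x - 2)) (fls_deriv (fls_deriv A))"
    using ord[OF A(1) _ xy(1)] by (auto simp: x_def ordge_omega)
  have oB: "ordge z (max 0 (y - 1)) (fls_deriv B)" "ordge z (max 0 (y - 2)) (fls_deriv (fls_deriv B))"
    using ord[OF B(1) _ xy(2)] by (auto simp: y_def ordge_omega)
  have mA: "mero (fls_deriv A)" "mero (fls_deriv (fls_deriv A))"
    and mB: "mero (fls_deriv B)" "mero (fls_deriv (fls_deriv B))"
    by (intro mero_deriv A(1) B(1))+
  have "ordge z (max 0 (x - 2) + max 0 (y - 2)) (fls_deriv A * fls_deriv (fls_deriv B) - fls_deriv (fls_deriv A) * fls_deriv B)"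
  proof (intro ordge_diff mero_mult mA mB)
    show "ordge z (max 0 (x - 2) + max 0 (y - 2)) (fls_deriv A * fls_deriv (fls_deriv B))"
      by (rule ordge_mono[OF ordge_mult[OF mA(1) mB(2) oA(1) oB(2)]]) simp
    show "ordge z (max 0 (x - 2) + max 0 (y - 2)) (fls_deriv (fls_deriv A) * fls_deriv B)"
      by (rule ordge_mono[OF ordge_mult[OF mA(2) mB(1) oA(2) oB(1)]]) simp
  qed
  hence "max 0 (x - 2) + max 0 (y - 2) \<le> omega z (wron \<phi> \<psi>)"
    using W unfolding w by (simp add: ordge_D)
  thus ?thesis using omega_Theta[of z] A(3) B(3) u1 u2 unfolding x_def y_def by linarith
qed

end

text \<open>Here y, e, u are the orders of F, \<alpha> and F / \<alpha>. Where F has no pole,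
  passing from y to u costs at most max 0 e; at a pole of F the term 2 B covers the truncated
  order.\<close>

lemma order_quotient_bound_pos:
  fixes u y e A B p k :: int
  assumes "u = y - e" "y \<ge> 0 \<Longrightarrow> p - y + min k y \<le> A" "y < 0 \<Longrightarrow> y \<le> - 13 \<and> p = 0 \<and> B \<ge> 1"
    and "A \<ge> 0" "B \<ge> 0" "0 \<le> k" "k \<le> 2"
  shows "p + min k \<bar>u\<bar> - max 0 u \<le> A + 2 * B + max 0 e"
proof (cases "y \<ge> 0")
  case True
  from assms(2)[OF this] show ?thesis using assms(1,4-) True by linarith
next
  case False
  hence "y < 0" by simp
  from assms(3)[OF this] show ?thesis using assms(1,4-) by linarith
qed

lemma order_quotient_bound:
  fixes u y e A B k :: int
  assumes "u = y - e" "y \<ge> 0 \<Longrightarrow> min 2 y \<le> A" "y < 0 \<Longrightarrow> B \<ge> 1"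
    and "A \<ge> 0" "B \<ge> 0" "0 \<le> k" "k \<le> 2"
  shows "min k \<bar>u\<bar> \<le> A + 2 * B + max 0 e + max 0 (- e)"
proof (cases "y \<ge> 0")
  case True
  from assms(2)[OF this] show ?thesis using assms(1,4-) True by linarith
next
  case False
  hence "y < 0" by simp
  from assms(3)[OF this] show ?thesis using assms(1,4-) by linarith
qed

lemma main_ineq:
  assumes f: "nonconst f" and g: "nonconst g" and \<alpha>: "mero \<alpha>" "\<alpha> \<noteq> 0"
    and a: "a \<noteq> 0" and n: "n \<ge> 11"
    and ne: "Fop n a f \<noteq> \<alpha>" "Fop n a g \<noteq> \<alpha>"
    and share: "\<And>z. max 0 (omega z (Fop n a f - \<alpha>)) = max 0 (omega z (Fop n a g - \<alpha>))"
    and W: "wron (Fop n a f / \<alpha>) (Fop n a g / \<alpha>) \<noteq> 0"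
  shows "lebd (\<lambda>r. real (n + 2) * Tc f r)
    (\<lambda>r. 6 * Tc f r + 7 * Tc g r - 4 * ln r + err \<alpha> r)"
proof -
  define \<phi> where "\<phi> = Fop n a f / \<alpha>"
  define \<psi> where "\<psi> = Fop n a g / \<alpha>"
  have m: "mero \<phi>" "mero \<psi>" using \<alpha> Fop_mero[OF f] Fop_mero[OF g] by (auto simp: \<phi>_def \<psi>_def)
  have nz: "\<phi> \<noteq> 0" "\<phi> \<noteq> 1" "\<psi> \<noteq> 0" "\<psi> \<noteq> 1" using \<alpha> Fop_nz[OF f] Fop_nz[OF g] ne by (auto simp: \<phi>_def \<psi>_def)
  have W': "wron \<phi> \<psi> \<noteq> 0" using W by (simp add: \<phi>_def \<psi>_def)
  define \<Theta> where "\<Theta> = Theta \<phi> \<psi>"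
  have \<Theta>: "mero \<Theta>" "\<Theta> \<noteq> 0" using Theta_mero[OF m nz W'] Theta_nz[OF m nz W'] by (auto simp: \<Theta>_def)
  have om: "omega z \<phi> = omega z (Fop n a f) - omega z \<alpha>" "omega z \<psi> = omega z (Fop n a g) - omega z \<alpha>" for z
    using \<alpha> Fop_mero[OF f] Fop_mero[OF g] Fop_nz[OF f] Fop_nz[OF g] by (auto simp: \<phi>_def \<psi>_def omega_divide)
  have om1: "omega z (\<phi> - 1) = omega z (Fop n a f - \<alpha>) - omega z \<alpha>"
     "omega z (\<psi> - 1) = omega z (Fop n a g - \<alpha>) - omega z \<alpha>" for z
  proof -
    have "\<phi> - 1 = (Fop n a f - \<alpha>) / \<alpha>" "\<psi> - 1 = (Fop n a g - \<alpha>) / \<alpha>" using \<alpha> by (auto simp: \<phi>_def \<psi>_def field_simps)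
    thus "omega z (\<phi> - 1) = omega z (Fop n a f - \<alpha>) - omega z \<alpha>"
     "omega z (\<psi> - 1) = omega z (Fop n a g - \<alpha>) - omega z \<alpha>"
      using \<alpha> ne Fop_mero[OF f] Fop_mero[OF g] by (auto simp: omega_divide)
  qed
  have "lebd (\<lambda>r. real (n + 2) * Tc f r)
    (\<lambda>r. (of_int 3 + 3) * Tc f r + 7 * Tc g r - (3 + 1) * ln r + err \<alpha> r)"
  proof (rule Fop_ineq[OF f g \<alpha> a \<Theta>])
    fix z
    note Lf = Fop_local[OF f a n, of z] and Lg = Fop_local[OF g a n, of z]
    note crude = omega_Theta_crude[OF m nz W', of z, folded \<Theta>_def]
    note fine = omega_Theta_fine[OF m nz W', of z, folded \<Theta>_def]
    note s = omega_shift1[OF m(1) nz(1), of z] omega_shift1[OF m(2) nz(3), of z]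
    note sh = share[of z]
    show "max 0 (omega z (Pop n a f)) + omega z \<Theta> \<le>
      local_bound 3 n a f g \<alpha> z"
    proof (cases "max 0 (omega z (\<phi> - 1)) = max 0 (omega z (\<psi> - 1))")
      case True
      have F: "max 0 (omega z (Pop n a f)) + min 2 \<bar>omega z \<phi>\<bar> - max 0 (omega z \<phi>)
         \<le> 3 * max 0 (omega z f) + max 0 (omega z (f - fls_const (bval n a))) + 2 * max 0 (- omega z f) + max 0 (omega z \<alpha>)"
        using Lf(3) by (intro order_quotient_bound_pos[OF om(1) Lf(1)]) auto
      have G: "min 2 \<bar>omega z \<psi>\<bar> \<le> 2 * max 0 (omega z g) + max 0 (omega z (g - fls_const a)) + max 0 (omega z (fls_deriv g / g))
        + 2 * max 0 (- omega z g) + max 0 (omega z \<alpha>) + max 0 (- omega z \<alpha>)"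
        using Lg(3) by (intro order_quotient_bound[OF om(2) Lg(4)]) auto
      show ?thesis using fine[OF True] F G unfolding local_bound_def by linarith
    next
      case False
      \<comment> \<open>As \<phi> - 1 = (F - \<alpha>) / \<alpha>, the 1-points of \<phi> and \<psi>
        can differ only at a pole of \<alpha>. There F or G has the order of \<alpha>, so f or g has
        a pole: it pays 2 and the pole of \<alpha> pays 1 of the 3 in the crude bound.\<close>
      have e: "omega z \<alpha> < 0" and z: "omega z (\<phi> - 1) > 0 \<or> omega z (\<psi> - 1) > 0"
        using False sh unfolding om1 by linarith+
      define A where "A = 3 * max 0 (omega z f) + max 0 (omega z (f - fls_const (bval n a)))"
      define B where "B = 2 * max 0 (omega z g) + max 0 (omega z (g - fls_const a)) + max 0 (omega z (fls_deriv g / g))"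
      define p where "p = max 0 (omega z (Pop n a f))"
      have AB: "A \<ge> 0" "B \<ge> 0" by (auto simp: A_def B_def)
      have "p + omega z \<Theta> \<le> A + 2 * max 0 (- omega z f) + B + 2 * max 0 (- omega z g)
         + 2 * max 0 (omega z \<alpha>) + max 0 (- omega z \<alpha>)"
        using z
      proof
        assume "omega z (\<phi> - 1) > 0"
        hence "omega z \<phi> = 0" using s(1-3) by (cases "omega z \<phi>" "0::int" rule: linorder_cases) auto
        hence y: "omega z (Fop n a f) = omega z \<alpha>" using om(1) by simp
        hence "p = 0 \<and> omega z f < 0" using Lf(3) e by (simp add: p_def)
        thus ?thesis using e crude AB by linarith
      next
        assume "omega z (\<psi> - 1) > 0"
        hence "omega z \<psi> = 0" using s(4-6) by (cases "omega z \<psi>" "0::int" rule: linorder_cases) auto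
        hence "omega z (Fop n a g) = omega z \<alpha>" using om(2) by simp
        hence g: "omega z g < 0" using Lg(3) e by simp
        have "p - max 0 (omega z \<phi>) \<le> A"
        proof (cases "omega z (Fop n a f) \<ge> 0")
          case True
          from Lf(1)[OF this] True show ?thesis using om(1)[of z] e unfolding p_def[symmetric] A_def[symmetric] by linarith
        next
          case False
          thus ?thesis using Lf(3) AB by (auto simp: p_def)
        qed
        thus ?thesis using e g crude AB by linarith
      qed
      thus ?thesis unfolding p_def A_def B_def local_bound_def by linarith
    qed
  next
    show "lebd (\<lambda>r. 3 * ln r + max 0 (- ln (nrm r (Fop n a f / \<alpha>)))) (\<lambda>r. ln (nrm r \<Theta>))"
      by (rule lebdI[of _ _ 0]) (use nrm_Theta[OF m nz W'] in \<open>auto simp: \<Theta>_def \<phi>_def\<close>)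
  qed simp
  thus ?thesis by simp
qed

lemma max0_nrm_le_Nc:
  assumes F: "mero F" "F \<noteq> 0"
  shows "lebd (\<lambda>r. max 0 (- ln (nrm r F))) (Nc F)"
proof -
  obtain C where C: "\<And>r. r > 0 \<Longrightarrow> ln (nrm r F) = Zc F r - Nc F r + C" using jensen_Zc_Nc[OF F] by metis
  show ?thesis
  proof (rule lebdI)
    fix r :: real assume r: "r \<ge> 1"
    show "max 0 (- ln (nrm r F)) \<le> Nc F r + \<bar>C\<bar>"
      using C[of r] r Zc_nonneg[OF F r] Nc_nonneg[OF F r] by auto
  qed
qed

text \<open>Excludes constant \<phi> and \<psi>. If F = c \<alpha>, then away from the zeros of
  \<alpha> the zeros of P(f) are zeros of f - b, and one multiple of T(f) cannot balance n +
  2.\<close>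

lemma Fop_proportional_ineq:
  assumes f: "nonconst f" and \<alpha>: "mero \<alpha>" "\<alpha> \<noteq> 0"
    and a: "a \<noteq> 0" and n: "n \<ge> 11" and eq: "Fop n a f = fls_const c * \<alpha>"
  shows "lebd (\<lambda>r. real (n + 2) * Tc f r) (\<lambda>r. Tc f r + 2 * Zc \<alpha> r + Nc \<alpha> r)"
proof -
  define b where "b = bval n a"
  note fm = nonconst_mero[OF f] nonconst_nz[OF f] nonconst_neq[OF f]
  have fb: "mero (f - fls_const b)" "f - fls_const b \<noteq> 0" using fm by auto
  have c: "c \<noteq> 0" using eq Fop_nz[OF f, of n a] by auto
  obtain C1 where C1: "\<And>r. r \<ge> 1 \<Longrightarrow> real (n + 2) * Tc f r \<le> Zc (Pop n a f) r + max 0 (- ln (nrm r (Fop n a f))) + C1"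
    using Tc_le_Zc_Pop[OF f a, of n] unfolding lebd_def by blast
  obtain C2 where C2: "\<And>r. r \<ge> 1 \<Longrightarrow> Zc (f - fls_const b) r \<le> Tc f r + C2"
    using Zc_diff_const_le[OF fm(1,2,3)] unfolding lebd_def by blast
  obtain C3 where C3: "\<And>r. r \<ge> 1 \<Longrightarrow> max 0 (- ln (nrm r \<alpha>)) \<le> Nc \<alpha> r + C3"
    using max0_nrm_le_Nc[OF \<alpha>] unfolding lebd_def by blast
  have om: "omega z (Fop n a f) = omega z \<alpha>" for z using c \<alpha> by (simp add: eq omega_mult)
  show ?thesis
  proof (rule lebdI)
    fix r :: real assume r: "r \<ge> 1"
    have "Zc (Pop n a f) r \<le> Nr (\<lambda>z. max 0 (omega z (f - fls_const b)) + 2 * max 0 (omega z \<alpha>)) r"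
      unfolding Zc_def
    proof (intro Nr_mono locfin_add locfin_cmult)
      show "max 0 (omega z (Pop n a f)) \<le> max 0 (omega z (f - fls_const b)) + 2 * max 0 (omega z \<alpha>)" for z
        using Fop_local(5)[OF f a n, of z] by (simp add: om b_def)
    qed (use r \<alpha> fb Pop_mero[OF f] Pop_nz[OF f] in auto)
    also have "\<dots> = Zc (f - fls_const b) r + 2 * Zc \<alpha> r"
      unfolding Zc_def using \<alpha> fb
      by (simp add: Nr_add Nr_cmult locfin_add locfin_cmult locfin_zeros)
    finally have 1: "Zc (Pop n a f) r \<le> Zc (f - fls_const b) r + 2 * Zc \<alpha> r" .
    have "ln (nrm r (Fop n a f)) = ln (absval c) + ln (nrm r \<alpha>)"
      using r \<alpha> c nrm_pos[OF _ \<alpha>, of r] by (simp add: eq nrm_mult nrm_const ln_mult)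
    hence "max 0 (- ln (nrm r (Fop n a f))) \<le> max 0 (- ln (nrm r \<alpha>)) + \<bar>ln (absval c)\<bar>" by simp
    with 1 C1[OF r] C2[OF r] C3[OF r]
    show "real (n + 2) * Tc f r \<le> Tc f r + 2 * Zc \<alpha> r + Nc \<alpha> r + (C1 + C2 + C3 + \<bar>ln (absval c)\<bar>)" by linarith
  qed
qed

subsection \<open>Linearly dependent columns\<close>

text \<open>The Wronskian with first column 1 is, up to x'^2, the derivative of z' / x'. In
  characteristic zero a vanishing derivative means a constant, and this is used twice.\<close>

lemma wr3_zero_affine:
  fixes x z :: "'a :: field_char_0 fls"
  assumes "wr3 1 x z = 0" "fls_deriv x \<noteq> 0"
  obtains k l where "z = fls_const k * x + fls_const l"
proof -
  have "fls_deriv (fls_deriv z / fls_deriv x) = 0"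
    using assms by (simp add: fls_deriv_quotient wr3_1 mult.commute)
  then obtain k where k: "fls_deriv z / fls_deriv x = fls_const k" by (auto simp: fls_deriv_eq_0_iff)
  hence "fls_deriv z = fls_const k * fls_deriv x" using assms(2) by (simp add: field_simps)
  hence "fls_deriv (z - fls_const k * x) = 0" by simp
  then obtain l where "z - fls_const k * x = fls_const l" unfolding fls_deriv_eq_0_iff by blast
  hence "z = fls_const k * x + fls_const l" by (simp add: algebra_simps)
  thus ?thesis using that by blast
qed

text \<open>The Moebius transformation \<open>L\<close> with \<open>\<psi> = L \<circ> \<phi>\<close> fixes \<open>1\<close>. Unless it preserves
  \<open>{0, \<infinity>}\<close>, there is a third value \<open>c\<close> of \<open>\<phi>\<close> which is taken only at zeros or poles of \<open>\<psi>\<close>.\<close>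

lemma dependent_value:
  assumes \<phi>: "nonconst \<phi>" and \<psi>: "nonconst \<psi>"
    and W: "wron \<phi> \<psi> = 0"
    and ne: "\<phi> \<noteq> \<psi>" "\<phi> * \<psi> \<noteq> 1"
  obtains c where "c \<noteq> 0" "\<And>z. omega z (\<phi> - fls_const c) > 0 \<Longrightarrow> omega z \<psi> \<noteq> 0"
proof -
  note m = nonconst_mero[OF \<phi>] nonconst_mero[OF \<psi>]
  have n1: "\<phi> - 1 \<noteq> 0" "\<psi> - 1 \<noteq> 0" using nonconst_neq[OF \<phi>, of 1] nonconst_neq[OF \<psi>, of 1] by auto
  have inv: "inverse x = inverse y \<Longrightarrow> x = y" for x y :: "'a fls" by simp
  have d: "fls_deriv (inverse (\<chi> - 1)) \<noteq> 0" if "nonconst \<chi>" for \<chi> :: "'a fls"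
  proof
    assume "fls_deriv (inverse (\<chi> - 1)) = 0"
    then obtain c where "inverse (\<chi> - 1) = fls_const c" by (auto simp: fls_deriv_eq_0_iff)
    hence "inverse (inverse (\<chi> - 1)) = inverse (fls_const c)" by simp
    hence "\<chi> = fls_const (inverse c + 1)" by (simp add: fls_inverse_const algebra_simps flip: fls_plus_const)
    thus False using nonconst_neq[OF that] by blast
  qed
  obtain k l where kl: "inverse (\<psi> - 1) = fls_const k * inverse (\<phi> - 1) + fls_const l"
    using wr3_zero_affine[OF W d[OF \<phi>]] by metis
  have k: "k \<noteq> 0" using kl d[OF \<psi>] by auto
  have rel: "\<phi> - 1 = (\<psi> - 1) * (fls_const k + fls_const l * (\<phi> - 1))"
  proof -
    define x where "x = \<phi> - 1"
    define z where "z = \<psi> - 1"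
    have xz: "x \<noteq> 0" "z \<noteq> 0" using n1 by (auto simp: x_def z_def)
    have "x * z * inverse z = x * z * (fls_const k * inverse x + fls_const l)"
      using kl by (simp only: x_def z_def)
    also have "\<dots> = z * (fls_const k * (x * inverse x) + fls_const l * x)" by (simp only: algebra_simps)
    also have "x * inverse x = 1" using xz by simp
    also have "x * z * inverse z = x" using xz by simp
    finally have "x = z * (fls_const k + fls_const l * x)" by (simp only: mult_1_right)
    thus ?thesis unfolding x_def z_def .
  qed
  have o1: "omega z (\<phi> - 1) = 0" if "omega z (\<phi> - fls_const c) > 0" "c \<noteq> 1" for c z
    using omega_diff_const_pos[OF \<phi> that(1), of 1] that(2) by simp
  have m1: "mero (\<psi> - 1)" "mero (\<phi> - 1)" using m by auto
  \<comment> \<open>With 1 / (\<psi> - 1) = k / (\<phi> - 1) + l, the value \<infinity> of \<psi>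
    corresponds to \<phi> = 1 - k / l and the value 0 to \<phi> = 1 - k / (1 + l). The first two
    cases say that this value is neither 0 nor \<infinity>; what remains is the identity and the
    inversion.\<close>
  consider "l \<noteq> 0" "k \<noteq> l" | "1 + l \<noteq> 0" "k \<noteq> 1 + l" | "l = 0" "k = 1" | "k = -1" "l = -1"
    by (metis add_0_right add_eq_0_iff add_cancel_right_left zero_neq_one add_0)
  thus ?thesis
  proof cases
    case 1
    define c where "c = 1 - k / l"
    have c: "c \<noteq> 0" "c \<noteq> 1" using 1 k by (auto simp: c_def)
    have "fls_const l * fls_const c = fls_const l - fls_const k"
      using 1 by (simp add: c_def right_diff_distrib flip: fls_minus_const)
    hence "fls_const k + fls_const l * (\<phi> - 1) = fls_const l * (\<phi> - fls_const c)" by (simp add: algebra_simps)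
    hence rel': "\<phi> - 1 = (\<psi> - 1) * (fls_const l * (\<phi> - fls_const c))" using rel by simp
    have nz: "\<phi> - fls_const c \<noteq> 0" "fls_const l \<noteq> 0" using nonconst_neq[OF \<phi>] 1 by auto
    have "omega z \<psi> \<noteq> 0" if "omega z (\<phi> - fls_const c) > 0" for z
    proof -
      have "omega z (\<phi> - 1) = omega z (\<psi> - 1) + omega z (\<phi> - fls_const c)"
        using nz n1 m m1 by (subst rel') (simp add: omega_mult)
      hence "omega z (\<psi> - 1) < 0" using o1[OF that c(2)] that by simp
      thus ?thesis using omega_diff_const(3)[OF m(2) nonconst_nz[OF \<psi>], of z 1] by auto
    qed
    thus ?thesis using that c by blast
  next
    case 2
    define c where "c = 1 - k / (1 + l)"
    have c: "c \<noteq> 0" "c \<noteq> 1" using 2 k by (auto simp: c_def)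
    have cc: "fls_const (1 + l) * fls_const c = fls_const (1 + l) - fls_const k"
      using 2 by (simp add: c_def right_diff_distrib flip: fls_minus_const)
    have "\<psi> * (fls_const k + fls_const l * (\<phi> - 1)) = (\<phi> - 1) + (fls_const k + fls_const l * (\<phi> - 1))"
      using rel by (simp add: algebra_simps)
    also have "\<dots> = fls_const (1 + l) * \<phi> - (fls_const (1 + l) - fls_const k)"
      by (simp add: algebra_simps flip: fls_plus_const)
    also have "\<dots> = fls_const (1 + l) * (\<phi> - fls_const c)" by (simp only: right_diff_distrib cc)
    finally have e: "\<psi> * (fls_const k + fls_const l * (\<phi> - 1)) = fls_const (1 + l) * (\<phi> - fls_const c)" .
    have "\<psi> * (\<phi> - 1) = \<psi> * ((\<psi> - 1) * (fls_const k + fls_const l * (\<phi> - 1)))"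
      by (simp only: rel[symmetric])
    also have "\<dots> = \<psi> * (fls_const k + fls_const l * (\<phi> - 1)) * (\<psi> - 1)" by (simp only: mult_ac)
    finally have rel': "\<psi> * (\<phi> - 1) = fls_const (1 + l) * (\<phi> - fls_const c) * (\<psi> - 1)"
      unfolding e .
    have nz: "\<phi> - fls_const c \<noteq> 0" "fls_const (1 + l) \<noteq> 0" using nonconst_neq[OF \<phi>] 2 by auto
    have "omega z \<psi> \<noteq> 0" if "omega z (\<phi> - fls_const c) > 0" for z
    proof
      assume z: "omega z \<psi> = 0"
      have "omega z (\<psi> * (\<phi> - 1)) = omega z \<psi> + omega z (\<phi> - 1)"
        using n1 m m1 nonconst_nz[OF \<psi>] by (intro omega_mult) auto
      moreover have "omega z (fls_const (1 + l) * (\<phi> - fls_const c) * (\<psi> - 1)) = omega z (\<phi> - fls_const c) + omega z (\<psi> - 1)"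
        using nz n1 m m1 by (simp only: omega_mult mero_mult mero_const mero_diff no_zero_divisors not_False_eq_True omega_const)
      ultimately have "omega z (\<psi> - 1) < 0" using rel' z o1[OF that c(2)] that by simp
      thus False using omega_diff_const(3)[OF m(2) nonconst_nz[OF \<psi>], of z 1] z by auto
    qed
    thus ?thesis using that c by blast
  next
    case 3
    hence "\<phi> = \<psi>" using rel by simp
    thus ?thesis using ne by simp
  next
    case 4
    hence "fls_const k = - 1" "fls_const l = - 1" by simp_all
    hence "\<phi> - 1 = (\<psi> - 1) * (- 1 + - 1 * (\<phi> - 1))" using rel by (simp only:)
    hence "\<phi> * \<psi> = 1" by (simp add: algebra_simps)
    thus ?thesis using ne by simp
  qed
qed

text \<open>The second main theorem for \<phi> and the values 0, \<infinity>, c, in which c-points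
  are counted as zeros and poles of \<psi>. The truncation at 1 lowers the coefficient of T(f) to 5,
  and 5 + 7 = 12 stays below n + 2.\<close>

lemma degenerate_ineq:
  assumes f: "nonconst f" and g: "nonconst g" and \<alpha>: "mero \<alpha>" "\<alpha> \<noteq> 0"
    and a: "a \<noteq> 0" and n: "n \<ge> 11"
    and \<phi>: "nonconst (Fop n a f / \<alpha>)" and \<psi>: "nonconst (Fop n a g / \<alpha>)"
    and W: "wron (Fop n a f / \<alpha>) (Fop n a g / \<alpha>) = 0"
    and ne: "Fop n a f \<noteq> Fop n a g" "Fop n a f * Fop n a g \<noteq> \<alpha> ^ 2"
  shows "lebd (\<lambda>r. real (n + 2) * Tc f r)
    (\<lambda>r. 5 * Tc f r + 7 * Tc g r - 2 * ln r + err \<alpha> r)"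
proof -
  define \<phi> where "\<phi> = Fop n a f / \<alpha>"
  define \<psi> where "\<psi> = Fop n a g / \<alpha>"
  have \<phi>: "nonconst \<phi>" and \<psi>: "nonconst \<psi>" using \<phi> \<psi> by (auto simp: \<phi>_def \<psi>_def)
  note m = nonconst_mero[OF \<phi>] nonconst_nz[OF \<phi>] nonconst_deriv[OF \<phi>]
  have "\<phi> \<noteq> \<psi>" "\<phi> * \<psi> \<noteq> 1" using ne \<alpha> by (auto simp: \<phi>_def \<psi>_def power2_eq_square)
  then obtain c where c: "c \<noteq> 0" "\<And>z. omega z (\<phi> - fls_const c) > 0 \<Longrightarrow> omega z \<psi> \<noteq> 0"
    using dependent_value[OF \<phi> \<psi>] W unfolding \<phi>_def \<psi>_def by metis
  have om: "omega z \<phi> = omega z (Fop n a f) - omega z \<alpha>" "omega z \<psi> = omega z (Fop n a g) - omega z \<alpha>" for z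
    using \<alpha> Fop_mero[OF f] Fop_mero[OF g] Fop_nz[OF f] Fop_nz[OF g] by (auto simp: \<phi>_def \<psi>_def omega_divide)
  have mc: "mero (\<phi> - fls_const c)" "\<phi> - fls_const c \<noteq> 0" using m nonconst_neq[OF \<phi>] by auto
  define \<Theta> where "\<Theta> = (\<phi> - fls_const c) / fls_deriv \<phi>"
  have \<Theta>: "mero \<Theta>" "\<Theta> \<noteq> 0" using m mc by (auto simp: \<Theta>_def)
  have "lebd (\<lambda>r. real (n + 2) * Tc f r)
    (\<lambda>r. (of_int 2 + 3) * Tc f r + 7 * Tc g r - (1 + 1) * ln r + err \<alpha> r)"
  proof (rule Fop_ineq[OF f g \<alpha> a \<Theta>])
    fix z
    note Lf = Fop_local[OF f a n, of z] and Lg = Fop_local[OF g a n, of z]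
    have t: "omega z \<Theta> = omega z (\<phi> - fls_const c) - omega z (fls_deriv \<phi>)"
      unfolding \<Theta>_def using m mc by (intro omega_divide) auto
    have \<Theta>le: "omega z \<Theta> \<le> min 1 \<bar>omega z \<phi>\<bar> + min 1 \<bar>omega z \<psi>\<bar> - max 0 (omega z \<phi>)"
      using t c omega_diff_const[OF m(1,2), of z c] omega_deriv(2)[OF m(1,2), of z]
        omega_deriv_diff_const[OF \<phi>, of z c] omega_deriv_ge0[OF m, of z]
      by (cases "omega z \<phi>" "0::int" rule: linorder_cases; cases "omega z (\<phi> - fls_const c) > 0") force+
    have F: "max 0 (omega z (Pop n a f)) + min 1 \<bar>omega z \<phi>\<bar> - max 0 (omega z \<phi>)
         \<le> 2 * max 0 (omega z f) + max 0 (omega z (f - fls_const (bval n a))) + 2 * max 0 (- omega z f) + max 0 (omega z \<alpha>)"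
      using Lf(3) by (intro order_quotient_bound_pos[OF om(1) Lf(2)]) auto
    have G: "min 1 \<bar>omega z \<psi>\<bar> \<le> 2 * max 0 (omega z g) + max 0 (omega z (g - fls_const a)) + max 0 (omega z (fls_deriv g / g))
        + 2 * max 0 (- omega z g) + max 0 (omega z \<alpha>) + max 0 (- omega z \<alpha>)"
      using Lg(3) by (intro order_quotient_bound[OF om(2) Lg(4)]) auto
    show "max 0 (omega z (Pop n a f)) + omega z \<Theta> \<le>
      local_bound 2 n a f g \<alpha> z"
      using \<Theta>le F G unfolding local_bound_def by linarith
  next
    show "lebd (\<lambda>r. 1 * ln r + max 0 (- ln (nrm r (Fop n a f / \<alpha>)))) (\<lambda>r. ln (nrm r \<Theta>))"
      unfolding \<phi>_def[symmetric]
    proof (rule lebdI)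
      fix r :: real assume "r \<ge> 1"
      hence r: "r > 0" by simp
      have pos: "nrm r \<phi> > 0" "nrm r (\<phi> - fls_const c) > 0" "nrm r (fls_deriv \<phi>) > 0" "absval c > 0"
        using r m mc c by (auto intro!: nrm_pos)
      have t: "ln (nrm r \<Theta>) = ln (nrm r (\<phi> - fls_const c)) - ln (nrm r (fls_deriv \<phi>))"
        using m mc r pos by (simp add: \<Theta>_def nrm_divide ln_div)
      have 1: "ln (nrm r (fls_deriv \<phi>)) \<le> ln (nrm r \<phi>) - ln r" using nrm_log_deriv[OF m r] .
      have 2: "ln (nrm r (fls_deriv \<phi>)) \<le> ln (nrm r (\<phi> - fls_const c)) - ln r"
        using nrm_log_deriv[OF mc _ r] m(3) by simp
      show "1 * ln r + max 0 (- ln (nrm r \<phi>)) \<le> ln (nrm r \<Theta>) + \<bar>ln (absval c)\<bar>"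
      \<comment> \<open>For small \<phi> the factor \<phi> - c has norm |c|, and |\<phi>'|_r \<le>
        |\<phi>|_r / r supplies - ln |\<phi>|_r. Otherwise - ln |\<phi>|_r is bounded above.\<close>
      proof (cases "nrm r \<phi> < absval c")
        case True
        have "nrm r (fls_const (- c) + \<phi>) = nrm r (fls_const (- c))"
          using True m r nrm_const[OF r, of "-c"] by (intro nrm_add_eq) auto
        hence "nrm r (\<phi> - fls_const c) = absval c" using nrm_const[OF r, of "-c"] by simp
        thus ?thesis using t 1 2 by auto
      next
        case False
        hence "ln (absval c) \<le> ln (nrm r \<phi>)" using c(1) by (intro ln_mono) auto
        thus ?thesis using t 2 by auto
      qed
    qed
  qed simp
  thus ?thesis by simp
qed

subsection \<open>The second main theorem for three values\<close>

context
  fixes h :: "'a :: {ultrametric_field, complete_space, alg_closed_field, field_char_0} fls" and c :: 'a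
  assumes h: "nonconst h" and c: "c \<noteq> 0"
begin

text \<open>The order of h (h - c) / h' with the poles of h added: the points over 0, c, \<infinity>
  count 1 each, and ramification over all other values is subtracted.\<close>

definition smt_div :: "'a \<Rightarrow> int" where
  "smt_div z = omega z h + omega z (h - fls_const c) - omega z (fls_deriv h) + max 0 (- omega z h)"

lemma smt_local:
  "smt_div z \<le> 1"
  "omega z h = 0 \<Longrightarrow> omega z (h - fls_const c) = 0 \<Longrightarrow> smt_div z = - omega z (fls_deriv h)"
  "omega z h = 0 \<Longrightarrow> omega z (h - fls_const c) = 0 \<Longrightarrow> smt_div z \<le> 0"
proof -
  note m = nonconst_mero[OF h] nonconst_nz[OF h] nonconst_deriv[OF h]
  note * = omega_diff_const[OF m(1,2), of z c] omega_deriv(2)[OF m(1,2), of z]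
        omega_deriv_diff_const[OF h, of z c] omega_deriv_ge0[OF m, of z]
  show "smt_div z \<le> 1" using * c unfolding smt_div_def
    by (cases "omega z h" "0::int" rule: linorder_cases; cases "omega z (h - fls_const c) > 0") force+
  show "omega z h = 0 \<Longrightarrow> omega z (h - fls_const c) = 0 \<Longrightarrow> smt_div z = - omega z (fls_deriv h)"
    by (simp add: smt_div_def)
  show "omega z h = 0 \<Longrightarrow> omega z (h - fls_const c) = 0 \<Longrightarrow> smt_div z \<le> 0"
    using *(6) by (simp add: smt_div_def)
qed

lemma smt_locfin: "locfin smt_div"
proof -
  note m = nonconst_mero[OF h] nonconst_nz[OF h] nonconst_deriv[OF h]
  have "mero (h - fls_const c)" "h - fls_const c \<noteq> 0" using m nonconst_neq[OF h] by auto
  thus ?thesis unfolding smt_div_def[abs_def] using m by (intro locfin_add locfin_diff locfin_omega locfin_poles) auto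
qed

text \<open>Since |h'|_r is at most both |h|_r / r and |h - c|_r / r, the norm of h (h - c) / h' is
  at least the larger of |h|_r and |h - c|_r, which is never below |c|. Jensen's formula does the
  rest.\<close>

lemma smt: "lebd (Tc h) (Nr smt_div)"
proof -
  note m = nonconst_mero[OF h] nonconst_nz[OF h] nonconst_deriv[OF h]
  have mc: "mero (h - fls_const c)" "h - fls_const c \<noteq> 0" using m nonconst_neq[OF h] by auto
  define \<Theta> where "\<Theta> = h * (h - fls_const c) / fls_deriv h"
  have \<Theta>: "mero \<Theta>" "\<Theta> \<noteq> 0" using m mc by (auto simp: \<Theta>_def)
  have om: "smt_div = (\<lambda>z. omega z \<Theta> + max 0 (- omega z h))"
    using m mc by (auto simp: smt_div_def \<Theta>_def omega_mult omega_divide)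
  obtain C where C: "\<forall>r>0. ln (nrm r \<Theta>) = Nr (\<lambda>z. omega z \<Theta>) r + C" using jensen(2)[OF \<Theta>] by blast
  show ?thesis
  proof (rule lebdI)
    fix r :: real assume r1: "r \<ge> 1"
    hence r: "r > 0" by simp
    have pos: "nrm r h > 0" "nrm r (h - fls_const c) > 0" "nrm r (fls_deriv h) > 0" "absval c > 0"
      using r m mc c by (auto intro!: nrm_pos)
    have N: "Nr smt_div r = Nr (\<lambda>z. omega z \<Theta>) r + Nc h r"
      unfolding om Nc_def using \<Theta> m by (intro Nr_add) auto
    have "ln (nrm r \<Theta>) = ln (nrm r h) + ln (nrm r (h - fls_const c)) - ln (nrm r (fls_deriv h))"
      using m mc r pos by (simp add: \<Theta>_def nrm_divide nrm_mult ln_div ln_mult)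
    moreover have "ln (nrm r (fls_deriv h)) \<le> ln (nrm r h) - ln r" using nrm_log_deriv[OF m r] .
    moreover have "ln (nrm r (fls_deriv h)) \<le> ln (nrm r (h - fls_const c)) - ln r"
      using nrm_log_deriv[OF mc _ r] m(3) by simp
    moreover have "ln r \<ge> 0" using r1 by simp
    moreover have "ln (absval c) \<le> max (ln (nrm r h)) (ln (nrm r (h - fls_const c)))"
    proof -
      have "nrm r (h - (h - fls_const c)) \<le> max (nrm r h) (nrm r (h - fls_const c))"
        using m mc r by (intro nrm_diff) auto
      hence "absval c \<le> max (nrm r h) (nrm r (h - fls_const c))" using nrm_const[OF r, of c] by simp
      thus ?thesis using pos by (auto simp: max_def split: if_splits)
    qed
    moreover have "ln (nrm r \<Theta>) = Nr (\<lambda>z. omega z \<Theta>) r + C" using C r by simp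
    ultimately show "Tc h r \<le> Nr smt_div r + (\<bar>ln (absval c)\<bar> + \<bar>C\<bar>)"
      using N unfolding Tc_def by linarith
  qed
qed

end

text \<open>Where \<alpha> has neither zero nor pole, F G = \<alpha>^2 matches a zero of F with a
  pole of G of order (n + 2) M + 1. So a zero of f or f - a at that point has order at least 8,
  enough for the factor 4 since s + 1 \<le> 2.\<close>

lemma recip_local:
  fixes f :: "'a :: {ultrametric_field, complete_space, alg_closed_field, field_char_0} fls" and z a :: 'a and n :: nat
  assumes f: "nonconst f" and a: "a \<noteq> 0" and n: "n \<ge> 11"
  defines "y \<equiv> omega z (Fop n a f)" and "s \<equiv> smt_div f a z"
    and "q \<equiv> max 0 (omega z f) + max 0 (omega z (f - fls_const a))"
  shows "y = 0 \<Longrightarrow> s \<le> 0"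
    and "y < 0 \<Longrightarrow> \<exists>M\<ge>1. - y = int (n + 2) * M + 1"
    and "y = int (n + 2) * M + 1 \<Longrightarrow> M \<ge> 1 \<Longrightarrow> 4 * (s + 1) \<le> q"
proof -
  note c = omega_Fop_Pop_cases[OF f a, of z n, folded y_def]
  note s = smt_local[OF f a, of z, folded s_def]
  have l: "omega z (fls_deriv f / f) = omega z (fls_deriv f) - omega z f"
    by (rule omega_log_deriv[OF nonconst_mero[OF f] nonconst_nz[OF f] nonconst_deriv[OF f]])
  have 1: "int (n + 1) * omega z f \<ge> 12 * omega z f" if "omega z f > 0" using that n by (intro mult_right_mono) auto
  have 2: "int (n + 2) * omega z f \<le> 13 * omega z f" if "omega z f < 0" using that n by (intro mult_right_mono_neg) auto
  show "y = 0 \<Longrightarrow> s \<le> 0" using c s 1 2 by presburger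
  show "\<exists>M\<ge>1. - y = int (n + 2) * M + 1" if "y < 0"
  proof -
    have "omega z f < 0 \<and> y = int (n + 2) * omega z f - 1" using c 1 2 that by linarith
    thus ?thesis by (intro exI[of _ "- omega z f"]) (auto simp: algebra_simps)
  qed
  assume M: "y = int (n + 2) * M + 1" "M \<ge> 1"
  have 3: "int (n + 2) * M \<ge> 13 * M" using M n by (intro mult_right_mono) auto
  have zero_order: "omega z f \<ge> 8" if "omega z f > 0" "y = int (n + 1) * omega z f - 1"
  proof -
    \<comment> \<open>Equating (n + 1) m - 1 with (n + 2) M + 1. The left side is a positive
      multiple of n + 1 \<ge> 12, which makes M, and then m > M, large.\<close>
    have e: "int (n + 1) * (omega z f - M) = M + 2" using M that by (simp add: algebra_simps)
    have "omega z f - M > 0"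
    proof (rule ccontr)
      assume "\<not> omega z f - M > 0"
      hence "int (n + 1) * (omega z f - M) \<le> 0" by (intro mult_nonneg_nonpos) auto
      thus False using e M by linarith
    qed
    moreover from this have "int (n + 1) * (omega z f - M) \<ge> 12 * (omega z f - M)" using n by (intro mult_right_mono) auto
    hence "12 * (omega z f - M) \<le> M + 2" unfolding e .
    ultimately show ?thesis by presburger
  qed
  have y: "y \<ge> 14" using 3 M by linarith
  consider (zero) "omega z f > 0" "y = int (n + 1) * omega z f - 1"
    | (pole) "omega z f < 0" "y = int (n + 2) * omega z f - 1"
    | (val) "omega z f = 0" "y = 2 * omega z (f - fls_const a) - 1"
    | (other) "omega z f = 0" "omega z (f - fls_const a) = 0" "y = omega z (fls_deriv f / f)"
    using c by (elim disjE conjE) force+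
  thus "4 * (s + 1) \<le> q"
  proof cases
    case zero
    thus ?thesis using zero_order s(1) unfolding q_def by simp
  next
    case pole
    thus ?thesis using 2[OF pole(1)] y by linarith
  next
    case val
    thus ?thesis using y s(1) unfolding q_def by simp
  next
    case other
    thus ?thesis using y s(2) l unfolding q_def by simp
  qed
qed

text \<open>Four times the second main theorem for f and g is balanced against Z(f) + Z(f - a) \<le>
  2 T(f) and the same for g, so half of the left side survives. At zeros and poles of \<alpha> the
  trivial bound 1 for each \<open>smt_div\<close> is charged to \<alpha>.\<close>

lemma reciprocal_ineq:
  assumes f: "nonconst f" and g: "nonconst g" and \<alpha>: "mero \<alpha>" "\<alpha> \<noteq> 0"
    and a: "a \<noteq> 0" and n: "n \<ge> 11"
    and eq: "Fop n a f * Fop n a g = \<alpha> ^ 2"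
  shows "lebd (\<lambda>r. Tc f r + Tc g r) (\<lambda>r. 4 * (Zc \<alpha> r + Nc \<alpha> r))"
proof -
  note fm = nonconst_mero[OF f] nonconst_nz[OF f] nonconst_neq[OF f]
  note gm = nonconst_mero[OF g] nonconst_nz[OF g] nonconst_neq[OF g]
  have fa: "mero (f - fls_const a)" "f - fls_const a \<noteq> 0" using fm by auto
  have ga: "mero (g - fls_const a)" "g - fls_const a \<noteq> 0" using gm by auto
  have om: "omega z (Fop n a f) + omega z (Fop n a g) = 2 * omega z \<alpha>" for z
  proof -
    have "omega z (Fop n a f * Fop n a g) = omega z (Fop n a f) + omega z (Fop n a g)"
      using Fop_mero[OF f] Fop_mero[OF g] Fop_nz[OF f] Fop_nz[OF g] by (intro omega_mult) auto
    thus ?thesis using eq \<alpha> by (simp add: omega_power)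
  qed
  have loc: "4 * (smt_div f a z + smt_div g a z) \<le>
     (max 0 (omega z f) + max 0 (omega z (f - fls_const a))) + (max 0 (omega z g) + max 0 (omega z (g - fls_const a)))
      + 8 * (max 0 (omega z \<alpha>) + max 0 (- omega z \<alpha>))" for z
  proof (cases "omega z \<alpha> = 0")
    case False
    hence "max 0 (omega z \<alpha>) + max 0 (- omega z \<alpha>) \<ge> 1" by simp
    hence "8 \<le> 8 * (max 0 (omega z \<alpha>) + max 0 (- omega z \<alpha>))" by simp
    moreover have "4 * (smt_div f a z + smt_div g a z) \<le> 8"
      using smt_local(1)[OF f a, of z] smt_local(1)[OF g a, of z] by simp
    ultimately have "4 * (smt_div f a z + smt_div g a z) \<le> 8 * (max 0 (omega z \<alpha>) + max 0 (- omega z \<alpha>))"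
      by (rule order_trans[rotated])
    thus ?thesis by (rule order_trans) simp
  next
    case True
    hence y: "omega z (Fop n a g) = - omega z (Fop n a f)" using om[of z] by simp
    note Lf = recip_local[OF f a n, of z] and Lg = recip_local[OF g a n, of z]
    consider "omega z (Fop n a f) = 0" | "omega z (Fop n a f) < 0" | "omega z (Fop n a g) < 0" using y by linarith
    thus ?thesis
    proof cases
      case 1
      hence "4 * (smt_div f a z + smt_div g a z) \<le> 0" using Lf(1) Lg(1) y by simp
      thus ?thesis by (rule order_trans) simp
    next
      case 2
      then obtain M where "M \<ge> 1" "omega z (Fop n a g) = int (n + 2) * M + 1" using Lf(2) y by auto
      note Lg(3)[OF this(2,1)]
      moreover have "4 * (smt_div f a z + smt_div g a z) \<le> 4 * (smt_div g a z + 1)"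
        using smt_local(1)[OF f a, of z] by simp
      ultimately have "4 * (smt_div f a z + smt_div g a z) \<le> max 0 (omega z g) + max 0 (omega z (g - fls_const a))"
        by (rule order_trans[rotated])
      thus ?thesis by (rule order_trans) simp
    next
      case 3
      then obtain M where "M \<ge> 1" "omega z (Fop n a f) = int (n + 2) * M + 1" using Lg(2) y by auto
      note Lf(3)[OF this(2,1)]
      moreover have "4 * (smt_div f a z + smt_div g a z) \<le> 4 * (smt_div f a z + 1)"
        using smt_local(1)[OF g a, of z] by simp
      ultimately have "4 * (smt_div f a z + smt_div g a z) \<le> max 0 (omega z f) + max 0 (omega z (f - fls_const a))"
        by (rule order_trans[rotated])
      thus ?thesis by (rule order_trans) simp
    qed
  qed
  obtain C1 where C1: "\<And>r. r \<ge> 1 \<Longrightarrow> Tc f r \<le> Nr (smt_div f a) r + C1" using smt[OF f a] unfolding lebd_def by blast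
  obtain C2 where C2: "\<And>r. r \<ge> 1 \<Longrightarrow> Tc g r \<le> Nr (smt_div g a) r + C2" using smt[OF g a] unfolding lebd_def by blast
  obtain C3 where C3: "\<And>r. r \<ge> 1 \<Longrightarrow> Zc f r \<le> Tc f r + C3" "\<And>r. r \<ge> 1 \<Longrightarrow> Zc (f - fls_const a) r \<le> Tc f r + C3"
    "\<And>r. Nc f r \<le> Tc f r" using counting_bounds[OF f, of a] by blast
  obtain C5 where C5: "\<And>r. r \<ge> 1 \<Longrightarrow> Zc g r \<le> Tc g r + C5" "\<And>r. r \<ge> 1 \<Longrightarrow> Zc (g - fls_const a) r \<le> Tc g r + C5"
    "\<And>r. Nc g r \<le> Tc g r" using counting_bounds[OF g, of a] by blast
  show ?thesis
  proof (rule lebdI)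
    fix r :: real assume r: "r \<ge> 1"
    have "4 * (Nr (smt_div f a) r + Nr (smt_div g a) r) = Nr (\<lambda>z. 4 * (smt_div f a z + smt_div g a z)) r"
      using smt_locfin[OF f a] smt_locfin[OF g a] by (simp add: Nr_add Nr_cmult locfin_cmult)
    also have "\<dots> \<le> Nr (\<lambda>z. (max 0 (omega z f) + max 0 (omega z (f - fls_const a))) + (max 0 (omega z g) + max 0 (omega z (g - fls_const a)))
      + 8 * (max 0 (omega z \<alpha>) + max 0 (- omega z \<alpha>))) r"
      using loc r smt_locfin[OF f a] smt_locfin[OF g a] fm gm fa ga \<alpha>
      by (intro Nr_mono locfin_add locfin_cmult) auto
    also have "\<dots> = (Zc f r + Zc (f - fls_const a) r) + (Zc g r + Zc (g - fls_const a) r) + 8 * (Zc \<alpha> r + Nc \<alpha> r)"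
      unfolding Zc_def Nc_def using fm gm fa ga \<alpha>
      by (simp add: Nr_add Nr_cmult locfin_add locfin_cmult locfin_zeros locfin_poles)
    finally show "Tc f r + Tc g r \<le> 4 * (Zc \<alpha> r + Nc \<alpha> r) + (2 * C1 + 2 * C2 + C3 + C5)"
      using C1[OF r] C2[OF r] C3(1,2)[OF r] C5(1,2)[OF r] by (simp add: algebra_simps)
  qed
qed

subsection \<open>Equal differential monomials\<close>

lemma Pop_nonconst:
  assumes "nonconst f"
  shows "nonconst (Pop n a f)"
  unfolding nonconst_def
proof (intro conjI allI notI)
  show "mero (Pop n a f)" using Pop_mero assms by blast
  fix c assume "Pop n a f = fls_const c"
  hence "fls_deriv (Pop n a f) = 0" by simp
  thus False using Fop_nz[OF assms] by (simp add: deriv_Pop)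
qed

text \<open>The second main theorem for P(f) and the values 0, d, \<infinity>. Truncated zeros of
  P(f) lie over f = 0, b, those of P(f) - d = P(g) over g = 0, b, and the poles are those of f: 3
  T(f) + 2 T(g) in all.\<close>

lemma Pop_diff_const_ineq:
  assumes f: "nonconst f" and g: "nonconst g" and a: "a \<noteq> 0"
    and eq: "Pop n a f - fls_const d = Pop n a g" and d: "d \<noteq> 0"
  shows "lebd (\<lambda>r. real (n + 2) * Tc f r) (\<lambda>r. 3 * Tc f r + 2 * Tc g r)"
proof -
  define b where "b = bval n a"
  note fm = nonconst_mero[OF f] nonconst_nz[OF f] nonconst_neq[OF f]
  note gm = nonconst_mero[OF g] nonconst_nz[OF g] nonconst_neq[OF g]
  have fb: "mero (f - fls_const b)" "f - fls_const b \<noteq> 0" using fm by auto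
  have gb: "mero (g - fls_const b)" "g - fls_const b \<noteq> 0" using gm by auto
  note P = Pop_nonconst[OF f, of n a]
  define s where "s = smt_div (Pop n a f) d"
  have pos: "max 0 (omega z u) + max 0 (omega z (u - fls_const b)) \<ge> 1 \<or> max 0 (- omega z u) \<ge> 1"
    if "omega z (Pop n a u) \<noteq> 0" "nonconst u" for z u
    using omega_Fop_Pop_cases[OF that(2) a, of z n] that(1) unfolding b_def by linarith
  \<comment> \<open>P(f) and P(g) differ by a constant, so f and g have the same poles, and those of
    g need no term of their own.\<close>
  have poles: "max 0 (- omega z f) \<ge> 1" if "max 0 (- omega z g) \<ge> 1" for z
  proof -
    have neg: "omega z (Pop n a u) < 0 \<longleftrightarrow> omega z u < 0" if "nonconst u" for u
    proof -
      have 1: "int (n + 1) * omega z u > 0" if "omega z u > 0" using that by simp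
      have 2: "int (n + 2) * omega z u < 0" if "omega z u < 0" using that by (simp add: mult_pos_neg)
      show ?thesis using omega_Fop_Pop_cases[OF that a, of z n] 1 2 by linarith
    qed
    have "omega z (Pop n a g) < 0" using neg[OF g] that by simp
    hence "omega z (Pop n a f) < 0"
      using omega_diff_const[OF nonconst_mero[OF P] nonconst_nz[OF P], of z d] d unfolding eq by linarith
    thus ?thesis using neg[OF f] by simp
  qed
  have loc: "s z \<le> max 0 (omega z f) + max 0 (omega z (f - fls_const b)) + max 0 (omega z g)
     + max 0 (omega z (g - fls_const b)) + max 0 (- omega z f)" for z
  proof (cases "omega z (Pop n a f) = 0 \<and> omega z (Pop n a g) = 0")
    case True
    thus ?thesis using smt_local(3)[OF P d, of z] eq by (simp add: s_def)
  next
    case False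
    thus ?thesis using smt_local(1)[OF P d, of z] pos[OF _ f, of z] pos[OF _ g, of z] poles[of z]
      unfolding s_def by linarith
  qed
  obtain C0 where C0: "\<And>r. r \<ge> 1 \<Longrightarrow> real (n + 2) * Tc f r \<le> max 0 (ln (nrm r (Pop n a f))) + real (n + 2) * Nc f r + C0"
    using Tc_Pop[OF f a, of n] unfolding lebd_def by blast
  obtain C1 where C1: "\<And>r. r \<ge> 1 \<Longrightarrow> Tc (Pop n a f) r \<le> Nr s r + C1" using smt[OF P d] unfolding s_def unfolding lebd_def by blast
  obtain C3 where C3: "\<And>r. r \<ge> 1 \<Longrightarrow> Zc f r \<le> Tc f r + C3" "\<And>r. r \<ge> 1 \<Longrightarrow> Zc (f - fls_const b) r \<le> Tc f r + C3"
    "\<And>r. Nc f r \<le> Tc f r" using counting_bounds[OF f, of b] by blast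
  obtain C5 where C5: "\<And>r. r \<ge> 1 \<Longrightarrow> Zc g r \<le> Tc g r + C5" "\<And>r. r \<ge> 1 \<Longrightarrow> Zc (g - fls_const b) r \<le> Tc g r + C5"
    "\<And>r. Nc g r \<le> Tc g r" using counting_bounds[OF g, of b] by blast
  show ?thesis
  proof (rule lebdI)
    fix r :: real assume r: "r \<ge> 1"
    have "Nr s r \<le> Nr (\<lambda>z. max 0 (omega z f) + max 0 (omega z (f - fls_const b)) + max 0 (omega z g)
     + max 0 (omega z (g - fls_const b)) + max 0 (- omega z f)) r"
      using loc r smt_locfin[OF P d] fm gm fb gb unfolding s_def by (intro Nr_mono locfin_add) auto
    also have "\<dots> = Zc f r + Zc (f - fls_const b) r + Zc g r + Zc (g - fls_const b) r + Nc f r"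
      unfolding Zc_def Nc_def using fm gm fb gb
      by (simp add: Nr_add locfin_add locfin_zeros locfin_poles)
    finally have "Nr s r \<le> \<dots>" .
    moreover have "Tc (Pop n a f) r = max 0 (ln (nrm r (Pop n a f))) + real (n + 2) * Nc f r"
      using Nc_Pop[OF f a, of n r] by (simp add: Tc_def max.commute)
    ultimately show "real (n + 2) * Tc f r \<le> 3 * Tc f r + 2 * Tc g r + (C0 + C1 + 2 * C3 + 2 * C5)"
      using C0[OF r] C1[OF r] C3(1,2)[OF r] C3(3)[of r] C5(1,2)[OF r] by linarith
  qed
qed

lemma Pop_eq_conclusion:
  assumes f: "nonconst f" and g: "nonconst g" and a: "a \<noteq> 0" and eq: "Pop n a f = Pop n a g"
  shows "f = g \<or> (\<exists>h. mero h \<and>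
     f = fls_const (bval n a) * ((h ^ (n + 1) - 1) / (h ^ (n + 2) - 1)) * h \<and>
     g = fls_const (bval n a) * ((h ^ (n + 1) - 1) / (h ^ (n + 2) - 1)))"
proof -
  define h where "h = f / g"
  have g0: "g \<noteq> 0" using nonconst_nz[OF g] .
  have h0: "h \<noteq> 0" using g0 nonconst_nz[OF f] by (simp add: h_def)
  have hm: "mero h" using nonconst_mero[OF f] nonconst_mero[OF g] by (simp add: h_def)
  have fh: "f = g * h" using g0 by (simp add: h_def)
  define B where "B = fls_const (bval n a)"
  have B: "B \<noteq> 0" using bval_nz[OF a] by (simp add: B_def)
  have "(of_nat (n + 2) :: 'a) \<noteq> 0" by (simp only: of_nat_eq_0_iff)
  hence "f ^ (n + 1) * (f - B) = g ^ (n + 1) * (g - B)"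
    using eq unfolding Pop_def B_def by (simp add: mult.assoc del: of_nat_add of_nat_Suc power_Suc power_add)
  hence "g ^ (n + 1) * (h ^ (n + 1) * (g * h - B)) = g ^ (n + 1) * (g - B)"
    unfolding fh by (simp only: power_mult_distrib mult.assoc)
  hence e: "h ^ (n + 1) * (g * h - B) = g - B" using g0 by simp
  have "g * (h ^ (n + 2) - 1) = B * (h ^ (n + 1) - 1)"
  proof -
    have "g * (h ^ (n + 2) - 1) = h ^ (n + 1) * (g * h - B) - (g - B) + B * (h ^ (n + 1) - 1)"
      by (simp add: algebra_simps)
    thus ?thesis using e by simp
  qed
  note key = this
  show ?thesis
  \<comment> \<open>If the denominator vanishes, \<open>key\<close> makes the numerator vanish too,
    and two consecutive powers equal to 1 leave h = 1.\<close>
  proof (cases "h ^ (n + 2) = 1")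
    case True
    hence "h ^ (n + 1) = 1" using key B by simp
    moreover have "h ^ (n + 2) = h * h ^ (n + 1)" by simp
    ultimately have "h = 1" using True by simp
    thus ?thesis using fh by simp
  next
    case False
    hence "g = B * ((h ^ (n + 1) - 1) / (h ^ (n + 2) - 1))" using key by (simp add: divide_simps del: power_Suc)
    moreover from this have "f = B * ((h ^ (n + 1) - 1) / (h ^ (n + 2) - 1)) * h" using fh by simp
    ultimately show ?thesis using hm unfolding B_def by blast
  qed
qed

subsection \<open>Constants and Moebius functions\<close>

lemma nrm_linear_growth:
  fixes c d :: "'a :: {ultrametric_field, complete_space}"
  assumes "c \<noteq> 0 \<or> d \<noteq> 0"
  defines "A \<equiv> fls_const c * fls_X + fls_const d" and "i \<equiv> if c = 0 then 0 else (1 :: real)"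
  shows "\<exists>C. \<forall>r\<ge>1. \<bar>ln (nrm r A) - i * ln r\<bar> \<le> C"
proof (cases "c = 0")
  case True
  have "\<bar>ln (nrm r A) - i * ln r\<bar> \<le> \<bar>ln (absval d)\<bar>" if "r \<ge> 1" for r
    using that True by (simp add: A_def i_def nrm_const)
  thus ?thesis by blast
next
  case False
  define p where "p = fps_const c * fps_X + fps_const d"
  have A: "A = fps_to_fls p / fps_to_fls 1" by (simp add: A_def p_def fls_times_fps_to_fls)
  have p: "entire p" by (rule entire_finite[of 2]) (simp add: p_def)
  have g: "gterm r p n = (if n = 0 then absval d else if n = 1 then absval c * r else 0)" for r n
    by (auto simp: gterm_def p_def)
  define M where "M = max (absval c) (absval d)"
  have M: "M > 0" "absval c \<le> M" "absval d \<le> M" using False by (auto simp: M_def less_max_iff_disj)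
  have "\<bar>ln (nrm r A) - i * ln r\<bar> \<le> \<bar>ln (absval c)\<bar> + \<bar>ln M\<bar>" if "r \<ge> 1" for r
  proof -
    have r: "r > 0" using that by simp
    have nA: "nrm r A = gauss r p"
      unfolding A using nrm_eq[OF p entire_1 _ r] gauss_const[OF r, of "1::'a"] by simp
    have "absval c * r \<le> gauss r p" using gterm_le_gauss[OF p r, of 1] by (simp add: g)
    hence 1: "ln (absval c * r) \<le> ln (nrm r A)" unfolding nA using False r by (intro ln_mono) auto
    have "gauss r p \<le> M * r"
    proof (rule gauss_le[OF p r])
      fix n
      have "absval d * 1 \<le> M * r" using that M absval_nonneg[of d] by (intro mult_mono) auto
      moreover have "absval c * r \<le> M * r" using r M by (intro mult_right_mono) auto
      ultimately show "gterm r p n \<le> M * r" using M r by (auto simp: g)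
    qed
    moreover have "gauss r p > 0" using \<open>absval c * r \<le> gauss r p\<close> False r
      by (meson absval_pos less_le_trans mult_pos_pos)
    ultimately have 2: "ln (nrm r A) \<le> ln (M * r)" unfolding nA by (intro ln_mono) auto
    have "ln (absval c * r) = ln (absval c) + ln r" using False r by (simp add: ln_mult)
    moreover have "ln (M * r) = ln M + ln r" using M r by (simp add: ln_mult)
    ultimately show ?thesis using 1 2 False by (auto simp: i_def)
  qed
  thus ?thesis by blast
qed

text \<open>With i and j the degrees of numerator and denominator, the error grows like (2 i + j +
  max 0 (j - i)) ln r. For i, j in {0, 1} the coefficient is at most 3, attained at i = j =
  1.\<close>

lemma special_error:
  fixes \<alpha> :: "'a :: {ultrametric_field, complete_space, alg_closed_field} fls"
  assumes "(\<exists>b. b \<noteq> 0 \<and> \<alpha> = fls_const b) \<or> moebius_fun \<alpha>"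
  shows "lebd (err \<alpha>) (\<lambda>r. 3 * ln r)"
  using assms
proof
  assume "\<exists>b. b \<noteq> 0 \<and> \<alpha> = fls_const b"
  then obtain b where b: "\<alpha> = fls_const b" by blast
  have "err \<alpha> r \<le> 3 * ln r + \<bar>ln (absval b)\<bar>" if "r \<ge> 1" for r
  proof -
    have "Zc \<alpha> r = 0" "Nc \<alpha> r = 0" by (simp_all add: b Zc_def Nc_def Nr_def)
    moreover have "nrm r \<alpha> = absval b" using that by (simp add: b nrm_const)
    moreover have "ln r \<ge> 0" using that by simp
    ultimately show ?thesis by (simp add: err_def)
  qed
  thus ?thesis by (rule lebdI)
next
  assume "moebius_fun \<alpha>"
  then obtain c d e h where cd: "c * h - d * e \<noteq> 0"
    and \<alpha>: "\<alpha> = (fls_const c * fls_X + fls_const d) / (fls_const e * fls_X + fls_const h)"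
    unfolding moebius_fun_def by blast
  have nz0: "c \<noteq> 0 \<or> d \<noteq> 0" "e \<noteq> 0 \<or> h \<noteq> 0" using cd by auto
  define A where "A = fls_const c * fls_X + fls_const d"
  define B where "B = fls_const e * fls_X + fls_const h"
  have AB: "\<alpha> = A / B" by (simp add: \<alpha> A_def B_def)
  have lin: "entire (fps_const x * fps_X + fps_const y)" for x y :: 'a
    by (rule entire_finite[of 2]) simp
  have fps: "A = fps_to_fls (fps_const c * fps_X + fps_const d)" "B = fps_to_fls (fps_const e * fps_X + fps_const h)"
    by (simp_all add: A_def B_def fls_times_fps_to_fls)
  have nz: "A \<noteq> 0" "B \<noteq> 0"
  proof -
    have "fps_const x * fps_X + fps_const y \<noteq> 0" if "x \<noteq> 0 \<or> y \<noteq> 0" for x y :: 'a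
    proof
      assume "fps_const x * fps_X + fps_const y = 0"
      hence "fps_nth (fps_const x * fps_X + fps_const y) 0 = 0" "fps_nth (fps_const x * fps_X + fps_const y) 1 = 0" by simp_all
      thus False using that by simp
    qed
    thus "A \<noteq> 0" "B \<noteq> 0" using nz0 unfolding fps by (auto simp del: fps_to_fls_plus)
  qed
  have m: "mero A" "mero B" unfolding fps using lin by (intro mero_fps; simp)+
  have om: "omega z \<alpha> = omega z A - omega z B" "omega z A \<ge> 0" "omega z B \<ge> 0" for z
    using m nz omega_entire(1)[OF lin] by (auto simp: AB omega_divide fps simp del: fps_to_fls_plus)
  define i where "i = (if c = 0 then 0 else (1 :: real))"
  define j where "j = (if e = 0 then 0 else (1 :: real))"
  obtain C1 where C1: "\<And>r. r \<ge> 1 \<Longrightarrow> \<bar>ln (nrm r A) - i * ln r\<bar> \<le> C1"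
    using nrm_linear_growth[of c d] nz0(1) unfolding A_def i_def by blast
  obtain C2 where C2: "\<And>r. r \<ge> 1 \<Longrightarrow> \<bar>ln (nrm r B) - j * ln r\<bar> \<le> C2"
    using nrm_linear_growth[of e h] nz0(2) unfolding B_def j_def by blast
  obtain C3 where C3: "\<forall>r>0. ln (nrm r A) = Nr (\<lambda>z. omega z A) r + C3" using jensen(2)[OF m(1) nz(1)] by blast
  obtain C4 where C4: "\<forall>r>0. ln (nrm r B) = Nr (\<lambda>z. omega z B) r + C4" using jensen(2)[OF m(2) nz(2)] by blast
  show ?thesis
  proof (rule lebdI)
    fix r :: real assume r: "r \<ge> 1"
    have lf: "locfin (\<lambda>z. omega z A)" "locfin (\<lambda>z. omega z B)" "locfin (\<lambda>z. omega z \<alpha>)"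
      using m nz by (auto simp: AB)
    have 1: "Zc \<alpha> r \<le> Nr (\<lambda>z. omega z A) r"
      unfolding Zc_def using lf om r by (intro Nr_mono locfin_max0) auto
    have 2: "Nc \<alpha> r \<le> Nr (\<lambda>z. omega z B) r"
      unfolding Nc_def using lf om r by (intro Nr_mono locfin_max0 locfin_uminus) auto
    have 3: "Nr (\<lambda>z. omega z A) r \<le> i * ln r + (C1 - C3)" "Nr (\<lambda>z. omega z B) r \<le> j * ln r + (C2 - C4)"
      using C1[OF r] C2[OF r] C3 C4 r by (auto simp: abs_le_iff)
    have "nrm r \<alpha> = nrm r A / nrm r B" using m r by (simp add: AB nrm_divide)
    hence 4: "- ln (nrm r \<alpha>) = ln (nrm r B) - ln (nrm r A)"
      using m nz r nrm_pos[of r A] nrm_pos[of r B] by (simp add: ln_div)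
    have lr: "ln r \<ge> 0" using r by simp
    have "j * ln r - i * ln r \<le> max 0 (j - i) * ln r"
      using lr by (auto simp: i_def j_def)
    hence 5: "max 0 (- ln (nrm r \<alpha>)) \<le> max 0 (j - i) * ln r + (C1 + C2)"
      using 4 C1[OF r] C2[OF r] lr unfolding abs_le_iff by (auto simp: i_def j_def)
    have "2 * (i * ln r) + j * ln r + max 0 (j - i) * ln r \<le> 3 * ln r"
      using lr by (auto simp: i_def j_def)
    with 1 2 3 5 show "err \<alpha> r \<le> 3 * ln r + (2 * (C1 - C3) + (C2 - C4) + (C1 + C2))"
      unfolding right_diff_distrib err_def by linarith
  qed
qed

subsection \<open>Differential monomials sharing a small function\<close>

lemma growth_absurd:
  fixes S E :: "real \<Rightarrow> real"
  assumes S: "filterlim S at_top at_top" and M: "M \<ge> 0" and le: "lebd S (\<lambda>r. M * E r)"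
    and small: "\<And>\<epsilon>. \<epsilon> > 0 \<Longrightarrow> \<forall>\<^sub>F r in at_top. E r \<le> \<epsilon> * S r"
  shows False
proof -
  obtain C where C: "\<And>r. r \<ge> 1 \<Longrightarrow> S r \<le> M * E r + C" using le unfolding lebd_def by blast
  \<comment> \<open>Chosen so that M \<epsilon> \<le> 1 / 2: then S is at most S / 2 + C, hence
    bounded.\<close>
  define \<epsilon> where "\<epsilon> = 1 / (2 * (M + 1))"
  have \<epsilon>: "\<epsilon> > 0" "M * \<epsilon> \<le> 1 / 2" using M by (auto simp: \<epsilon>_def field_simps)
  have "\<forall>\<^sub>F r in at_top. S r \<ge> max 0 (2 * C + 1)" using S unfolding filterlim_at_top by blast
  moreover note small[OF \<epsilon>(1)]
  moreover have "\<forall>\<^sub>F r in at_top. r \<ge> (1 :: real)" by (rule eventually_ge_at_top)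
  ultimately have "\<forall>\<^sub>F r in at_top. S r \<ge> max 0 (2 * C + 1) \<and> E r \<le> \<epsilon> * S r \<and> r \<ge> 1"
    by (intro eventually_conj)
  then obtain r where r: "S r \<ge> max 0 (2 * C + 1)" "E r \<le> \<epsilon> * S r" "r \<ge> 1"
    using eventually_happens'[OF trivial_limit_at_top_linorder] by blast
  have "M * E r \<le> M * (\<epsilon> * S r)" using r(2) M by (intro mult_left_mono)
  also have "\<dots> = M * \<epsilon> * S r" by (simp only: mult.assoc)
  also have "\<dots> \<le> 1 / 2 * S r" using \<epsilon>(2) r(1) by (intro mult_right_mono) auto
  finally show False using C[OF r(3)] r(1) by simp
qed

lemma wr3_1_swap: "wr3 1 z x = 0 \<longleftrightarrow> wr3 1 x z = 0"
  by (auto simp: wr3_1 mult.commute)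

lemma sharing_imp_equal:
  assumes f: "nonconst f" and g: "nonconst g" and \<alpha>: "mero \<alpha>" "\<alpha> \<noteq> 0"
    and small: "\<And>\<epsilon>. \<epsilon> > 0 \<Longrightarrow> \<forall>\<^sub>F r in at_top. Zc \<alpha> r + Nc \<alpha> r \<le> \<epsilon> * Tc f r"
      "\<And>\<epsilon>. \<epsilon> > 0 \<Longrightarrow> \<forall>\<^sub>F r in at_top. Zc \<alpha> r + Nc \<alpha> r \<le> \<epsilon> * Tc g r"
    and a: "a \<noteq> 0" and n: "n \<ge> 11"
    and share: "share_CM (Fop n a f) (Fop n a g) \<alpha>"
    and cond: "n \<ge> 12 \<or> lebd (err \<alpha>) (\<lambda>r. 3 * ln r)"
  shows "Fop n a f = Fop n a g"
proof (rule ccontr)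
  assume neq: "Fop n a f \<noteq> Fop n a g"
  \<comment> \<open>If one of F, G equals \<alpha>, the clause of \<open>share_CM\<close> on
    identically vanishing differences makes the other equal it as well, against F \<noteq>
    G.\<close>
  have ne: "Fop n a f \<noteq> \<alpha>" "Fop n a g \<noteq> \<alpha>"
    using share neq unfolding share_CM_def by auto
  have sh: "max 0 (omega z (Fop n a f - \<alpha>)) = max 0 (omega z (Fop n a g - \<alpha>))" for z
    using share unfolding share_CM_def by blast
  define E where "E = (\<lambda>r. Zc \<alpha> r + Nc \<alpha> r)"
  define S where "S = (\<lambda>r. Tc f r + Tc g r)"
  obtain K where K: "\<And>r. r \<ge> 1 \<Longrightarrow> max 0 (- ln (nrm r \<alpha>)) \<le> Nc \<alpha> r + K"
    using max0_nrm_le_Nc[OF \<alpha>] unfolding lebd_def by blast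
  have errE: "err \<alpha> r \<le> 2 * E r + K" if "r \<ge> 1" for r
    using K[OF that] by (simp add: err_def E_def)
  note Tf = Tc_unbounded[OF nonconst_mero[OF f] nonconst_neq[OF f]]
  note Tg = Tc_unbounded[OF nonconst_mero[OF g] nonconst_neq[OF g]]
  have T0: "Tc f r \<ge> 0" "Tc g r \<ge> 0" if "r \<ge> 1" for r
    using that f g by (auto intro!: Tc_nonneg nonconst_mero nonconst_nz)
  have Slim: "filterlim S at_top at_top" unfolding S_def using Tf Tg by (rule filterlim_at_top_add_at_top)
  have smallS: "\<forall>\<^sub>F r in at_top. E r \<le> \<epsilon> * S r" if "\<epsilon> > 0" for \<epsilon>
    using small(1)[OF that] eventually_ge_at_top[of 1]
  proof eventually_elim
    case (elim r)
    have "\<epsilon> * Tc g r \<ge> 0" using that T0(2)[OF elim(2)] by simp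
    thus ?case using elim(1) by (simp add: E_def S_def distrib_left)
  qed
  have no_prop: False
    if u: "nonconst u" and eq: "Fop n a u = fls_const c * \<alpha>"
      and sm: "\<And>\<epsilon>. \<epsilon> > 0 \<Longrightarrow> \<forall>\<^sub>F r in at_top. E r \<le> \<epsilon> * Tc u r" for u c
  proof (rule growth_absurd[OF Tc_unbounded[OF nonconst_mero[OF u] nonconst_neq[OF u]] _ _ sm])
    obtain C where C: "\<And>r. r \<ge> 1 \<Longrightarrow> real (n + 2) * Tc u r \<le> Tc u r + 2 * Zc \<alpha> r + Nc \<alpha> r + C"
      using Fop_proportional_ineq[OF u \<alpha> a n eq] unfolding lebd_def by blast
    show "lebd (Tc u) (\<lambda>r. 2 * E r)"
    proof (rule lebdI)
      fix r :: real assume r: "r \<ge> 1"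
      have "2 * Tc u r \<le> real (n + 2) * Tc u r"
        using r Tc_nonneg[OF nonconst_mero[OF u] nonconst_nz[OF u]] by (intro mult_right_mono) auto
      thus "Tc u r \<le> 2 * E r + C" using C[OF r] Nc_nonneg[OF \<alpha> r] by (simp add: E_def)
    qed
  qed auto
  have smE: "\<And>\<epsilon>. \<epsilon> > 0 \<Longrightarrow> \<forall>\<^sub>F r in at_top. E r \<le> \<epsilon> * Tc f r" "\<And>\<epsilon>. \<epsilon> > 0 \<Longrightarrow> \<forall>\<^sub>F r in at_top. E r \<le> \<epsilon> * Tc g r"
    using small by (auto simp: E_def)
  have nc: "nonconst (Fop n a u / \<alpha>)"
    if u: "nonconst u" and sm: "\<And>\<epsilon>. \<epsilon> > 0 \<Longrightarrow> \<forall>\<^sub>F r in at_top. E r \<le> \<epsilon> * Tc u r" for u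
    unfolding nonconst_def
  proof (intro conjI allI notI)
    show "mero (Fop n a u / \<alpha>)" using Fop_mero[OF u] \<alpha> by simp
    fix c assume "Fop n a u / \<alpha> = fls_const c"
    hence "Fop n a u = fls_const c * \<alpha>" using \<alpha> by (simp add: divide_eq_eq)
    thus False using no_prop[OF u _ sm] by blast
  qed
  note nf = nc[OF f smE(1)] and ng = nc[OF g smE(2)]
  have prod: "Fop n a f * Fop n a g \<noteq> \<alpha> ^ 2"
  proof
    assume "Fop n a f * Fop n a g = \<alpha> ^ 2"
    hence "lebd S (\<lambda>r. 4 * E r)" unfolding S_def E_def by (rule reciprocal_ineq[OF f g \<alpha> a n])
    thus False using growth_absurd[OF Slim _ _ smallS, of 4] by simp
  qed
  have n2: "k * S r \<le> real (n + 2) * S r" if "real (n + 2) \<ge> k" "r \<ge> 1" for k r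
    using that T0[OF that(2)] by (intro mult_right_mono) (auto simp: S_def)
  have nS: "real (n + 2) * S r = real (n + 2) * Tc f r + real (n + 2) * Tc g r" for r
    by (simp add: S_def distrib_left)
  define w where "w = wron (Fop n a f / \<alpha>) (Fop n a g / \<alpha>)"
  have swap: "wron (Fop n a g / \<alpha>) (Fop n a f / \<alpha>) = 0 \<longleftrightarrow> w = 0"
    unfolding w_def by (rule wr3_1_swap)
  show False
  proof (cases "w = 0")
    case True
    hence w: "wron (Fop n a f / \<alpha>) (Fop n a g / \<alpha>) = 0"
       "wron (Fop n a g / \<alpha>) (Fop n a f / \<alpha>) = 0"
      using swap by (simp_all add: w_def)
    obtain C1 where C1: "\<And>r. r \<ge> 1 \<Longrightarrow> real (n + 2) * Tc f r \<le>
        5 * Tc f r + 7 * Tc g r - 2 * ln r + err \<alpha> r + C1"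
      using degenerate_ineq[OF f g \<alpha> a n nf ng w(1) neq prod] unfolding lebd_def by blast
    obtain C2 where C2: "\<And>r. r \<ge> 1 \<Longrightarrow> real (n + 2) * Tc g r \<le>
        5 * Tc g r + 7 * Tc f r - 2 * ln r + err \<alpha> r + C2"
      using degenerate_ineq[OF g f \<alpha> a n ng nf w(2) neq[symmetric]] prod unfolding lebd_def by (auto simp: mult.commute)
    have sum: "real (n + 2) * S r \<le> 12 * S r - 4 * ln r + 2 * err \<alpha> r + (C1 + C2)" if "r \<ge> 1" for r
      using C1[OF that] C2[OF that] nS[of r] unfolding S_def distrib_left by linarith
    have "lebd S (\<lambda>r. 4 * E r)"
    proof (rule lebdI)
      fix r :: real assume r: "r \<ge> 1"
      have "ln r \<ge> 0" using r by simp
      moreover have "13 * S r \<le> real (n + 2) * S r" using n r by (intro n2) auto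
      ultimately show "S r \<le> 4 * E r + (C1 + C2 + 2 * K)"
        using sum[OF r] errE[OF r] by linarith
    qed
    thus False using growth_absurd[OF Slim _ _ smallS, of 4] by simp
  next
    case False
    hence w: "wron (Fop n a f / \<alpha>) (Fop n a g / \<alpha>) \<noteq> 0"
       "wron (Fop n a g / \<alpha>) (Fop n a f / \<alpha>) \<noteq> 0"
      using swap by (simp_all add: w_def)
    obtain C1 where C1: "\<And>r. r \<ge> 1 \<Longrightarrow> real (n + 2) * Tc f r \<le>
        6 * Tc f r + 7 * Tc g r - 4 * ln r + err \<alpha> r + C1"
      using main_ineq[OF f g \<alpha> a n ne sh w(1)] unfolding lebd_def by blast
    obtain C2 where C2: "\<And>r. r \<ge> 1 \<Longrightarrow> real (n + 2) * Tc g r \<le>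
        6 * Tc g r + 7 * Tc f r - 4 * ln r + err \<alpha> r + C2"
      using main_ineq[OF g f \<alpha> a n ne(2,1) sh[symmetric] w(2)] unfolding lebd_def by blast
    have sum: "real (n + 2) * S r \<le> 13 * S r - 8 * ln r + 2 * err \<alpha> r + (C1 + C2)" if "r \<ge> 1" for r
      using C1[OF that] C2[OF that] nS[of r] unfolding S_def distrib_left by linarith
    from cond show False
    proof
      assume "n \<ge> 12"
      have "lebd S (\<lambda>r. 4 * E r)"
      proof (rule lebdI)
        fix r :: real assume r: "r \<ge> 1"
        have "ln r \<ge> 0" using r by simp
        moreover have "14 * S r \<le> real (n + 2) * S r" using \<open>n \<ge> 12\<close> r by (intro n2) auto
        ultimately show "S r \<le> 4 * E r + (C1 + C2 + 2 * K)"
          using sum[OF r] errE[OF r] by linarith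
      qed
      thus False using growth_absurd[OF Slim _ _ smallS, of 4] by simp
    next
      assume "lebd (err \<alpha>) (\<lambda>r. 3 * ln r)"
      then obtain D where D: "\<And>r. r \<ge> 1 \<Longrightarrow> err \<alpha> r \<le> 3 * ln r + D" unfolding lebd_def by blast
      \<comment> \<open>The characteristics cancel here, leaving 2 ln r \<le> C1 + C2 + 2 D from - 8
        ln r + 2 (3 ln r); this radius violates it.\<close>
      define r where "r = exp (\<bar>C1 + C2 + 2 * D\<bar> + 1)"
      have r: "r \<ge> 1" "ln r = \<bar>C1 + C2 + 2 * D\<bar> + 1" by (auto simp: r_def)
      have "13 * S r \<le> real (n + 2) * S r" using n r by (intro n2) auto
      thus False using sum[OF r(1)] D[OF r(1)] r(2) by linarith
    qed
  qed
qed

lemma Fop_eq_imp_Pop_eq: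
  assumes f: "nonconst f" and g: "nonconst g" and a: "a \<noteq> 0" and n: "n \<ge> 11"
    and eq: "Fop n a f = Fop n a g"
  shows "Pop n a f = Pop n a g"
proof -
  have "fls_deriv (Pop n a f - Pop n a g) = 0" using eq by (simp add: deriv_Pop)
  then obtain d where d: "Pop n a f - Pop n a g = fls_const d" unfolding fls_deriv_eq_0_iff by blast
  have "d = 0"
  proof (rule ccontr)
    assume d0: "d \<noteq> 0"
    have e1: "Pop n a f - fls_const d = Pop n a g" using d by (simp add: algebra_simps)
    have e2: "Pop n a g - fls_const (- d) = Pop n a f" using d by (simp add: algebra_simps)
    obtain C1 where C1: "\<And>r. r \<ge> 1 \<Longrightarrow> real (n + 2) * Tc f r \<le> 3 * Tc f r + 2 * Tc g r + C1"
      using Pop_diff_const_ineq[OF f g a e1 d0] unfolding lebd_def by blast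
    obtain C2 where C2: "\<And>r. r \<ge> 1 \<Longrightarrow> real (n + 2) * Tc g r \<le> 3 * Tc g r + 2 * Tc f r + C2"
      using Pop_diff_const_ineq[OF g f a e2] d0 unfolding lebd_def by auto
    have T0: "Tc f r \<ge> 0" "Tc g r \<ge> 0" if "r \<ge> 1" for r
      using that f g by (auto intro!: Tc_nonneg nonconst_mero nonconst_nz)
    have lim: "filterlim (\<lambda>r. Tc f r + Tc g r) at_top at_top"
      using Tc_unbounded[OF nonconst_mero[OF f] nonconst_neq[OF f]]
        Tc_unbounded[OF nonconst_mero[OF g] nonconst_neq[OF g]] by (rule filterlim_at_top_add_at_top)
    \<comment> \<open>Adding both inequalities compares n + 2 with 3 + 2 = 5, so 6 is already enough
      to bound the sum. The product 0 * 0 is the form of \<open>growth_absurd\<close> with M = 0 and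
      E = 0.\<close>
    have le: "lebd (\<lambda>r. Tc f r + Tc g r) (\<lambda>r. 0 * 0)"
    proof (rule lebdI)
      fix r :: real assume r: "r \<ge> 1"
      have "6 * Tc f r \<le> real (n + 2) * Tc f r" "6 * Tc g r \<le> real (n + 2) * Tc g r"
        using n T0[OF r] by (auto intro!: mult_right_mono)
      thus "Tc f r + Tc g r \<le> 0 * 0 + (C1 + C2)" using C1[OF r] C2[OF r] by linarith
    qed
    show False
    proof (rule growth_absurd[OF lim order_refl le])
      fix \<epsilon> :: real assume "\<epsilon> > 0"
      hence "0 \<le> \<epsilon> * (Tc f r + Tc g r)" if "r \<ge> 1" for r using T0[OF that] by simp
      thus "\<forall>\<^sub>F r in at_top. 0 \<le> \<epsilon> * (Tc f r + Tc g r)"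
        unfolding eventually_at_top_linorder by blast
    qed
  qed
  thus ?thesis using d by simp
qed

theorem theorem9:
  fixes f g \<alpha> :: "'a::{ultrametric_field, complete_space, alg_closed_field, field_char_0} fls"
    and a :: 'a and n :: nat
  assumes "transcendental_fun f" and "transcendental_fun g"
    and "meromorphic_fun \<alpha>" and "\<alpha> \<noteq> 0"
    and "small_wrt \<alpha> f" and "small_wrt \<alpha> g"
    and "a \<noteq> 0" and "n > 0"
    and "share_CM (fls_deriv f * f ^ n * (f - fls_const a))
                  (fls_deriv g * g ^ n * (g - fls_const a)) \<alpha>"
  shows "(n \<ge> 12 \<longrightarrow>
          (f = g \<or>
            (\<exists>h. meromorphic_fun h \<and>
               f = fls_const (a * of_nat (n + 2) / of_nat (n + 1))
                     * ((h ^ (n + 1) - 1) / (h ^ (n + 2) - 1)) * h \<and>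
               g = fls_const (a * of_nat (n + 2) / of_nat (n + 1))
                     * ((h ^ (n + 1) - 1) / (h ^ (n + 2) - 1))))) \<and>
         ((\<exists>b. b \<noteq> 0 \<and> \<alpha> = fls_const b) \<or> moebius_fun \<alpha> \<longrightarrow> n \<ge> 11 \<longrightarrow>
          (f = g \<or>
            (\<exists>h. meromorphic_fun h \<and>
               f = fls_const (a * of_nat (n + 2) / of_nat (n + 1))
                     * ((h ^ (n + 1) - 1) / (h ^ (n + 2) - 1)) * h \<and>
               g = fls_const (a * of_nat (n + 2) / of_nat (n + 1))
                     * ((h ^ (n + 1) - 1) / (h ^ (n + 2) - 1)))))"
proof -
  have f: "nonconst f" and g: "nonconst g"
    using assms(1,2) transcendental_nonconst[OF assms(1)] transcendental_nonconst[OF assms(2)]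
    by (auto simp: nonconst_def transcendental_fun_def)
  have "f = g \<or> (\<exists>h. meromorphic_fun h \<and>
     f = fls_const (bval n a) * ((h ^ (n + 1) - 1) / (h ^ (n + 2) - 1)) * h \<and>
     g = fls_const (bval n a) * ((h ^ (n + 1) - 1) / (h ^ (n + 2) - 1)))"
    if n: "n \<ge> 11" and cond: "n \<ge> 12 \<or> lebd (err \<alpha>) (\<lambda>r. 3 * ln r)"
  proof -
    have "Fop n a f = Fop n a g"
      using sharing_imp_equal[OF f g assms(3,4) small_wrt_bound[OF assms(5,1,3,4)]
        small_wrt_bound[OF assms(6,2,3,4)] assms(7) n _ cond] assms(9) by (simp add: Fop_def)
    hence "Pop n a f = Pop n a g" by (rule Fop_eq_imp_Pop_eq[OF f g assms(7) n])
    thus ?thesis by (rule Pop_eq_conclusion[OF f g assms(7)])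
  qed
  note main = this[unfolded bval_def]
  show ?thesis by (intro conjI impI main) (auto intro: special_error)
qed

end
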